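(* There exist infinitely many pairs $(M_1,M_2)$ of spherical space forms such that $M_1$ and $M_2$ are isospectral and the fundamental groups of $M_1$ and $M_2$ are not isomorphic.
   Context: A spherical space form is a Riemannian manifold of the form $S^q/G$, where $q\geq 2$, $S^q$ is the unit sphere in $\mathbb{R}^{q+1}$ with its round metric of constant sectional curvature $1$, and $G$ is a finite subgroup of the orthogonal group $\mathrm{O}(q+1)$ acting freely on $S^q$; the quotient carries the induced metric of constant sectional curvature $1$. (Its fundamental group is isomorphic to $G$.) For a compact Riemannian manifold $(M,g)$, $\mathrm{Spec}(M,g)$ is the collection of eigenvalues, counted with multiplicity, of the Laplace–Beltrami operator on functions. Two compact Riemannian manifolds are isospectral if their spectra coincide. Pairs are counted up to isometry of their members. *)

theory Defs
  imports
    "HOL-Library.Function_Algebras"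
    "HOL-Analysis.Derivative"
    "HOL-Analysis.Abstract_Euclidean_Space"
    "Jordan_Normal_Form.Determinant"
begin

text \<open>
  The dimension is a number that varies inside the statement, so points of $\mathbb{R}^n$ are
  functions \<open>nat \<Rightarrow> real\<close> vanishing from index \<open>n\<close> on, topologised by the library's
  \<^const>\<open>Euclidean_space\<close>; correspondingly \<open>nsphere q\<close> is the unit sphere of $\mathbb{R}^{q+1}$.
\<close>

section \<open>Smooth functions on open subsets of Euclidean space\<close>

definition pderiv_at :: "nat \<Rightarrow> ((nat \<Rightarrow> real) \<Rightarrow> real) \<Rightarrow> (nat \<Rightarrow> real) \<Rightarrow> real" where
  "pderiv_at i f x = deriv (\<lambda>t. f (x(i := t))) (x i)"

primrec C_on :: "nat \<Rightarrow> nat \<Rightarrow> (nat \<Rightarrow> real) set \<Rightarrow> ((nat \<Rightarrow> real) \<Rightarrow> real) \<Rightarrow> bool" where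
  "C_on n 0 U f \<longleftrightarrow> continuous_map (subtopology (Euclidean_space n) U) euclideanreal f"
| "C_on n (Suc k) U f \<longleftrightarrow>
     continuous_map (subtopology (Euclidean_space n) U) euclideanreal f \<and>
     (\<forall>i<n. (\<forall>x\<in>U. (\<lambda>t. f (x(i := t))) differentiable (at (x i))) \<and>
            C_on n k U (pderiv_at i f))"

definition smooth_on_open :: "nat \<Rightarrow> (nat \<Rightarrow> real) set \<Rightarrow> ((nat \<Rightarrow> real) \<Rightarrow> real) \<Rightarrow> bool" where
  "smooth_on_open n U f \<longleftrightarrow> openin (Euclidean_space n) U \<and> (\<forall>k. C_on n k U f)"

section \<open>Spherical space forms\<close>

definition orthogonal_group :: "nat \<Rightarrow> real mat monoid" where
  "orthogonal_group n =
     \<lparr>carrier = {A \<in> carrier_mat n n. transpose_mat A * A = 1\<^sub>m n},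
      monoid.mult = (\<lambda>A B. A * B), one = 1\<^sub>m n\<rparr>"

definition mat_act :: "real mat \<Rightarrow> (nat \<Rightarrow> real) \<Rightarrow> (nat \<Rightarrow> real)" where
  "mat_act A x = (\<lambda>i. if i < dim_row A then \<Sum>j<dim_col A. A $$ (i, j) * x j else 0)"

text \<open>The space form $S^q/G$ is represented by the pair \<open>(q, G)\<close>.\<close>

type_synonym space_form = "nat \<times> real mat set"

definition spherical_space_form :: "space_form \<Rightarrow> bool" where
  "spherical_space_form M \<longleftrightarrow> (case M of (q, G) \<Rightarrow>
     q \<ge> 2 \<and> subgroup G (orthogonal_group (q + 1)) \<and> finite G \<and>
     (\<forall>A\<in>G. A \<noteq> 1\<^sub>m (q + 1) \<longrightarrow> (\<forall>x\<in>topspace (nsphere q). mat_act A x \<noteq> x)))"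

definition proj :: "space_form \<Rightarrow> (nat \<Rightarrow> real) \<Rightarrow> (nat \<Rightarrow> real) set" where
  "proj M x = (\<lambda>A. mat_act A x) ` snd M"

definition points :: "space_form \<Rightarrow> (nat \<Rightarrow> real) set set" where
  "points M = proj M ` topspace (nsphere (fst M))"

definition quotient_top :: "space_form \<Rightarrow> (nat \<Rightarrow> real) set topology" where
  "quotient_top M = topology (\<lambda>V. V \<subseteq> points M \<and>
     openin (nsphere (fst M)) {x \<in> topspace (nsphere (fst M)). proj M x \<in> V})"

section \<open>The Riemannian structure\<close>

text \<open>
  A local parametrization of $S^q/G$ is given through a lift \<open>\<sigma>\<close> to the sphere: the
  parametrization itself is \<open>proj M \<circ> \<sigma>\<close>.  Every point of the quotient is covered by such
  parametrizations since the projection is a covering.  As the projection is a local isometry,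
  the coefficients of the induced metric are
  $g_{ij} = \langle \partial_i \sigma, \partial_j \sigma \rangle$.
\<close>

definition metric_mat :: "nat \<Rightarrow> ((nat \<Rightarrow> real) \<Rightarrow> (nat \<Rightarrow> real)) \<Rightarrow> (nat \<Rightarrow> real) \<Rightarrow> real mat" where
  "metric_mat q \<sigma> u = Matrix.mat q q (\<lambda>(i, j).
     \<Sum>k\<le>q. pderiv_at i (\<lambda>v. \<sigma> v k) u * pderiv_at j (\<lambda>v. \<sigma> v k) u)"

text \<open>The Gram matrix is nonsingular exactly where \<open>\<sigma>\<close> is an immersion.\<close>

definition parametrization ::
    "space_form \<Rightarrow> (nat \<Rightarrow> real) set \<Rightarrow> ((nat \<Rightarrow> real) \<Rightarrow> (nat \<Rightarrow> real)) \<Rightarrow> bool" where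
  "parametrization M U \<sigma> \<longleftrightarrow>
     openin (Euclidean_space (fst M)) U \<and>
     \<sigma> ` U \<subseteq> topspace (nsphere (fst M)) \<and>
     (\<forall>k\<le>fst M. smooth_on_open (fst M) U (\<lambda>u. \<sigma> u k)) \<and>
     (\<forall>u\<in>U. Determinant.det (metric_mat (fst M) \<sigma> u) \<noteq> 0) \<and>
     inj_on (proj M \<circ> \<sigma>) U"

text \<open>
  The coordinate expression
  $\frac{1}{\sqrt{\det g}} \sum_{i,j} \partial_i (\sqrt{\det g} g^{ij} \partial_j f)$
  of the Laplace--Beltrami operator, where $(g^{ij})$ is the inverse matrix of $(g_{ij})$.
\<close>

definition inv_metric :: "nat \<Rightarrow> ((nat \<Rightarrow> real) \<Rightarrow> (nat \<Rightarrow> real)) \<Rightarrow> (nat \<Rightarrow> real) \<Rightarrow> real mat" where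
  "inv_metric q \<sigma> u = (1 / Determinant.det (metric_mat q \<sigma> u)) \<cdot>\<^sub>m adj_mat (metric_mat q \<sigma> u)"

definition laplace_beltrami ::
    "nat \<Rightarrow> ((nat \<Rightarrow> real) \<Rightarrow> (nat \<Rightarrow> real)) \<Rightarrow> ((nat \<Rightarrow> real) \<Rightarrow> real) \<Rightarrow> (nat \<Rightarrow> real) \<Rightarrow> real" where
  "laplace_beltrami q \<sigma> f u =
     (1 / sqrt (Determinant.det (metric_mat q \<sigma> u))) *
     (\<Sum>i<q. \<Sum>j<q. pderiv_at i (\<lambda>v.
        sqrt (Determinant.det (metric_mat q \<sigma> v)) * inv_metric q \<sigma> v $$ (i, j) * pderiv_at j f v) u)"

section \<open>The spectrum\<close>

text \<open>
  The smooth functions on $S^q/G$ with $-\Delta f = \lambda f$.  Functions on the quotient are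
  normalised to be 0 off its points, so that the eigenspace is a space of functions on
  $S^q/G$ proper.
\<close>

definition eigenspace :: "space_form \<Rightarrow> real \<Rightarrow> ((nat \<Rightarrow> real) set \<Rightarrow> real) set" where
  "eigenspace M l = {f.
     (\<forall>P. P \<notin> points M \<longrightarrow> f P = 0) \<and>
     (\<forall>U \<sigma>. parametrization M U \<sigma> \<longrightarrow>
        smooth_on_open (fst M) U (f \<circ> proj M \<circ> \<sigma>) \<and>
        (\<forall>u\<in>U. - laplace_beltrami (fst M) \<sigma> (f \<circ> proj M \<circ> \<sigma>) u = l * f (proj M (\<sigma> u))))}"

text \<open>
  The spectrum is recorded as the multiplicity function; \<open>l\<close> is an eigenvalue iff its
  multiplicity is nonzero.  (Eigenspaces on compact manifolds are finite-dimensional, so the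
  library's convention for the dimension of infinite-dimensional spaces plays no role.)
\<close>

definition Spec :: "space_form \<Rightarrow> real \<Rightarrow> nat" where
  "Spec M l = vector_space.dim (\<lambda>(c::real) f x. c * f x) (eigenspace M l)"

definition isospectral :: "space_form \<Rightarrow> space_form \<Rightarrow> bool" where
  "isospectral M N \<longleftrightarrow> Spec M = Spec N"

section \<open>Isometries\<close>

text \<open>
  A Riemannian isometry is a bijection which near every point is, in suitable local coordinates,
  the identity map, with equal metric coefficients on both sides.  (Open subsets of Euclidean
  spaces of different dimensions are never equal unless empty, so dimensions must agree.)
\<close>

definition isometric :: "space_form \<Rightarrow> space_form \<Rightarrow> bool" where
  "isometric M N \<longleftrightarrow> (\<exists>\<Phi>. bij_betw \<Phi> (points M) (points N) \<and>
     (\<forall>P\<in>points M. \<exists>U \<sigma> \<tau>. parametrization M U \<sigma> \<and> parametrization N U \<tau> \<and>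
        P \<in> (proj M \<circ> \<sigma>) ` U \<and>
        (\<forall>u\<in>U. \<Phi> (proj M (\<sigma> u)) = proj N (\<tau> u) \<and>
               metric_mat (fst M) \<sigma> u = metric_mat (fst N) \<tau> u)))"

section \<open>The fundamental group\<close>

definition loops :: "'a topology \<Rightarrow> 'a \<Rightarrow> (real \<Rightarrow> 'a) set" where
  "loops X x = {p. pathin X p \<and> p 0 = x \<and> p 1 = x}"

definition homotopic_loops_at :: "'a topology \<Rightarrow> 'a \<Rightarrow> (real \<Rightarrow> 'a) \<Rightarrow> (real \<Rightarrow> 'a) \<Rightarrow> bool" where
  "homotopic_loops_at X x p q \<longleftrightarrow>
     homotopic_with (\<lambda>r. r 0 = x \<and> r 1 = x) (top_of_set {0..1}) X p q"

definition loop_class :: "'a topology \<Rightarrow> 'a \<Rightarrow> (real \<Rightarrow> 'a) \<Rightarrow> (real \<Rightarrow> 'a) set" where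
  "loop_class X x p = {q \<in> loops X x. homotopic_loops_at X x p q}"

text \<open>The library's concatenation of paths requires a type with a fixed topology.\<close>

definition loop_concat :: "(real \<Rightarrow> 'a) \<Rightarrow> (real \<Rightarrow> 'a) \<Rightarrow> real \<Rightarrow> 'a" where
  "loop_concat p q = (\<lambda>t. if t \<le> 1/2 then p (2 * t) else q (2 * t - 1))"

definition fundamental_group :: "'a topology \<Rightarrow> 'a \<Rightarrow> (real \<Rightarrow> 'a) set monoid" where
  "fundamental_group X x =
     \<lparr>carrier = loop_class X x ` loops X x,
      monoid.mult = (\<lambda>a b. \<Union>p\<in>a. \<Union>q\<in>b. loop_class X x (loop_concat p q)),
      one = loop_class X x (\<lambda>_. x)\<rparr>"

text \<open>Space forms are path connected, so the choice of base points is immaterial.\<close>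

definition isomorphic_fundamental_groups :: "space_form \<Rightarrow> space_form \<Rightarrow> bool" where
  "isomorphic_fundamental_groups M N \<longleftrightarrow>
     (\<exists>P\<in>points M. \<exists>Q\<in>points N.
        fundamental_group (quotient_top M) P \<cong> fundamental_group (quotient_top N) Q)"

text \<open>Equality of (unordered) pairs up to isometry of their members.\<close>

definition isometric_pairs :: "space_form \<times> space_form \<Rightarrow> space_form \<times> space_form \<Rightarrow> bool" where
  "isometric_pairs p p' \<longleftrightarrow>
     (isometric (fst p) (fst p') \<and> isometric (snd p) (snd p')) \<or>
     (isometric (fst p) (snd p') \<and> isometric (snd p) (fst p'))"

end

theory Submission
  imports Defs "HOL-Analysis.Analysis" "HOL-Number_Theory.Cong"
begin

text \<open>
  The groups are metacyclic of order $819 = 91 \cdot 9$: each is generated by $A$ of order 91 and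
  $B$ of order 9 such that $B$ acts on $\langle A\rangle$ through a subgroup of order 3 of
  $(\mathbb{Z}/91)^\times$, generated by 16 for the first group and by 9 for the second one.
  These subgroups differ, so the groups are not isomorphic.  Both groups act on
  $\mathbb{C}^9$, whose coordinates are indexed by $\{0,1,2\}^2$: $A$ acts on the coordinate $(i, j)$
  by $e^{2\pi\mathrm{i}\, 16^i 9^j / 91}$, whereas $B$ is $e^{2\pi\mathrm{i}/9}$ times the cyclic shift
  of $i$, respectively of $j$.  Elements $A^a B^b$ with $3 \mid b$ are the same matrices in
  both groups.  If $3 \nmid b$, then $A^a B^b$ is conjugate to $B^b$, and the two versions of $B^b$
  are conjugate by the exchange of $i$ and $j$.  So the groups are almost conjugate inside the finite
  group of monomial matrices with entries of order dividing 819, and Sunada's argument gives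
  isospectrality.  Taking $k$ copies of this representation gives space forms of dimension $18k-1$ for
  every $k \geq 1$, which are pairwise not isometric for dimension reasons.
\<close>

section \<open>The round sphere as a subspace of Euclidean space\<close>

text \<open>Both primes in 91 = 7 * 13 are 1 modulo 3, so the units modulo 91 have several subgroups
  of order 3. By residues modulo 7 and 13, 16 is (2, 3) and 9 is (2, 9). Both are nontrivial modulo
  each prime, so 1 - r and 1 - r^2 are units for r = 16 and r = 9; this is why A^a B^b is conjugate
  to B^b when 3 does not divide b. B has order 9, although it acts through order 3, because its cube
  must be a scalar other than 1 for the action to be free. Eigenvalues of the sphere are never
  computed: eigenfunctions on a quotient are the invariant eigenfunctions on the sphere, and
  dimensions of invariants are averages of traces. Two obstacles shape the rest. Eigenspaces are not
  known to be finite-dimensional, so traces are taken on finite-dimensional invariant subspaces. The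
  fundamental group belongs to an abstract orbit space, so loops are lifted with a uniform
  separation constant in place of evenly covered sets, and the sphere is shown to be simply
  connected by polynomial approximation and stereographic projection.\<close>

lemma Euclidean_space_eq_top_of_set: "Euclidean_space n = top_of_set {x. \<forall>i\<ge>n. x i = 0}"
  by (simp add: Euclidean_space_def euclidean_product_topology)

lemma topspace_nsphere: "topspace (nsphere q) = {x. (\<Sum>i\<le>q. (x i)\<^sup>2) = 1 \<and> (\<forall>i>q. x i = 0)}"
  by (simp add: nsphere)

text \<open>The type \<open>nat \<Rightarrow> real\<close> carries the product topology and the
  sphere its subspace topology, so \<open>continuous_on\<close> and \<open>compact\<close> become
  available for the abstract topology \<open>nsphere q\<close>.\<close>

lemma nsphere_eq_top_of_set: "nsphere q = top_of_set (topspace (nsphere q))"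
  unfolding topspace_nsphere by (simp add: nsphere euclidean_product_topology)

lemma continuous_on_coordinate: "continuous_on S (\<lambda>x. x i :: real)"
  by (rule continuous_on_subset[OF continuous_on_product_coordinates]) simp

lemma continuous_on_apply:
  assumes "continuous_on S f"
  shows "continuous_on S (\<lambda>x. f x i :: real)"
  using continuous_on_product_then_coordinatewise[OF assms] .

lemma topspace_nsphere_subset_Euclidean: "topspace (nsphere q) \<subseteq> topspace (Euclidean_space (Suc q))"
  by (auto simp: topspace_nsphere topspace_Euclidean_space)

text \<open>A closed subset of a product of intervals [-1, 1], which is compact by Tychonoff; the
  infinitely many coordinates beyond \<open>q\<close> vanish and so lie in the interval too.\<close>

lemma compact_topspace_nsphere: "compact (topspace (nsphere q))"
proof -
  have K: "compactin (powertop_real UNIV) (PiE UNIV (\<lambda>_. {-1..1::real}))"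
    unfolding compactin_PiE by auto
  have closed: "closed (topspace (nsphere q))"
  proof -
    have eq: "topspace (nsphere q) = {x. (\<Sum>i\<le>q. (x i)\<^sup>2) = 1} \<inter> (\<Inter>i\<in>{q<..}. {x. x i = 0})"
      by (auto simp: topspace_nsphere)
    show ?thesis unfolding eq
      by (intro closed_Int closed_INT ballI closed_Collect_eq continuous_intros continuous_on_coordinate)
  qed
  have "topspace (nsphere q) \<subseteq> PiE UNIV (\<lambda>_. {-1..1::real})"
  proof
    fix x assume "x \<in> topspace (nsphere q)"
    then have x: "(\<Sum>i\<le>q. (x i)\<^sup>2) = 1" "\<And>i. i > q \<Longrightarrow> x i = 0" by (auto simp: topspace_nsphere)
    have "\<bar>x i\<bar> \<le> 1" for i
    proof (cases "i \<le> q")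
      case True
      then have "(x i)\<^sup>2 \<le> (\<Sum>i\<le>q. (x i)\<^sup>2)" by (intro member_le_sum) auto
      then show ?thesis using x abs_square_le_1 by metis
    qed (use x in auto)
    then show "x \<in> PiE UNIV (\<lambda>_. {-1..1::real})" by (auto simp: abs_le_iff minus_le_iff)
  qed
  then show ?thesis
    using closed_compactin[OF K] closed by (simp add: euclidean_product_topology flip: closed_closedin)
qed

text \<open>Euclidean distance of the first \<open>q + 1\<close> coordinates: it separates the
  points of the sphere, and orthogonal matrices preserve it.\<close>

definition edist :: "nat \<Rightarrow> (nat \<Rightarrow> real) \<Rightarrow> (nat \<Rightarrow> real) \<Rightarrow> real" where
  "edist q x y = L2_set (\<lambda>i. x i - y i) {..q}"

lemma edist_self [simp]: "edist q x x = 0"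
  by (simp add: edist_def L2_set_def)

lemma edist_nonneg [simp]: "0 \<le> edist q x y"
  by (simp add: edist_def)

lemma edist_commute: "edist q x y = edist q y x"
  by (simp add: edist_def L2_set_def power2_commute)

lemma edist_triangle: "edist q x z \<le> edist q x y + edist q y z"
  using L2_set_triangle_ineq[of "\<lambda>i. x i - y i" "\<lambda>i. y i - z i" "{..q}"] by (simp add: edist_def)

lemma edist_eq_0_iff:
  assumes "x \<in> topspace (nsphere q)" "y \<in> topspace (nsphere q)"
  shows "edist q x y = 0 \<longleftrightarrow> x = y"
proof
  assume "edist q x y = 0"
  then have "\<And>i. i \<le> q \<Longrightarrow> x i = y i" by (simp add: edist_def L2_set_eq_0_iff)
  then show "x = y" using assms by (intro ext) (metis (mono_tags, lifting) topspace_nsphere mem_Collect_eq not_le)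
qed simp

lemma continuous_on_edist:
  assumes "continuous_on S f" "continuous_on S g"
  shows "continuous_on S (\<lambda>x. edist q (f x) (g x))"
  unfolding edist_def L2_set_def
  by (intro continuous_intros continuous_on_apply[OF assms(1)] continuous_on_apply[OF assms(2)])

lemma openin_nsphere_edist_ball:
  "openin (nsphere q) {y \<in> topspace (nsphere q). edist q x y < e}"
proof -
  let ?S = "topspace (nsphere q)"
  have "continuous_on ?S (\<lambda>y. edist q x y)" by (intro continuous_on_edist continuous_intros)
  then have "openin (top_of_set ?S) (?S \<inter> (\<lambda>y. edist q x y) -` {..<e})"
    by (simp add: continuous_openin_preimage_gen)
  moreover have "?S \<inter> (\<lambda>y. edist q x y) -` {..<e} = {y \<in> ?S. edist q x y < e}" by auto
  ultimately have "openin (top_of_set ?S) {y \<in> ?S. edist q x y < e}" by simp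
  then show ?thesis by (subst nsphere_eq_top_of_set)
qed

section \<open>Orthogonal actions on the sphere\<close>

lemma carrier_orthogonal_group:
  "A \<in> carrier (orthogonal_group n) \<longleftrightarrow> A \<in> carrier_mat n n \<and> transpose_mat A * A = 1\<^sub>m n"
  by (simp add: orthogonal_group_def)

lemma mult_orthogonal_group [simp]: "A \<otimes>\<^bsub>orthogonal_group n\<^esub> B = A * B"
  by (simp add: orthogonal_group_def)

lemma one_orthogonal_group [simp]: "\<one>\<^bsub>orthogonal_group n\<^esub> = 1\<^sub>m n"
  by (simp add: orthogonal_group_def)

lemma transpose_in_orthogonal_group:
  assumes "A \<in> carrier (orthogonal_group n)"
  shows "transpose_mat A \<in> carrier (orthogonal_group n)"
  using assms mat_mult_left_right_inverse[of "transpose_mat A" n A]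
  by (simp add: carrier_orthogonal_group)

lemma group_orthogonal_group: "group (orthogonal_group n)"
proof (rule groupI)
  fix A B assume A: "A \<in> carrier (orthogonal_group n)" and B: "B \<in> carrier (orthogonal_group n)"
  then have c: "A \<in> carrier_mat n n" "B \<in> carrier_mat n n" by (auto simp: carrier_orthogonal_group)
  have "transpose_mat (A * B) * (A * B) = transpose_mat B * (transpose_mat A * A) * B"
    using c by (simp add: transpose_mult[of _ n n _ n] assoc_mult_mat[of _ n n _ n _ n])
  then show "A \<otimes>\<^bsub>orthogonal_group n\<^esub> B \<in> carrier (orthogonal_group n)"
    using A B c by (simp add: carrier_orthogonal_group)
next
  fix A assume A: "A \<in> carrier (orthogonal_group n)"
  show "\<exists>y\<in>carrier (orthogonal_group n). y \<otimes>\<^bsub>orthogonal_group n\<^esub> A = \<one>\<^bsub>orthogonal_group n\<^esub>"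
    using transpose_in_orthogonal_group[OF A] A by (auto simp: carrier_orthogonal_group)
qed (auto simp: carrier_orthogonal_group assoc_mult_mat[of _ n n _ n _ n])

lemma mat_act_apply: "A \<in> carrier_mat n n \<Longrightarrow> mat_act A x i = (if i < n then \<Sum>j<n. A $$ (i, j) * x j else 0)"
  by (simp add: mat_act_def)

lemma mat_act_mult:
  assumes "A \<in> carrier_mat n n" "B \<in> carrier_mat n n"
  shows "mat_act (A * B) x = mat_act A (mat_act B x)"
proof
  fix i
  show "mat_act (A * B) x i = mat_act A (mat_act B x) i"
  proof (cases "i < n")
    case True
    have "mat_act (A * B) x i = (\<Sum>j<n. (\<Sum>k<n. A $$ (i, k) * B $$ (k, j)) * x j)"
      using assms True by (simp add: mat_act_def scalar_prod_def atLeast0LessThan)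
    also have "\<dots> = (\<Sum>k<n. \<Sum>j<n. A $$ (i, k) * B $$ (k, j) * x j)"
      by (subst sum.swap) (simp add: sum_distrib_right)
    also have "\<dots> = mat_act A (mat_act B x) i"
      using assms True by (simp add: mat_act_def sum_distrib_left mult.assoc)
    finally show ?thesis .
  qed (use assms in \<open>simp add: mat_act_def\<close>)
qed

lemma mat_act_one:
  assumes "x \<in> topspace (Euclidean_space n)"
  shows "mat_act (1\<^sub>m n) x = x"
proof
  fix i
  show "mat_act (1\<^sub>m n) x i = x i"
  proof (cases "i < n")
    case True
    then have "mat_act (1\<^sub>m n) x i = (\<Sum>j<n. if i = j then x j else 0)"
      by (simp add: mat_act_def if_distrib[of "\<lambda>c. c * _"] cong: if_cong)
    then show ?thesis using True by simp
  qed (use assms in \<open>auto simp: mat_act_def topspace_Euclidean_space\<close>)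
qed

lemma mat_act_inner:
  assumes "A \<in> carrier (orthogonal_group n)"
  shows "(\<Sum>k<n. mat_act A x k * mat_act A y k) = (\<Sum>k<n. x k * y k)"
proof -
  have A: "A \<in> carrier_mat n n" and o: "transpose_mat A * A = 1\<^sub>m n"
    using assms by (auto simp: carrier_orthogonal_group)
  have ent: "(\<Sum>k<n. A $$ (k, i) * A $$ (k, j)) = (if i = j then 1 else 0)" if "i < n" "j < n" for i j
  proof -
    have "(transpose_mat A * A) $$ (i, j) = (\<Sum>k<n. A $$ (k, i) * A $$ (k, j))"
      using A that by (simp add: scalar_prod_def atLeast0LessThan)
    then show ?thesis using o that by simp
  qed
  have "(\<Sum>k<n. mat_act A x k * mat_act A y k)
      = (\<Sum>k<n. \<Sum>i<n. \<Sum>j<n. (A $$ (k, i) * A $$ (k, j)) * (x i * y j))"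
    using A by (simp add: mat_act_def sum_product mult_ac)
  also have "\<dots> = (\<Sum>i<n. \<Sum>j<n. (\<Sum>k<n. A $$ (k, i) * A $$ (k, j)) * (x i * y j))"
    by (subst sum.swap, rule sum.cong[OF refl], subst sum.swap) (simp add: sum_distrib_right)
  also have "\<dots> = (\<Sum>i<n. \<Sum>j<n. if i = j then x i * y j else 0)"
    by (intro sum.cong refl) (simp add: ent)
  also have "\<dots> = (\<Sum>k<n. x k * y k)" by simp
  finally show ?thesis .
qed

lemma mat_act_diff:
  "mat_act A (\<lambda>i. x i - y i) = (\<lambda>i. mat_act A x i - mat_act A y i)"
  by (auto simp: mat_act_def fun_eq_iff right_diff_distrib sum_subtractf)

lemma mat_act_nsphere:
  assumes "A \<in> carrier (orthogonal_group (q + 1))" "x \<in> topspace (nsphere q)"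
  shows "mat_act A x \<in> topspace (nsphere q)"
  using assms mat_act_inner[OF assms(1), of x x]
  by (auto simp: topspace_nsphere power2_eq_square lessThan_Suc_atMost mat_act_def carrier_orthogonal_group)

lemma edist_mat_act:
  assumes "A \<in> carrier (orthogonal_group (q + 1))"
  shows "edist q (mat_act A x) (mat_act A y) = edist q x y"
  using mat_act_inner[OF assms, of "\<lambda>i. x i - y i" "\<lambda>i. x i - y i"]
  by (simp add: edist_def L2_set_def power2_eq_square lessThan_Suc_atMost mat_act_diff)

lemma continuous_on_mat_act:
  assumes "continuous_on S f"
  shows "continuous_on S (\<lambda>x. mat_act A (f x))"
proof (rule continuous_on_coordinatewise_then_product)
  fix i
  show "continuous_on S (\<lambda>x. mat_act A (f x) i)"
    by (cases "i < dim_row A") (auto simp: mat_act_def intro!: continuous_intros continuous_on_apply[OF assms])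
qed

section \<open>Orbits of a finite group acting freely on the sphere\<close>

locale space_form_group =
  fixes q :: nat and G :: "real mat set"
  assumes sf: "spherical_space_form (q, G)"
begin

lemma q_ge_2: "q \<ge> 2" and subgroup_G: "subgroup G (orthogonal_group (q + 1))" and finite_G: "finite G"
  and free: "A \<in> G \<Longrightarrow> A \<noteq> 1\<^sub>m (q + 1) \<Longrightarrow> x \<in> topspace (nsphere q) \<Longrightarrow> mat_act A x \<noteq> x"
  using sf by (auto simp: spherical_space_form_def)

lemma G_orthogonal: "A \<in> G \<Longrightarrow> A \<in> carrier (orthogonal_group (q + 1))"
  using subgroup.subset[OF subgroup_G] by auto

lemma G_carrier_mat: "A \<in> G \<Longrightarrow> A \<in> carrier_mat (q + 1) (q + 1)"
  using G_orthogonal carrier_orthogonal_group by blast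

lemma one_in_G: "1\<^sub>m (q + 1) \<in> G"
  using subgroup.one_closed[OF subgroup_G] by simp

lemma mult_in_G: "A \<in> G \<Longrightarrow> B \<in> G \<Longrightarrow> A * B \<in> G"
  using subgroup.m_closed[OF subgroup_G] by simp

lemma act_mult: "A \<in> G \<Longrightarrow> B \<in> G \<Longrightarrow> mat_act (A * B) x = mat_act A (mat_act B x)"
  by (rule mat_act_mult[OF G_carrier_mat G_carrier_mat])

lemma act_one: "x \<in> topspace (nsphere q) \<Longrightarrow> mat_act (1\<^sub>m (q + 1)) x = x"
  using mat_act_one[of x "q + 1"] topspace_nsphere_subset_Euclidean by auto

lemma act_sphere: "A \<in> G \<Longrightarrow> x \<in> topspace (nsphere q) \<Longrightarrow> mat_act A x \<in> topspace (nsphere q)"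
  by (intro mat_act_nsphere G_orthogonal)

lemma G_inverse:
  assumes "A \<in> G"
  obtains B where "B \<in> G" "A * B = 1\<^sub>m (q + 1)" "B * A = 1\<^sub>m (q + 1)"
proof -
  interpret O: group "orthogonal_group (q + 1)" by (rule group_orthogonal_group)
  show ?thesis
    using that[of "inv\<^bsub>orthogonal_group (q + 1)\<^esub> A"] subgroup.m_inv_closed[OF subgroup_G assms]
      O.r_inv[OF G_orthogonal[OF assms]] O.l_inv[OF G_orthogonal[OF assms]] by simp
qed

text \<open>Freeness is applied to the inverse of \<open>B\<close> times \<open>A\<close>, which
  fixes \<open>x\<close>.\<close>

lemma act_eq_iff:
  assumes "A \<in> G" "B \<in> G" "x \<in> topspace (nsphere q)"
  shows "mat_act A x = mat_act B x \<longleftrightarrow> A = B"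
proof
  assume eq: "mat_act A x = mat_act B x"
  obtain C where C: "C \<in> G" "B * C = 1\<^sub>m (q + 1)" "C * B = 1\<^sub>m (q + 1)" using G_inverse assms by blast
  have "mat_act (C * A) x = mat_act (C * B) x"
    using eq by (simp only: act_mult[OF C(1) assms(1)] act_mult[OF C(1) assms(2)])
  then have "mat_act (C * A) x = x" unfolding C(3) act_one[OF assms(3)] .
  then have "C * A = 1\<^sub>m (q + 1)" using free[of "C * A" x] mult_in_G C assms by blast
  then have "B * C * A = B"
    using assoc_mult_mat[OF G_carrier_mat[OF assms(2)] G_carrier_mat[OF C(1)] G_carrier_mat[OF assms(1)]]
      G_carrier_mat[OF assms(2)] by simp
  then show "A = B"
    using C left_mult_one_mat[OF G_carrier_mat[OF assms(1)]] by simp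
qed simp

lemma proj_apply: "proj (q, G) x = (\<lambda>A. mat_act A x) ` G"
  by (simp add: proj_def)

lemma in_proj: "x \<in> topspace (nsphere q) \<Longrightarrow> x \<in> proj (q, G) x"
  unfolding proj_apply using one_in_G act_one by force

lemma proj_act:
  assumes A: "A \<in> G"
  shows "proj (q, G) (mat_act A x) = proj (q, G) x"
proof -
  have sub: "proj (q, G) (mat_act B y) \<subseteq> proj (q, G) y" if "B \<in> G" for B y
    unfolding proj_apply using that mult_in_G by (auto simp flip: act_mult)
  obtain B where B: "B \<in> G" "B * A = 1\<^sub>m (q + 1)" using G_inverse[OF A] by metis
  have "mat_act (C * B) (mat_act A x) = mat_act C x" if C: "C \<in> G" for C
    using A B C act_mult[of C B] act_mult[of B A] act_mult[of "C * B" A]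
    by (metis G_carrier_mat act_mult mult_in_G assoc_mult_mat right_mult_one_mat)
  then have "proj (q, G) x \<subseteq> proj (q, G) (mat_act A x)"
    unfolding proj_apply using B mult_in_G by (auto simp: image_iff) metis
  then show ?thesis using sub[OF A] by blast
qed

lemma proj_eq_iff:
  assumes "x \<in> topspace (nsphere q)" "y \<in> topspace (nsphere q)"
  shows "proj (q, G) x = proj (q, G) y \<longleftrightarrow> (\<exists>A\<in>G. y = mat_act A x)"
proof
  assume "proj (q, G) x = proj (q, G) y"
  then have "y \<in> proj (q, G) x" using in_proj assms by auto
  then show "\<exists>A\<in>G. y = mat_act A x" by (auto simp: proj_apply)
qed (auto simp: proj_act)

lemma points_eq: "points (q, G) = proj (q, G) ` topspace (nsphere q)"
  by (simp add: points_def)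

lemma mem_points:
  assumes "P \<in> points (q, G)" "x \<in> P"
  shows "x \<in> topspace (nsphere q)" "P = proj (q, G) x"
proof -
  obtain y A where y: "y \<in> topspace (nsphere q)" "P = proj (q, G) y" "A \<in> G" "x = mat_act A y"
    using assms by (auto simp: points_eq proj_apply)
  then show "x \<in> topspace (nsphere q)" "P = proj (q, G) x" using act_sphere proj_act by auto
qed

text \<open>Each nontrivial element of the finite group moves points by a distance that has a
  positive minimum on the compact sphere. The factor 4 lets two points within 2 \<delta> of a common
  centre be compared.\<close>

lemma separation:
  obtains \<delta> where "\<delta> > 0"
    "\<And>x y. x \<in> topspace (nsphere q) \<Longrightarrow> y \<in> proj (q, G) x \<Longrightarrow> edist q x y < 4 * \<delta> \<Longrightarrow> x = y"
proof -
  let ?S = "topspace (nsphere q)"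
  have "\<exists>d>0. \<forall>x\<in>?S. d \<le> edist q x (mat_act A x)" if A: "A \<in> G" "A \<noteq> 1\<^sub>m (q + 1)" for A
  proof -
    have "?S \<noteq> {}" using in_topspace_nsphere by blast
    moreover have "continuous_on ?S (\<lambda>x. edist q x (mat_act A x))"
      by (intro continuous_on_edist continuous_on_mat_act continuous_intros)
    ultimately obtain x0 where x0: "x0 \<in> ?S" "\<And>x. x \<in> ?S \<Longrightarrow> edist q x0 (mat_act A x0) \<le> edist q x (mat_act A x)"
      using continuous_attains_inf[OF compact_topspace_nsphere] by blast
    moreover have "edist q x0 (mat_act A x0) > 0"
      using edist_eq_0_iff[OF x0(1) act_sphere[OF A(1) x0(1)]] free[OF A x0(1)]
        edist_nonneg[of q x0 "mat_act A x0"] by (metis less_le)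
    ultimately show ?thesis by blast
  qed
  then obtain d where d: "\<And>A. A \<in> G \<Longrightarrow> A \<noteq> 1\<^sub>m (q + 1) \<Longrightarrow> d A > 0 \<and> (\<forall>x\<in>?S. d A \<le> edist q x (mat_act A x))"
    by metis
  \<comment> \<open>Inserting 1 keeps the minimum defined for the trivial group.\<close>
  define \<delta> where "\<delta> = Min (insert 1 (d ` (G - {1\<^sub>m (q + 1)}))) / 4"
  have fin: "finite (insert 1 (d ` (G - {1\<^sub>m (q + 1)})))" using finite_G by simp
  have "\<delta> > 0" unfolding \<delta>_def using fin d by (simp add: Min_gr_iff)
  moreover have "x = y" if x: "x \<in> ?S" and y: "y \<in> proj (q, G) x" and lt: "edist q x y < 4 * \<delta>" for x y
  proof -
    obtain A where A: "A \<in> G" "y = mat_act A x" using y by (auto simp: proj_apply)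
    have "A = 1\<^sub>m (q + 1)"
    proof (rule ccontr)
      assume ne: "A \<noteq> 1\<^sub>m (q + 1)"
      then have "4 * \<delta> \<le> d A" unfolding \<delta>_def using fin A by (simp add: Min_le)
      then show False using d[OF A(1) ne] x lt A by force
    qed
    then show ?thesis using A act_one x by simp
  qed
  ultimately show ?thesis by (rule that)
qed

end

section \<open>Fixed spaces of almost conjugate groups\<close>

context vector_space
begin

text \<open>The identity tr (T S) = tr (S T), where \<open>representation B (T (S b)) b\<close> are
  the diagonal matrix entries. As \<open>S\<close> and \<open>T\<close> may join the spans of
  different bases, it covers both independence of the basis and invariance under
  conjugation.\<close>

lemma trace_swap:
  assumes B: "independent B" "finite B" and C: "independent C" "finite C"
    and S: "Vector_Spaces.linear scale scale S" "\<And>b. b \<in> B \<Longrightarrow> S b \<in> span C"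
    and T: "Vector_Spaces.linear scale scale T" "\<And>c. c \<in> C \<Longrightarrow> T c \<in> span B"
  shows "(\<Sum>b\<in>B. representation B (T (S b)) b) = (\<Sum>c\<in>C. representation C (S (T c)) c)"
proof -
  have expand: "representation X (h (k x)) x = (\<Sum>y\<in>Y. representation Y (k x) y * representation X (h y) x)"
    if X: "independent X" "finite X" and Y: "independent Y" "finite Y"
      and h: "Vector_Spaces.linear scale scale h" "\<And>y. y \<in> Y \<Longrightarrow> h y \<in> span X"
      and k: "k x \<in> span Y" for X Y h k x
  proof -
    interpret h: Vector_Spaces.linear scale scale h by (fact h(1))
    have "k x = (\<Sum>y\<in>Y. scale (representation Y (k x) y) y)"
      using sum_representation_eq[OF Y(1) k Y(2)] by simp
    then have "h (k x) = (\<Sum>y\<in>Y. scale (representation Y (k x) y) (h y))"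
      by (metis (no_types, lifting) h.scale h.sum sum.cong)
    moreover have "representation X (\<Sum>y\<in>Y. scale (representation Y (k x) y) (h y)) x
        = (\<Sum>y\<in>Y. representation X (scale (representation Y (k x) y) (h y)) x)"
      using X h by (subst representation_sum) (auto intro: span_scale)
    ultimately show ?thesis
      using X h by (simp add: representation_scale)
  qed
  have "(\<Sum>b\<in>B. representation B (T (S b)) b)
      = (\<Sum>b\<in>B. \<Sum>c\<in>C. representation C (S b) c * representation B (T c) b)"
    using assms by (intro sum.cong refl expand) auto
  also have "\<dots> = (\<Sum>c\<in>C. \<Sum>b\<in>B. representation B (T c) b * representation C (S b) c)"
    by (subst sum.swap) (simp add: mult.commute)
  also have "\<dots> = (\<Sum>c\<in>C. representation C (S (T c)) c)"
    using assms by (intro sum.cong refl expand[symmetric]) auto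
  finally show ?thesis .
qed

text \<open>With \<open>S = e\<close> and \<open>T\<close> the identity, \<open>trace_swap\<close>
  passes from \<open>B\<close> to a basis of \<open>W\<close>, on which \<open>e\<close> is the
  identity and every diagonal entry is 1.\<close>

lemma trace_projection:
  assumes B: "independent B" "finite B" and "subspace W" "W \<subseteq> span B"
    and e: "Vector_Spaces.linear scale scale e" "\<And>b. b \<in> B \<Longrightarrow> e b \<in> W" "\<And>w. w \<in> W \<Longrightarrow> e w = w"
  shows "(\<Sum>b\<in>B. representation B (e b) b) = of_nat (dim W)"
proof -
  obtain C where C: "C \<subseteq> W" "independent C" "W \<subseteq> span C" "card C = dim W"
    using basis_exists by metis
  have finC: "finite C"
    using independent_span_bound[OF B(2) C(2)] C(1) assms(4) by auto
  have id: "Vector_Spaces.linear scale scale (\<lambda>x. x)"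
    by (rule linear_ident)
  have "(\<Sum>b\<in>B. representation B (e b) b) = (\<Sum>c\<in>C. representation C (e c) c)"
    using trace_swap[OF B C(2) finC e(1) _ id] C e(2) assms(4) by auto
  also have "\<dots> = (\<Sum>c\<in>C. 1)"
    using C e(3) by (intro sum.cong refl) (auto simp: representation_basis subset_iff)
  finally show ?thesis using C by simp
qed

text \<open>\<open>dim\<close> is the cardinality of a basis, thus 0 in infinite dimension. A finite
  basis on one side bounds the independent sets on the other; if one basis is infinite, so is the
  other, and both dimensions are 0.\<close>

lemma dim_le_imp_dim_eq:
  assumes W1: "subspace W1" and W2: "subspace W2"
    and le: "\<And>X. X \<subseteq> W1 \<Longrightarrow> finite X \<Longrightarrow> independent X \<Longrightarrow> \<exists>Y\<subseteq>W2. finite Y \<and> independent Y \<and> card Y = card X"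
    and ge: "\<And>X. X \<subseteq> W2 \<Longrightarrow> finite X \<Longrightarrow> independent X \<Longrightarrow> \<exists>Y\<subseteq>W1. finite Y \<and> independent Y \<and> card Y = card X"
  shows "dim W1 = dim W2"
proof -
  have key: "finite B \<and> card B \<le> card A"
    if A: "finite A" "V \<subseteq> span A" and B: "B \<subseteq> U" "independent B"
      and h: "\<And>X. X \<subseteq> U \<Longrightarrow> finite X \<Longrightarrow> independent X \<Longrightarrow> \<exists>Y\<subseteq>V. finite Y \<and> independent Y \<and> card Y = card X"
    for A B U V
  proof -
    have bound: "card X \<le> card A" if X: "X \<subseteq> B" "finite X" for X
    proof -
      obtain Y where Y: "Y \<subseteq> V" "independent Y" "card Y = card X"
        using h[of X] B X independent_mono by blast
      then show ?thesis
        using independent_span_bound[OF A(1) Y(2)] A(2) by auto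
    qed
    have "finite B"
    proof (rule ccontr)
      assume "infinite B"
      then obtain X where "X \<subseteq> B" "finite X" "card X = Suc (card A)"
        using infinite_arbitrarily_large by blast
      with bound[of X] show False by simp
    qed
    with bound[of B] show ?thesis by simp
  qed
  obtain B1 where B1: "B1 \<subseteq> W1" "independent B1" "W1 \<subseteq> span B1" "card B1 = dim W1"
    using basis_exists by metis
  obtain B2 where B2: "B2 \<subseteq> W2" "independent B2" "W2 \<subseteq> span B2" "card B2 = dim W2"
    using basis_exists by metis
  show ?thesis
  proof (cases "finite B1")
    case True
    then have "finite B2" "card B2 \<le> card B1" using key[OF True B1(3) B2(1,2) ge] by auto
    moreover have "card B1 \<le> card B2"
      using key[OF \<open>finite B2\<close> B2(3) B1(1,2) le] by auto
    ultimately show ?thesis using B1 B2 by simp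
  next
    case False
    then have "infinite B2" using key[OF _ B2(3) B1(1,2) le] by auto
    then show ?thesis using False B1 B2 by simp
  qed
qed

lemma finite_span_basis:
  assumes "finite X"
  obtains B where "independent B" "finite B" "span B = span X"
  by (metis assms finite_subset basis_exists span_superset span_subspace subspace_span dim_span span_eq
      maximal_independent_subset span_mono span_span subset_antisym)

end

text \<open>Products only have to exist in \<open>\<Gamma>\<close> and to agree on \<open>E\<close>.
  This accommodates a right action, such as composition with matrices, and a unit that acts as the
  identity on \<open>E\<close> alone.\<close>

locale finite_operator_family = vector_space scale
  for scale :: "'a::field_char_0 \<Rightarrow> 'b::ab_group_add \<Rightarrow> 'b" +
  fixes E :: "'b set" and \<Gamma> :: "'g set" and \<rho> :: "'g \<Rightarrow> 'b \<Rightarrow> 'b"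
  assumes E: "subspace E" and finite_\<Gamma>: "finite \<Gamma>"
    and linear_\<rho>: "g \<in> \<Gamma> \<Longrightarrow> Vector_Spaces.linear scale scale (\<rho> g)"
    and \<rho>_E: "g \<in> \<Gamma> \<Longrightarrow> v \<in> E \<Longrightarrow> \<rho> g v \<in> E"
    and \<rho>_mult: "g \<in> \<Gamma> \<Longrightarrow> h \<in> \<Gamma> \<Longrightarrow> \<exists>k\<in>\<Gamma>. \<forall>v\<in>E. \<rho> g (\<rho> h v) = \<rho> k v"
    and \<rho>_one: "\<exists>e\<in>\<Gamma>. \<forall>v\<in>E. \<rho> e v = v"
begin

lemma \<rho>_add: "g \<in> \<Gamma> \<Longrightarrow> \<rho> g (x + y) = \<rho> g x + \<rho> g y"
  and \<rho>_scale: "g \<in> \<Gamma> \<Longrightarrow> \<rho> g (scale c x) = scale c (\<rho> g x)"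
  and \<rho>_zero: "g \<in> \<Gamma> \<Longrightarrow> \<rho> g 0 = 0"
  and \<rho>_sum: "g \<in> \<Gamma> \<Longrightarrow> \<rho> g (sum f A) = (\<Sum>a\<in>A. \<rho> g (f a))"
  using linear_\<rho>[of g] unfolding linear_iff_module_hom
  by (auto intro: module_hom.add module_hom.scale module_hom.zero module_hom.sum)

definition fixed_space :: "'g set \<Rightarrow> 'b set" where
  "fixed_space G = {v \<in> E. \<forall>g\<in>G. \<rho> g v = v}"

text \<open>The permutation \<open>s\<close> stands for a translation of a group; it is what makes
  an average over \<open>G\<close> invariant.\<close>

definition closed_under_action :: "'g set \<Rightarrow> bool" where
  "closed_under_action G \<longleftrightarrow> G \<subseteq> \<Gamma> \<and> G \<noteq> {} \<and>
     (\<forall>g\<in>G. \<exists>s. bij_betw s G G \<and> (\<forall>h\<in>G. \<forall>v\<in>E. \<rho> g (\<rho> h v) = \<rho> (s h) v))"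

lemma subspace_fixed_space:
  assumes "G \<subseteq> \<Gamma>"
  shows "subspace (fixed_space G)"
  using E assms unfolding subspace_def fixed_space_def
  by (auto simp: \<rho>_add \<rho>_scale \<rho>_zero subset_iff)

text \<open>The images of a finite set under a finite family closed under composition form a finite
  set that the family maps into itself.\<close>

lemma invariant_span:
  assumes "finite X" "X \<subseteq> E"
  obtains B where "independent B" "finite B" "X \<subseteq> span B" "span B \<subseteq> E"
    "\<And>g v. g \<in> \<Gamma> \<Longrightarrow> v \<in> span B \<Longrightarrow> \<rho> g v \<in> span B"
proof -
  define Y where "Y = (\<Union>g\<in>\<Gamma>. \<rho> g ` X)"
  have fY: "finite Y" using assms finite_\<Gamma> by (auto simp: Y_def)
  have YE: "Y \<subseteq> E" using assms \<rho>_E by (auto simp: Y_def)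
  obtain B where B: "independent B" "finite B" "span B = span Y"
    using finite_span_basis[OF fY] by blast
  have XY: "X \<subseteq> Y"
  proof
    fix x assume "x \<in> X"
    then have "x \<in> E" using assms by auto
    then show "x \<in> Y" using \<rho>_one \<open>x \<in> X\<close> by (force simp: Y_def)
  qed
  have inv: "\<rho> g v \<in> span Y" if g: "g \<in> \<Gamma>" and v: "v \<in> span Y" for g v
  proof -
    interpret h: Vector_Spaces.linear scale scale "\<rho> g" by (rule linear_\<rho>[OF g])
    have "\<rho> g y \<in> Y" if y: "y \<in> Y" for y
    proof -
      obtain k x where k: "k \<in> \<Gamma>" "x \<in> X" "y = \<rho> k x" using y by (auto simp: Y_def)
      obtain k' where "k' \<in> \<Gamma>" "\<forall>v\<in>E. \<rho> g (\<rho> k v) = \<rho> k' v" using \<rho>_mult[OF g k(1)] by blast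
      then have "\<rho> g y = \<rho> k' x" using k assms by auto
      then show ?thesis using \<open>k' \<in> \<Gamma>\<close> k by (auto simp: Y_def)
    qed
    then have "\<rho> g ` span Y \<subseteq> span Y"
      unfolding h.span_image[symmetric] by (intro span_mono) auto
    then show ?thesis using v by auto
  qed
  show ?thesis
    using that[OF B(1,2)] B(3) XY span_superset[of Y] span_minimal[OF YE E] inv by auto
qed

text \<open>Averaging over \<open>G\<close> is a projection onto the fixed vectors, and the trace of
  a projection is its rank.\<close>

lemma dim_fixed_space_eq_aux:
  assumes B: "independent B" "finite B" "span B \<subseteq> E"
      "\<And>g v. g \<in> \<Gamma> \<Longrightarrow> v \<in> span B \<Longrightarrow> \<rho> g v \<in> span B"
    and G: "closed_under_action G"
  shows "of_nat (card G) * of_nat (dim (span B \<inter> fixed_space G))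
    = (\<Sum>g\<in>G. \<Sum>b\<in>B. representation B (\<rho> g b) b)"
proof -
  have G\<Gamma>: "G \<subseteq> \<Gamma>" and ne: "G \<noteq> {}" using G by (auto simp: closed_under_action_def)
  have finG: "finite G" using G\<Gamma> finite_\<Gamma> finite_subset by blast
  then have cG: "of_nat (card G) \<noteq> (0::'a)" using ne by simp
  define e where "e v = scale (inverse (of_nat (card G))) (\<Sum>g\<in>G. \<rho> g v)" for v
  have lin: "Vector_Spaces.linear scale scale e"
    unfolding linear_iff_module_hom module_hom_iff e_def
    using G\<Gamma> by (auto intro: module_axioms simp: subset_iff \<rho>_add \<rho>_scale sum.distrib scale_right_distrib
        scale_sum_right mult.commute cong: sum.cong)
  have eW: "e b \<in> span B \<inter> fixed_space G" if "b \<in> span B" for b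
  proof -
    have bE: "b \<in> E" using that B by auto
    have 1: "e b \<in> span B"
      unfolding e_def using that B(4) G\<Gamma> by (intro span_scale span_sum) auto
    have "\<rho> g (e b) = e b" if g: "g \<in> G" for g
    proof -
      obtain s where s: "bij_betw s G G" "\<forall>h\<in>G. \<forall>v\<in>E. \<rho> g (\<rho> h v) = \<rho> (s h) v"
        using G g unfolding closed_under_action_def by blast
      have "\<rho> g (e b) = scale (inverse (of_nat (card G))) (\<Sum>h\<in>G. \<rho> g (\<rho> h b))"
        unfolding e_def using g G\<Gamma> by (simp add: \<rho>_scale \<rho>_sum subset_iff)
      also have "(\<Sum>h\<in>G. \<rho> g (\<rho> h b)) = (\<Sum>h\<in>G. \<rho> (s h) b)"
        using s bE by (intro sum.cong) auto
      also have "\<dots> = (\<Sum>h\<in>G. \<rho> h b)"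
        by (rule sum.reindex_bij_betw[OF s(1)])
      finally show ?thesis by (simp add: e_def)
    qed
    then show ?thesis using 1 B(3) by (auto simp: fixed_space_def)
  qed
  have ew: "e w = w" if "w \<in> fixed_space G" for w
  proof -
    have "(\<Sum>g\<in>G. \<rho> g w) = scale (of_nat (card G)) w"
      using that by (simp add: fixed_space_def sum_constant_scale)
    then show ?thesis using cG by (simp add: e_def)
  qed
  have "of_nat (dim (span B \<inter> fixed_space G)) = (\<Sum>b\<in>B. representation B (e b) b)"
    using eW ew span_base
    by (intro trace_projection[symmetric] B lin subspace_inter subspace_span subspace_fixed_space G\<Gamma>) auto
  also have "\<dots> = (\<Sum>b\<in>B. inverse (of_nat (card G)) * (\<Sum>g\<in>G. representation B (\<rho> g b) b))"
  proof (rule sum.cong[OF refl])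
    fix b assume b: "b \<in> B"
    then have *: "\<And>g. g \<in> G \<Longrightarrow> \<rho> g b \<in> span B" using B(4) G\<Gamma> span_base by auto
    show "representation B (e b) b = inverse (of_nat (card G)) * (\<Sum>g\<in>G. representation B (\<rho> g b) b)"
      unfolding e_def using * B(1) by (simp add: representation_scale span_sum representation_sum)
  qed
  also have "\<dots> = inverse (of_nat (card G)) * (\<Sum>g\<in>G. \<Sum>b\<in>B. representation B (\<rho> g b) b)"
    by (subst sum.swap) (simp add: sum_distrib_left)
  finally show ?thesis using cG by simp
qed

text \<open>Sunada's argument.  Passing to finite-dimensional invariant subspaces makes traces available
  although \<open>E\<close> itself is not known to be finite-dimensional.\<close>

theorem dim_fixed_space_eq:
  assumes G: "closed_under_action G" and H: "closed_under_action H"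
    and \<beta>: "bij_betw \<beta> G H"
    and conj: "\<And>g. g \<in> G \<Longrightarrow> \<exists>s\<in>\<Gamma>. \<exists>t\<in>\<Gamma>. (\<forall>v\<in>E. \<rho> (\<beta> g) v = \<rho> s (\<rho> g (\<rho> t v))) \<and> (\<forall>v\<in>E. \<rho> t (\<rho> s v) = v)"
  shows "dim (fixed_space G) = dim (fixed_space H)"
proof -
  have G\<Gamma>: "G \<subseteq> \<Gamma>" and H\<Gamma>: "H \<subseteq> \<Gamma>" using G H by (auto simp: closed_under_action_def)
  have cards: "card G = card H" using \<beta> by (rule bij_betw_same_card)
  have ne: "of_nat (card H) \<noteq> (0::'a)"
    using H finite_\<Gamma> finite_subset[OF H\<Gamma>] by (auto simp: closed_under_action_def)
  \<comment> \<open>Inside one finite-dimensional invariant span, the two sums of traces agree term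
    by term along \<open>\<beta>\<close>.\<close>
  have main: "dim (span B \<inter> fixed_space G) = dim (span B \<inter> fixed_space H)"
    if B: "independent B" "finite B" "span B \<subseteq> E"
      "\<And>g v. g \<in> \<Gamma> \<Longrightarrow> v \<in> span B \<Longrightarrow> \<rho> g v \<in> span B" for B
  proof -
    have tr: "(\<Sum>b\<in>B. representation B (\<rho> (\<beta> g) b) b) = (\<Sum>b\<in>B. representation B (\<rho> g b) b)"
      if g: "g \<in> G" for g
    proof -
      obtain s t where st: "s \<in> \<Gamma>" "t \<in> \<Gamma>" "\<forall>v\<in>E. \<rho> (\<beta> g) v = \<rho> s (\<rho> g (\<rho> t v))"
        "\<forall>v\<in>E. \<rho> t (\<rho> s v) = v"
        using conj[OF g] by blast
      have gG: "g \<in> \<Gamma>" using g G\<Gamma> by auto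
      have BE: "b \<in> E" "b \<in> span B" if "b \<in> B" for b using that B(3) span_base by auto
      have l: "Vector_Spaces.linear scale scale (\<lambda>v. \<rho> g (\<rho> t v))"
        using Vector_Spaces.linear_compose[OF linear_\<rho>[OF st(2)] linear_\<rho>[OF gG]] by (simp add: o_def)
      have "(\<Sum>b\<in>B. representation B (\<rho> (\<beta> g) b) b) = (\<Sum>b\<in>B. representation B (\<rho> s (\<rho> g (\<rho> t b))) b)"
        using BE st by (intro sum.cong) auto
      \<comment> \<open>\<open>trace_swap\<close> moves \<open>\<rho> s\<close> to the other end,
        where it cancels against \<open>\<rho> t\<close>.\<close>
      also have "\<dots> = (\<Sum>b\<in>B. representation B (\<rho> g (\<rho> t (\<rho> s b))) b)"
        by (rule trace_swap[OF B(1,2) B(1,2) l _ linear_\<rho>[OF st(1)]]) (use BE B(4) st gG in auto)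
      also have "\<dots> = (\<Sum>b\<in>B. representation B (\<rho> g b) b)"
        using BE st by (intro sum.cong) auto
      finally show ?thesis .
    qed
    have "(of_nat (card H) * of_nat (dim (span B \<inter> fixed_space H)) :: 'a)
      = (\<Sum>g\<in>H. \<Sum>b\<in>B. representation B (\<rho> g b) b)"
      by (rule dim_fixed_space_eq_aux[OF B H])
    also have "\<dots> = (\<Sum>g\<in>G. \<Sum>b\<in>B. representation B (\<rho> (\<beta> g) b) b)"
      by (rule sum.reindex_bij_betw[OF \<beta>, symmetric])
    also have "\<dots> = (\<Sum>g\<in>G. \<Sum>b\<in>B. representation B (\<rho> g b) b)"
      by (rule sum.cong[OF refl tr])
    also have "\<dots> = of_nat (card H) * of_nat (dim (span B \<inter> fixed_space G))"
      unfolding cards[symmetric] using dim_fixed_space_eq_aux[OF B G] by simp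
    finally show ?thesis using ne by simp
  qed
  \<comment> \<open>A finite independent set of fixed vectors lies in some finite-dimensional
    invariant span, where \<open>eq\<close> provides equally many independent vectors in the other
    fixed space.\<close>
  have le: "\<exists>Y\<subseteq>fixed_space H'. finite Y \<and> independent Y \<and> card Y = card X"
    if X: "X \<subseteq> fixed_space G'" "finite X" "independent X"
      and eq: "\<And>B. independent B \<Longrightarrow> finite B \<Longrightarrow> span B \<subseteq> E \<Longrightarrow>
      (\<And>g v. g \<in> \<Gamma> \<Longrightarrow> v \<in> span B \<Longrightarrow> \<rho> g v \<in> span B) \<Longrightarrow>
      dim (span B \<inter> fixed_space G') = dim (span B \<inter> fixed_space H')" for X G' H'
  proof -
    have XE: "X \<subseteq> E" using X by (auto simp: fixed_space_def)
    obtain B where B: "independent B" "finite B" "X \<subseteq> span B" "span B \<subseteq> E"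
      "\<And>g v. g \<in> \<Gamma> \<Longrightarrow> v \<in> span B \<Longrightarrow> \<rho> g v \<in> span B"
      using invariant_span[OF X(2) XE] by blast
    obtain C where C: "C \<subseteq> span B \<inter> fixed_space G'" "independent C" "span B \<inter> fixed_space G' \<subseteq> span C"
        "card C = dim (span B \<inter> fixed_space G')"
      using basis_exists by metis
    obtain D where D: "D \<subseteq> span B \<inter> fixed_space H'" "independent D"
        "card D = dim (span B \<inter> fixed_space H')"
      using basis_exists by metis
    have finC: "finite C" and finD: "finite D"
      using independent_span_bound[OF B(2) C(2)] independent_span_bound[OF B(2) D(2)] C(1) D(1) by auto
    have "card X \<le> card C"
      using independent_span_bound[OF finC X(3)] C(3) B(3) X(1) by auto
    also have "\<dots> = card D" using eq[OF B(1,2,4,5)] C D by simp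
    finally obtain Y where "Y \<subseteq> D" "card Y = card X" "finite Y"
      by (metis obtain_subset_with_card_n)
    then show ?thesis using D independent_mono by (intro exI[of _ Y]) auto
  qed
  show ?thesis
    by (rule dim_le_imp_dim_eq[OF subspace_fixed_space[OF G\<Gamma>] subspace_fixed_space[OF H\<Gamma>]])
      (use le main main[symmetric] in \<open>blast+\<close>)
qed

end

lemma (in vector_space_pair) dim_image_eq_of_inj:
  assumes f: "Vector_Spaces.linear s1 s2 f" and "vs1.subspace V" and inj: "inj_on f V"
  shows "vs2.dim (f ` V) = vs1.dim V"
proof -
  obtain B where B: "B \<subseteq> V" "vs1.independent B" "V \<subseteq> vs1.span B" "card B = vs1.dim V"
    using vs1.basis_exists by metis
  have sp: "vs1.span B = V" using B assms(2) vs1.span_subspace by blast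
  interpret f: Vector_Spaces.linear s1 s2 f by (rule f)
  have "vs2.independent (f ` B)"
    using f.independent_injective_image[OF B(2)] inj sp by simp
  moreover have "vs2.span (f ` B) = f ` V" using sp f.span_image by simp
  ultimately have "vs2.dim (f ` V) = card (f ` B)"
    by (metis vs2.dim_eq_card vs2.span_span)
  also have "\<dots> = card B" using inj B by (meson card_image inj_on_subset)
  finally show ?thesis using B by simp
qed

section \<open>Smooth functions and the Laplace--Beltrami operator\<close>

text \<open>\<open>pderiv_at\<close> sees a function only along a coordinate line, and by this lemma
  only its values on \<open>U\<close> count. The bound on \<open>i\<close> matters: \<open>U\<close>
  is open only within the first \<open>n\<close> coordinates.\<close>

lemma openin_Euclidean_fun_upd:
  assumes U: "openin (Euclidean_space n) U" and x: "x \<in> U" and i: "i < n"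
  shows "\<forall>\<^sub>F t in nhds (x i). x(i := t) \<in> U"
proof -
  let ?T = "{x. \<forall>i\<ge>n. x i = 0} :: (nat \<Rightarrow> real) set"
  obtain W where W: "open W" "U = ?T \<inter> W"
    using U unfolding Euclidean_space_eq_top_of_set by (auto simp: openin_open)
  have "continuous_on UNIV (\<lambda>t. x(i := t))"
  proof (rule continuous_on_coordinatewise_then_product)
    show "continuous_on UNIV (\<lambda>t. (x(i := t)) j)" for j
      by (cases "j = i") auto
  qed
  then have "open ((\<lambda>t. x(i := t)) -` W)"
    using W(1) open_vimage by blast
  moreover have "x i \<in> (\<lambda>t. x(i := t)) -` W" using x W by auto
  ultimately have "\<forall>\<^sub>F t in nhds (x i). x(i := t) \<in> W"
    using eventually_nhds_in_open[of "(\<lambda>t. x(i := t)) -` W" "x i"] by simp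
  moreover have "x(i := t) \<in> ?T" for t using x W(2) i by auto
  ultimately show ?thesis unfolding W(2) by simp
qed

lemma line_eventually_eq:
  assumes U: "openin (Euclidean_space n) U" and x: "x \<in> U" and i: "i < n"
    and eq: "\<And>y. y \<in> U \<Longrightarrow> f y = g y"
  shows "\<forall>\<^sub>F t in nhds (x i). f (x(i := t)) = g (x(i := t))"
  using openin_Euclidean_fun_upd[OF U x i] by (rule eventually_mono) (rule eq)

lemma pderiv_at_cong:
  assumes U: "openin (Euclidean_space n) U" and x: "x \<in> U" and i: "i < n"
    and eq: "\<And>y. y \<in> U \<Longrightarrow> f y = g y"
  shows "pderiv_at i f x = pderiv_at i g x"
  unfolding pderiv_at_def by (rule deriv_cong_ev[OF line_eventually_eq[OF assms] refl])

lemma line_differentiable_cong: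
  fixes f g :: "(nat \<Rightarrow> real) \<Rightarrow> real"
  assumes U: "openin (Euclidean_space n) U" and x: "x \<in> U" and i: "i < n"
    and eq: "\<And>y. y \<in> U \<Longrightarrow> f y = g y"
    and f: "(\<lambda>t. f (x(i := t))) differentiable (at (x i))"
  shows "(\<lambda>t. g (x(i := t))) differentiable (at (x i))"
proof -
  have ev: "\<forall>\<^sub>F t in nhds (x i). f (x(i := t)) = g (x(i := t))"
    by (rule line_eventually_eq[OF U x i eq])
  have "((\<lambda>t. f (x(i := t))) has_field_derivative D) (at (x i)) \<longleftrightarrow>
      ((\<lambda>t. g (x(i := t))) has_field_derivative D) (at (x i))" for D
    by (rule DERIV_cong_ev[OF refl _ refl]) (rule ev)
  then show ?thesis using f by (simp add: real_differentiable_def)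
qed

lemma C_on_imp_continuous: "C_on n k U f \<Longrightarrow> continuous_map (subtopology (Euclidean_space n) U) euclideanreal f"
  by (cases k) auto

text \<open>The derivatives of \<open>f\<close> and \<open>g\<close> are different functions that
  agree on \<open>U\<close>, so the induction has to generalise over both.\<close>

lemma C_on_cong:
  assumes U: "openin (Euclidean_space n) U"
  shows "\<forall>y\<in>U. f y = g y \<Longrightarrow> C_on n k U f \<Longrightarrow> C_on n k U g"
proof (induction k arbitrary: f g)
  have cont: "continuous_map (subtopology (Euclidean_space n) U) euclideanreal g"
    if "\<forall>y\<in>U. f y = g y" "continuous_map (subtopology (Euclidean_space n) U) euclideanreal f" for f g
    by (rule continuous_map_eq[OF that(2)]) (use that(1) in simp)
  {
    case 0
    then show ?case unfolding C_on.simps by (rule cont)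
  next
    case (Suc k)
    have "continuous_map (subtopology (Euclidean_space n) U) euclideanreal g"
      using Suc.prems unfolding C_on.simps by (blast intro: cont)
    moreover have "C_on n k U (pderiv_at i g)" if i: "i < n" for i
    proof (rule Suc.IH)
      show "C_on n k U (pderiv_at i f)" using Suc.prems i unfolding C_on.simps by blast
      show "\<forall>y\<in>U. pderiv_at i f y = pderiv_at i g y"
        using Suc.prems(1) i by (intro ballI pderiv_at_cong[OF U]) auto
    qed
    moreover have "(\<lambda>t. g (x(i := t))) differentiable (at (x i))" if i: "i < n" and x: "x \<in> U" for i x
    proof (rule line_differentiable_cong[OF U x i])
      show "(\<lambda>t. f (x(i := t))) differentiable at (x i)"
        using Suc.prems(2) i x unfolding C_on.simps by blast
    qed (use Suc.prems(1) in simp)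
    ultimately show ?case unfolding C_on.simps by blast
  }
qed

lemma C_on_subset: "C_on n k U f \<Longrightarrow> V \<subseteq> U \<Longrightarrow> C_on n k V f"
proof (induction k arbitrary: f)
  case 0
  then show ?case unfolding C_on.simps by (rule continuous_map_from_subtopology_mono)
next
  case (Suc k)
  then have "continuous_map (subtopology (Euclidean_space n) V) euclideanreal f"
    unfolding C_on.simps by (blast intro: continuous_map_from_subtopology_mono)
  then show ?case using Suc unfolding C_on.simps by blast
qed

lemma continuous_map_local:
  assumes U: "openin (Euclidean_space n) U"
    and h: "\<And>x. x \<in> U \<Longrightarrow> \<exists>V. openin (Euclidean_space n) V \<and> x \<in> V \<and> V \<subseteq> U \<and>
      continuous_map (subtopology (Euclidean_space n) V) Y f"
  shows "continuous_map (subtopology (Euclidean_space n) U) Y f"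
proof -
  obtain V where V: "\<And>x. x \<in> U \<Longrightarrow> openin (Euclidean_space n) (V x) \<and> x \<in> V x \<and> V x \<subseteq> U \<and>
      continuous_map (subtopology (Euclidean_space n) (V x)) Y f"
    using h by metis
  show ?thesis
  proof (rule pasting_lemma[where I = U and T = V and f = "\<lambda>_. f"])
    fix x assume x: "x \<in> U"
    show "openin (subtopology (Euclidean_space n) U) (V x)"
      using V[OF x] openin_open_subtopology[OF U] by simp
    show "continuous_map (subtopology (subtopology (Euclidean_space n) U) (V x)) Y f"
      using V[OF x] by (simp add: subtopology_subtopology inf.absorb2)
  qed (use V in auto)
qed

text \<open>Sphere charts become charts of a quotient only after shrinking, so smoothness has to be
  checked locally. \<open>pderiv_at i f\<close> does not depend on the open set, so the induction
  hypothesis applies to it directly.\<close>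

lemma C_on_local:
  assumes U: "openin (Euclidean_space n) U"
    and "\<forall>x\<in>U. \<exists>V. openin (Euclidean_space n) V \<and> x \<in> V \<and> V \<subseteq> U \<and> C_on n k V f"
  shows "C_on n k U f"
  using assms(2)
proof (induction k arbitrary: f)
  case 0
  then show ?case using continuous_map_local[OF U, of euclideanreal f] by simp
next
  case (Suc k)
  have "continuous_map (subtopology (Euclidean_space n) U) euclideanreal f"
    by (rule continuous_map_local[OF U]) (use Suc.prems in \<open>meson C_on_imp_continuous\<close>)
  moreover have "C_on n k U (pderiv_at i f)" if i: "i < n" for i
  proof (rule Suc.IH, rule ballI)
    fix x assume "x \<in> U"
    then obtain V where "openin (Euclidean_space n) V" "x \<in> V" "V \<subseteq> U" "C_on n (Suc k) V f"
      using Suc.prems by blast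
    then show "\<exists>V. openin (Euclidean_space n) V \<and> x \<in> V \<and> V \<subseteq> U \<and> C_on n k V (pderiv_at i f)"
      using i by auto
  qed
  moreover have "(\<lambda>t. f (x(i := t))) differentiable (at (x i))" if i: "i < n" and x: "x \<in> U" for i x
  proof -
    obtain V where "x \<in> V" "C_on n (Suc k) V f" using Suc.prems x by blast
    then show ?thesis using i by auto
  qed
  ultimately show ?case unfolding C_on.simps by blast
qed

lemma smooth_on_open_differentiable:
  assumes "smooth_on_open n U f" "x \<in> U" "i < n"
  shows "(\<lambda>t. f (x(i := t))) differentiable (at (x i))"
proof -
  have "C_on n (Suc 0) U f" using assms(1) unfolding smooth_on_open_def by blast
  then show ?thesis using assms(2,3) unfolding C_on.simps by blast
qed

lemma smooth_on_open_cong: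
  assumes "smooth_on_open n U f" "\<And>y. y \<in> U \<Longrightarrow> f y = g y"
  shows "smooth_on_open n U g"
  unfolding smooth_on_open_def
proof (intro conjI allI)
  show U: "openin (Euclidean_space n) U" using assms(1) by (simp only: smooth_on_open_def)
  show "C_on n k U g" for k
  proof (rule C_on_cong[OF U])
    show "C_on n k U f" using assms(1) unfolding smooth_on_open_def by blast
  qed (simp add: assms(2))
qed

lemma smooth_on_open_subset:
  assumes "smooth_on_open n U f" "V \<subseteq> U" "openin (Euclidean_space n) V"
  shows "smooth_on_open n V f"
  unfolding smooth_on_open_def
proof (intro conjI allI)
  show "C_on n k V f" for k
  proof (rule C_on_subset[OF _ assms(2)])
    show "C_on n k U f" using assms(1) unfolding smooth_on_open_def by blast
  qed
qed (rule assms(3))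

lemma smooth_on_open_local:
  assumes "openin (Euclidean_space n) U"
    and "\<And>x. x \<in> U \<Longrightarrow> \<exists>V. x \<in> V \<and> V \<subseteq> U \<and> smooth_on_open n V f"
  shows "smooth_on_open n U f"
  unfolding smooth_on_open_def
proof (intro conjI allI C_on_local ballI assms(1))
  fix k x assume "x \<in> U"
  then obtain V where V: "x \<in> V" "V \<subseteq> U" "smooth_on_open n V f" using assms(2) by blast
  then have "openin (Euclidean_space n) V" "C_on n k V f" by (simp_all only: smooth_on_open_def)
  with V show "\<exists>V. openin (Euclidean_space n) V \<and> x \<in> V \<and> V \<subseteq> U \<and> C_on n k V f" by blast
qed

lemma smooth_on_open_pderiv_at:
  assumes "smooth_on_open n U f" "i < n"
  shows "smooth_on_open n U (pderiv_at i f)"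
  unfolding smooth_on_open_def
proof (intro conjI allI)
  show "openin (Euclidean_space n) U" using assms(1) by (simp only: smooth_on_open_def)
  fix k
  have "C_on n (Suc k) U f" using assms(1) by (simp only: smooth_on_open_def)
  then show "C_on n k U (pderiv_at i f)" using assms(2) unfolding C_on.simps by blast
qed

lemma pderiv_at_linear:
  assumes "(\<lambda>t. f (x(i := t))) differentiable (at (x i))" "(\<lambda>t. g (x(i := t))) differentiable (at (x i))"
  shows "pderiv_at i (\<lambda>y. a * f y + b * g y) x = a * pderiv_at i f x + b * pderiv_at i g x"
proof -
  have "((\<lambda>t. f (x(i := t))) has_real_derivative pderiv_at i f x) (at (x i))"
    "((\<lambda>t. g (x(i := t))) has_real_derivative pderiv_at i g x) (at (x i))"
    using assms unfolding pderiv_at_def real_differentiable_def by (metis DERIV_imp_deriv)+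
  then have "((\<lambda>t. a * f (x(i := t)) + b * g (x(i := t))) has_real_derivative
      a * pderiv_at i f x + b * pderiv_at i g x) (at (x i))"
    by (auto intro!: derivative_eq_intros)
  then show ?thesis unfolding pderiv_at_def by (rule DERIV_imp_deriv)
qed

lemma C_on_linear:
  assumes U: "openin (Euclidean_space n) U"
  shows "C_on n k U f \<Longrightarrow> C_on n k U g \<Longrightarrow> C_on n k U (\<lambda>y. a * f y + b * g y)"
proof (induction k arbitrary: f g)
  case 0
  then show ?case
    unfolding C_on.simps by (intro continuous_map_add continuous_map_real_mult_left)
next
  case (Suc k)
  have "continuous_map (subtopology (Euclidean_space n) U) euclideanreal (\<lambda>y. a * f y + b * g y)"
    using Suc.prems unfolding C_on.simps by (intro continuous_map_add continuous_map_real_mult_left) blast+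
  moreover have "C_on n k U (pderiv_at i (\<lambda>y. a * f y + b * g y))" if i: "i < n" for i
  proof (rule C_on_cong[OF U])
    show "C_on n k U (\<lambda>x. a * pderiv_at i f x + b * pderiv_at i g x)"
      using Suc.prems i unfolding C_on.simps by (intro Suc.IH) blast+
    show "\<forall>x\<in>U. a * pderiv_at i f x + b * pderiv_at i g x = pderiv_at i (\<lambda>y. a * f y + b * g y) x"
      using Suc.prems i unfolding C_on.simps by (intro ballI pderiv_at_linear[symmetric]) blast+
  qed
  moreover have "(\<lambda>t. a * f (x(i := t)) + b * g (x(i := t))) differentiable (at (x i))" if "i < n" "x \<in> U" for i x
    using Suc.prems that unfolding C_on.simps
    by (intro differentiable_add differentiable_mult differentiable_const) blast+
  ultimately show ?case unfolding C_on.simps by blast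
qed

lemma smooth_on_open_linear:
  assumes "smooth_on_open n U f" "smooth_on_open n U g"
  shows "smooth_on_open n U (\<lambda>y. a * f y + b * g y)"
  unfolding smooth_on_open_def
proof (intro conjI allI)
  show U: "openin (Euclidean_space n) U" using assms(1) by (simp only: smooth_on_open_def)
  show "C_on n k U (\<lambda>y. a * f y + b * g y)" for k
    by (rule C_on_linear[OF U]) (use assms in \<open>unfold smooth_on_open_def, blast+\<close>)
qed

lemma smooth_on_open_zero:
  assumes "openin (Euclidean_space n) U"
  shows "smooth_on_open n U (\<lambda>_. 0)"
proof -
  have "pderiv_at i (\<lambda>_. 0) = (\<lambda>_. 0)" for i by (auto simp: pderiv_at_def)
  then have "C_on n k U (\<lambda>_. 0)" for k
    by (induction k) (simp_all only: C_on.simps continuous_map_const topspace_euclidean UNIV_I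
        differentiable_const simp_thms ball_triv)
  then show ?thesis using assms unfolding smooth_on_open_def by blast
qed

lemma smooth_on_open_sum:
  assumes "openin (Euclidean_space n) U" "finite J" "\<And>j. j \<in> J \<Longrightarrow> smooth_on_open n U (f j)"
  shows "smooth_on_open n U (\<lambda>x. \<Sum>j\<in>J. c j * f j x)"
  using assms(2,3)
proof (induction J)
  case (insert j J)
  have "smooth_on_open n U (\<lambda>x. c j * f j x + 1 * (\<Sum>j\<in>J. c j * f j x))"
    by (intro smooth_on_open_linear insert.IH insert.prems) auto
  then show ?case using insert.hyps by simp
next
  case empty
  show ?case unfolding sum.empty by (rule smooth_on_open_zero[OF assms(1)])
qed

lemma pderiv_at_sum:
  assumes "finite J" "\<And>j. j \<in> J \<Longrightarrow> (\<lambda>t. f j (x(i := t))) differentiable (at (x i))"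
  shows "pderiv_at i (\<lambda>y. \<Sum>j\<in>J. c j * f j y) x = (\<Sum>j\<in>J. c j * pderiv_at i (f j) x)"
proof -
  have "((\<lambda>t. f j (x(i := t))) has_real_derivative pderiv_at i (f j) x) (at (x i))" if "j \<in> J" for j
    using assms(2)[OF that] unfolding pderiv_at_def real_differentiable_def by (metis DERIV_imp_deriv)
  then have "((\<lambda>t. \<Sum>j\<in>J. c j * f j (x(i := t))) has_real_derivative
      (\<Sum>j\<in>J. c j * pderiv_at i (f j) x)) (at (x i))"
    by (intro DERIV_sum DERIV_cmult)
  then show ?thesis unfolding pderiv_at_def by (rule DERIV_imp_deriv)
qed

section \<open>Differentiability of the metric coefficients; locality and linearity of the
  Laplace-Beltrami operator\<close>

lemma differentiable_prod_real:
  fixes f :: "'i \<Rightarrow> real \<Rightarrow> real"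
  assumes "finite J" "\<And>j. j \<in> J \<Longrightarrow> f j differentiable (at s within S)"
  shows "(\<lambda>t. \<Prod>j\<in>J. f j t) differentiable (at s within S)"
  using assms by (induction J) (auto intro!: differentiable_mult)

lemma differentiable_det:
  fixes A :: "real \<Rightarrow> real mat"
  assumes "\<And>t. A t \<in> carrier_mat n n"
    and "\<And>i j. i < n \<Longrightarrow> j < n \<Longrightarrow> (\<lambda>t. A t $$ (i, j)) differentiable (at s)"
  shows "(\<lambda>t. Determinant.det (A t)) differentiable (at s)"
proof -
  have eq: "Determinant.det (A t) = (\<Sum>p\<in>{p. p permutes {0..<n}}. signof p * (\<Prod>i\<in>{0..<n}. A t $$ (i, p i)))" for t
    using assms(1) by (simp add: Determinant.det_def')
  show ?thesis unfolding eq using assms(2)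
    by (intro differentiable_sum ballI differentiable_mult differentiable_prod_real differentiable_const)
      (auto simp: finite_permutations permutes_in_image)
qed

lemma metric_mat_carrier [simp]: "metric_mat q \<sigma> u \<in> carrier_mat q q"
  by (simp add: metric_mat_def)

lemma dim_metric_mat [simp]: "dim_row (metric_mat q \<sigma> u) = q" "dim_col (metric_mat q \<sigma> u) = q"
  by (simp_all add: metric_mat_def)

lemma metric_mat_entry:
  "i < q \<Longrightarrow> j < q \<Longrightarrow> metric_mat q \<sigma> u $$ (i, j) =
     (\<Sum>k\<le>q. pderiv_at i (\<lambda>v. \<sigma> v k) u * pderiv_at j (\<lambda>v. \<sigma> v k) u)"
  by (simp add: metric_mat_def)

lemma parametrization_openin: "parametrization (q, G) U \<sigma> \<Longrightarrow> openin (Euclidean_space q) U"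
  by (simp add: parametrization_def)

lemma parametrization_smooth: "parametrization (q, G) U \<sigma> \<Longrightarrow> k \<le> q \<Longrightarrow> smooth_on_open q U (\<lambda>u. \<sigma> u k)"
  by (simp add: parametrization_def)

lemma parametrization_det: "parametrization (q, G) U \<sigma> \<Longrightarrow> u \<in> U \<Longrightarrow> Determinant.det (metric_mat q \<sigma> u) \<noteq> 0"
  by (simp add: parametrization_def)

lemma parametrization_sphere: "parametrization (q, G) U \<sigma> \<Longrightarrow> u \<in> U \<Longrightarrow> \<sigma> u \<in> topspace (nsphere q)"
  by (auto simp: parametrization_def)

lemma differentiable_metric_entry:
  assumes p: "parametrization (q, G) U \<sigma>" and u: "u \<in> U" and "l < q" "i < q" "j < q"
  shows "(\<lambda>t. metric_mat q \<sigma> (u(l := t)) $$ (i, j)) differentiable (at (u l))"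
proof -
  have "(\<lambda>t. pderiv_at m (\<lambda>v. \<sigma> v k) (u(l := t))) differentiable (at (u l))" if "k \<le> q" "m < q" for k m
    by (rule smooth_on_open_differentiable[OF smooth_on_open_pderiv_at[OF parametrization_smooth[OF p that(1)] that(2)] u assms(3)])
  then show ?thesis
    unfolding metric_mat_entry[OF assms(4,5)] using assms(4,5)
    by (intro differentiable_sum ballI differentiable_mult) auto
qed

text \<open>\<open>deriv\<close> is additive only for differentiable summands, so linearity of the
  Laplacian rests on this. The inverse metric is written through minors by Cramer's rule.\<close>

lemma differentiable_metric_coefficient:
  assumes p: "parametrization (q, G) U \<sigma>" and u: "u \<in> U" and l: "l < q" and i: "i < q" and j: "j < q"
  shows "(\<lambda>t. sqrt (Determinant.det (metric_mat q \<sigma> (u(l := t)))) * inv_metric q \<sigma> (u(l := t)) $$ (i, j))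
    differentiable (at (u l))"
proof -
  let ?g = "\<lambda>t. metric_mat q \<sigma> (u(l := t))"
  have det: "(\<lambda>t. Determinant.det (?g t)) differentiable (at (u l))"
    by (rule differentiable_det[of _ q]) (auto intro: differentiable_metric_entry[OF p u l])
  have nz: "Determinant.det (?g (u l)) \<noteq> 0" using parametrization_det[OF p u] by simp
  obtain D where D: "((\<lambda>t. Determinant.det (?g t)) has_real_derivative D) (at (u l))"
    using det by (auto simp: real_differentiable_def)
  let ?d = "Determinant.det (?g (u l))"
  \<comment> \<open>Only \<open>?d \<noteq> 0\<close> is at hand, not its sign. In HOL
    \<open>sqrt\<close> is odd, hence differentiable at negative numbers too, and the generic rule
    covers both signs.\<close>
  have "(sqrt has_real_derivative (if ?d > 0 then inverse (sqrt ?d) / 2 else - inverse (sqrt ?d) / 2)) (at ?d)"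
    by (rule DERIV_real_sqrt_generic[OF nz]) auto
  from DERIV_chain2[OF this D]
  have sq: "(\<lambda>t. sqrt (Determinant.det (?g t))) differentiable (at (u l))"
    by (auto simp: real_differentiable_def)
  have minor: "(\<lambda>t. Determinant.det (mat_delete (?g t) j i)) differentiable (at (u l))"
  proof (rule differentiable_det[of _ "q - 1"])
    show "mat_delete (?g t) j i \<in> carrier_mat (q - 1) (q - 1)" for t
      by (rule mat_delete_carrier) simp
    fix i' j' assume ij: "i' < q - 1" "j' < q - 1"
    have "mat_delete (?g t) j i $$ (i', j') = ?g t $$ (if i' < j then i' else Suc i', if j' < i then j' else Suc j')" for t
      using ij by (simp add: mat_delete_def)
    then show "(\<lambda>t. mat_delete (?g t) j i $$ (i', j')) differentiable at (u l)"
      using ij by (auto intro: differentiable_metric_entry[OF p u l])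
  qed
  have inv: "inv_metric q \<sigma> v $$ (i, j) = (1 / Determinant.det (metric_mat q \<sigma> v)) *
      ((- 1) ^ (j + i) * Determinant.det (mat_delete (metric_mat q \<sigma> v) j i))" for v
    using i j metric_mat_carrier[of q \<sigma> v] by (simp add: inv_metric_def adj_mat_def cofactor_def)
  show ?thesis
    unfolding inv by (intro differentiable_mult sq differentiable_divide differentiable_const det nz minor)
qed

text \<open>Chart and function may change together as long as metric coefficients and values agree
  on \<open>U\<close>; this serves rotated charts as well as restricted ones.\<close>

lemma laplace_beltrami_cong:
  assumes U: "openin (Euclidean_space q) U" and u: "u \<in> U"
    and metric: "\<And>v. v \<in> U \<Longrightarrow> metric_mat q \<sigma> v = metric_mat q \<tau> v" and fg: "\<And>v. v \<in> U \<Longrightarrow> f v = g v"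
  shows "laplace_beltrami q \<sigma> f u = laplace_beltrami q \<tau> g u"
  unfolding laplace_beltrami_def
proof (intro arg_cong2[where f = "(*)"] sum.cong refl)
  show "1 / sqrt (Determinant.det (metric_mat q \<sigma> u)) = 1 / sqrt (Determinant.det (metric_mat q \<tau> u))"
    using metric[OF u] by simp
  fix i j assume i: "i \<in> {..<q}" and j: "j \<in> {..<q}"
  show "pderiv_at i (\<lambda>v. sqrt (Determinant.det (metric_mat q \<sigma> v)) * inv_metric q \<sigma> v $$ (i, j) * pderiv_at j f v) u
      = pderiv_at i (\<lambda>v. sqrt (Determinant.det (metric_mat q \<tau> v)) * inv_metric q \<tau> v $$ (i, j) * pderiv_at j g v) u"
  proof (rule pderiv_at_cong[OF U u])
    fix v assume v: "v \<in> U"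
    have "pderiv_at j f v = pderiv_at j g v"
      by (rule pderiv_at_cong[OF U v]) (use j fg in auto)
    then show "sqrt (Determinant.det (metric_mat q \<sigma> v)) * inv_metric q \<sigma> v $$ (i, j) * pderiv_at j f v
        = sqrt (Determinant.det (metric_mat q \<tau> v)) * inv_metric q \<tau> v $$ (i, j) * pderiv_at j g v"
      using metric[OF v] by (simp add: inv_metric_def)
  qed (use i in simp)
qed

lemma laplace_beltrami_linear:
  assumes p: "parametrization (q, G) U \<sigma>" and u: "u \<in> U"
    and f: "smooth_on_open q U f" and g: "smooth_on_open q U g"
  shows "laplace_beltrami q \<sigma> (\<lambda>x. a * f x + b * g x) u = a * laplace_beltrami q \<sigma> f u + b * laplace_beltrami q \<sigma> g u"
proof -
  note U = parametrization_openin[OF p]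
  define c where "c i j v = sqrt (Determinant.det (metric_mat q \<sigma> v)) * inv_metric q \<sigma> v $$ (i, j)" for i j v
  have eq: "pderiv_at i (\<lambda>v. c i j v * pderiv_at j (\<lambda>x. a * f x + b * g x) v) u
      = a * pderiv_at i (\<lambda>v. c i j v * pderiv_at j f v) u + b * pderiv_at i (\<lambda>v. c i j v * pderiv_at j g v) u"
    if i: "i < q" and j: "j < q" for i j
  proof -
    have diff: "(\<lambda>t. c i j (u(i := t)) * pderiv_at j h (u(i := t))) differentiable (at (u i))"
      if h: "smooth_on_open q U h" for h
      unfolding c_def
      by (intro differentiable_mult[OF differentiable_metric_coefficient[OF p u i i j]]
          smooth_on_open_differentiable[OF smooth_on_open_pderiv_at[OF h j] u i])
    have "pderiv_at i (\<lambda>v. c i j v * pderiv_at j (\<lambda>x. a * f x + b * g x) v) u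
      = pderiv_at i (\<lambda>v. a * (c i j v * pderiv_at j f v) + b * (c i j v * pderiv_at j g v)) u"
    proof (rule pderiv_at_cong[OF U u i])
      fix v assume v: "v \<in> U"
      have "pderiv_at j (\<lambda>x. a * f x + b * g x) v = a * pderiv_at j f v + b * pderiv_at j g v"
        by (rule pderiv_at_linear) (rule smooth_on_open_differentiable[OF _ v j], fact)+
      then show "c i j v * pderiv_at j (\<lambda>x. a * f x + b * g x) v
          = a * (c i j v * pderiv_at j f v) + b * (c i j v * pderiv_at j g v)"
        by (simp add: algebra_simps)
    qed
    also have "\<dots> = a * pderiv_at i (\<lambda>v. c i j v * pderiv_at j f v) u + b * pderiv_at i (\<lambda>v. c i j v * pderiv_at j g v) u"
      by (rule pderiv_at_linear[OF diff[OF f] diff[OF g]])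
    finally show ?thesis .
  qed
  have "(\<Sum>i<q. \<Sum>j<q. pderiv_at i (\<lambda>v. c i j v * pderiv_at j (\<lambda>x. a * f x + b * g x) v) u)
      = (\<Sum>i<q. \<Sum>j<q. a * pderiv_at i (\<lambda>v. c i j v * pderiv_at j f v) u + b * pderiv_at i (\<lambda>v. c i j v * pderiv_at j g v) u)"
    by (intro sum.cong refl eq) auto
  then show ?thesis
    unfolding laplace_beltrami_def c_def[symmetric]
    by (simp add: sum.distrib sum_distrib_left[symmetric] algebra_simps)
qed

lemma proj_trivial:
  assumes "x \<in> topspace (nsphere q)"
  shows "proj (q, {1\<^sub>m (q + 1)}) x = {x}"
  using mat_act_one[of x "q + 1"] assms topspace_nsphere_subset_Euclidean[of q] by (auto simp: proj_def)

text \<open>The sphere is the space form of the trivial group, so its charts are obtained from the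
  general notion; orbits are singletons, and injectivity concerns \<open>\<sigma>\<close>
  alone.\<close>

lemma parametrization_trivial_iff:
  "parametrization (q, {1\<^sub>m (q + 1)}) U \<sigma> \<longleftrightarrow>
     openin (Euclidean_space q) U \<and> \<sigma> ` U \<subseteq> topspace (nsphere q) \<and>
     (\<forall>k\<le>q. smooth_on_open q U (\<lambda>u. \<sigma> u k)) \<and>
     (\<forall>u\<in>U. Determinant.det (metric_mat q \<sigma> u) \<noteq> 0) \<and> inj_on \<sigma> U"
proof -
  have "inj_on (proj (q, {1\<^sub>m (q + 1)}) \<circ> \<sigma>) U \<longleftrightarrow> inj_on \<sigma> U" if "\<sigma> ` U \<subseteq> topspace (nsphere q)"
    using that proj_trivial[of _ q] unfolding inj_on_def by (simp add: image_subset_iff)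
  then show ?thesis by (auto simp: parametrization_def)
qed

text \<open>The derivatives of the rotated chart are \<open>A\<close> applied to those of
  \<open>\<sigma>\<close>, and \<open>A\<close> preserves inner products, so the Gram matrices
  coincide.\<close>

lemma
  assumes A: "A \<in> carrier (orthogonal_group (q + 1))" and p: "parametrization (q, {1\<^sub>m (q + 1)}) U \<sigma>"
  shows parametrization_mat_act: "parametrization (q, {1\<^sub>m (q + 1)}) U (\<lambda>u. mat_act A (\<sigma> u))"
    and metric_mat_mat_act: "u \<in> U \<Longrightarrow> metric_mat q (\<lambda>u. mat_act A (\<sigma> u)) u = metric_mat q \<sigma> u"
proof -
  have Ac: "A \<in> carrier_mat (q + 1) (q + 1)" using A carrier_orthogonal_group by blast
  have U: "openin (Euclidean_space q) U" and sm: "\<And>k. k \<le> q \<Longrightarrow> smooth_on_open q U (\<lambda>u. \<sigma> u k)"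
    and S: "\<sigma> ` U \<subseteq> topspace (nsphere q)" and inj: "inj_on \<sigma> U"
    and det: "\<forall>u\<in>U. Determinant.det (metric_mat q \<sigma> u) \<noteq> 0"
    using p unfolding parametrization_trivial_iff by blast+
  have coord: "(\<lambda>u. mat_act A (\<sigma> u) k) = (\<lambda>u. \<Sum>j<q + 1. A $$ (k, j) * \<sigma> u j)" if "k \<le> q" for k
    using that by (simp add: mat_act_apply[OF Ac])
  have pd: "pderiv_at i (\<lambda>v. mat_act A (\<sigma> v) k) u = mat_act A (\<lambda>j. pderiv_at i (\<lambda>v. \<sigma> v j) u) k"
    if "k \<le> q" "i < q" "u \<in> U" for i k u
    unfolding coord[OF that(1)] unfolding mat_act_apply[OF Ac] using that
    by (subst pderiv_at_sum) (auto intro!: smooth_on_open_differentiable[OF sm])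
  show metric: "metric_mat q (\<lambda>u. mat_act A (\<sigma> u)) u = metric_mat q \<sigma> u" if u: "u \<in> U" for u
  proof (rule eq_matI)
    fix i j assume "i < dim_row (metric_mat q \<sigma> u)" "j < dim_col (metric_mat q \<sigma> u)"
    then have ij: "i < q" "j < q" by (auto simp: metric_mat_def)
    have "(\<Sum>k\<le>q. pderiv_at i (\<lambda>v. mat_act A (\<sigma> v) k) u * pderiv_at j (\<lambda>v. mat_act A (\<sigma> v) k) u)
      = (\<Sum>k\<le>q. mat_act A (\<lambda>l. pderiv_at i (\<lambda>v. \<sigma> v l) u) k * mat_act A (\<lambda>l. pderiv_at j (\<lambda>v. \<sigma> v l) u) k)"
      using pd ij u by (intro sum.cong refl) simp
    also have "\<dots> = (\<Sum>k\<le>q. pderiv_at i (\<lambda>v. \<sigma> v k) u * pderiv_at j (\<lambda>v. \<sigma> v k) u)"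
      using mat_act_inner[OF A] by (simp add: lessThan_Suc_atMost)
    finally show "metric_mat q (\<lambda>u. mat_act A (\<sigma> u)) u $$ (i, j) = metric_mat q \<sigma> u $$ (i, j)"
      using ij by (simp add: metric_mat_entry)
  qed (simp_all add: metric_mat_def)
  show "parametrization (q, {1\<^sub>m (q + 1)}) U (\<lambda>u. mat_act A (\<sigma> u))"
    unfolding parametrization_trivial_iff
  proof (intro conjI allI impI ballI U)
    show "(\<lambda>u. mat_act A (\<sigma> u)) ` U \<subseteq> topspace (nsphere q)"
      using S mat_act_nsphere[OF A] by auto
    show "smooth_on_open q U (\<lambda>u. mat_act A (\<sigma> u) k)" if "k \<le> q" for k
      unfolding coord[OF that] by (rule smooth_on_open_sum[OF U]) (auto intro: sm)
    show "Determinant.det (metric_mat q (\<lambda>u. mat_act A (\<sigma> u)) u) \<noteq> 0" if "u \<in> U" for u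
      using metric det that by simp
    show "inj_on (\<lambda>u. mat_act A (\<sigma> u)) U"
    proof (rule inj_onI)
      fix u v assume uv: "u \<in> U" "v \<in> U" and eq: "mat_act A (\<sigma> u) = mat_act A (\<sigma> v)"
      have "edist q (\<sigma> u) (\<sigma> v) = 0"
        using edist_mat_act[OF A, of "\<sigma> u" "\<sigma> v"] eq by simp
      then show "u = v"
        using edist_eq_0_iff S uv inj by (metis image_subset_iff inj_onD)
    qed
  qed
qed

section \<open>Eigenspaces\<close>

text \<open>The functions live on points, whereas those of \<open>eigenspace\<close> for the trivial
  group live on singleton orbits; matrices can thus act by composition.\<close>

definition sphere_eigenspace :: "nat \<Rightarrow> real \<Rightarrow> ((nat \<Rightarrow> real) \<Rightarrow> real) set" where
  "sphere_eigenspace q l = {F. (\<forall>x. x \<notin> topspace (nsphere q) \<longrightarrow> F x = 0) \<and>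
     (\<forall>U \<sigma>. parametrization (q, {1\<^sub>m (q + 1)}) U \<sigma> \<longrightarrow> smooth_on_open q U (F \<circ> \<sigma>) \<and>
        (\<forall>u\<in>U. - laplace_beltrami q \<sigma> (F \<circ> \<sigma>) u = l * F (\<sigma> u)))}"

lemma sphere_eigenspaceI:
  assumes "\<And>x. x \<notin> topspace (nsphere q) \<Longrightarrow> F x = 0"
    and "\<And>U \<sigma>. parametrization (q, {1\<^sub>m (q + 1)}) U \<sigma> \<Longrightarrow> smooth_on_open q U (F \<circ> \<sigma>)"
    and "\<And>U \<sigma> u. parametrization (q, {1\<^sub>m (q + 1)}) U \<sigma> \<Longrightarrow> u \<in> U \<Longrightarrow>
      - laplace_beltrami q \<sigma> (F \<circ> \<sigma>) u = l * F (\<sigma> u)"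
  shows "F \<in> sphere_eigenspace q l"
  unfolding sphere_eigenspace_def using assms by blast

lemma
  assumes "F \<in> sphere_eigenspace q l"
  shows sphere_eigenspace_zero: "x \<notin> topspace (nsphere q) \<Longrightarrow> F x = 0"
    and sphere_eigenspace_smooth: "parametrization (q, {1\<^sub>m (q + 1)}) U \<sigma> \<Longrightarrow> smooth_on_open q U (F \<circ> \<sigma>)"
    and sphere_eigenspace_eigen: "parametrization (q, {1\<^sub>m (q + 1)}) U \<sigma> \<Longrightarrow> u \<in> U \<Longrightarrow>
      - laplace_beltrami q \<sigma> (F \<circ> \<sigma>) u = l * F (\<sigma> u)"
  using assms unfolding sphere_eigenspace_def by blast+

lemma vector_space_fun: "vector_space (\<lambda>(c::real) (f::'a \<Rightarrow> real) x. c * f x)"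
  by unfold_locales (auto simp: fun_eq_iff plus_fun_def algebra_simps)

lemma sphere_eigenspace_linear:
  assumes F: "F \<in> sphere_eigenspace q l" and H: "H \<in> sphere_eigenspace q l"
  shows "(\<lambda>x. a * F x + b * H x) \<in> sphere_eigenspace q l"
proof (rule sphere_eigenspaceI)
  show "a * F x + b * H x = 0" if "x \<notin> topspace (nsphere q)" for x
    using sphere_eigenspace_zero[OF F that] sphere_eigenspace_zero[OF H that] by simp
next
  fix U \<sigma> assume p: "parametrization (q, {1\<^sub>m (q + 1)}) U \<sigma>"
  have eq: "(\<lambda>x. a * F x + b * H x) \<circ> \<sigma> = (\<lambda>u. a * (F \<circ> \<sigma>) u + b * (H \<circ> \<sigma>) u)"
    by (simp add: fun_eq_iff)
  show "smooth_on_open q U ((\<lambda>x. a * F x + b * H x) \<circ> \<sigma>)"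
    unfolding eq by (intro smooth_on_open_linear sphere_eigenspace_smooth[OF F p] sphere_eigenspace_smooth[OF H p])
  fix u assume u: "u \<in> U"
  have "laplace_beltrami q \<sigma> ((\<lambda>x. a * F x + b * H x) \<circ> \<sigma>) u
      = a * laplace_beltrami q \<sigma> (F \<circ> \<sigma>) u + b * laplace_beltrami q \<sigma> (H \<circ> \<sigma>) u"
    unfolding eq
    by (rule laplace_beltrami_linear[OF p u sphere_eigenspace_smooth[OF F p] sphere_eigenspace_smooth[OF H p]])
  also have "\<dots> = - (a * (- laplace_beltrami q \<sigma> (F \<circ> \<sigma>) u) + b * (- laplace_beltrami q \<sigma> (H \<circ> \<sigma>) u))"
    by simp
  finally show "- laplace_beltrami q \<sigma> ((\<lambda>x. a * F x + b * H x) \<circ> \<sigma>) u = l * (a * F (\<sigma> u) + b * H (\<sigma> u))"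
    unfolding sphere_eigenspace_eigen[OF F p u] sphere_eigenspace_eigen[OF H p u] by (simp add: algebra_simps)
qed

lemma zero_in_sphere_eigenspace: "(\<lambda>_. 0) \<in> sphere_eigenspace q l"
proof (rule sphere_eigenspaceI)
  fix U \<sigma> assume p: "parametrization (q, {1\<^sub>m (q + 1)}) U \<sigma>"
  have eq: "(\<lambda>_. 0) \<circ> \<sigma> = (\<lambda>_. 0 :: real)" by (simp add: fun_eq_iff)
  show sm: "smooth_on_open q U ((\<lambda>_. 0) \<circ> \<sigma>)"
    unfolding eq by (rule smooth_on_open_zero[OF parametrization_openin[OF p]])
  fix u assume u: "u \<in> U"
  show "- laplace_beltrami q \<sigma> ((\<lambda>_. 0) \<circ> \<sigma>) u = l * 0"
    \<comment> \<open>Linearity with both coefficients 0 yields the Laplacian of the zero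
      function.\<close>
    using laplace_beltrami_linear[OF p u sm sm, of 0 0] by (simp add: eq)
qed simp

lemma subspace_sphere_eigenspace:
  "module.subspace (\<lambda>(c::real) f x. c * f x) (sphere_eigenspace q l)"
proof -
  interpret vector_space "\<lambda>(c::real) (f::(nat \<Rightarrow> real) \<Rightarrow> real) x. c * f x" by (rule vector_space_fun)
  show ?thesis
    unfolding subspace_def plus_fun_def zero_fun_def
    using zero_in_sphere_eigenspace[of q l] sphere_eigenspace_linear[of _ q l _ 1 1]
      sphere_eigenspace_linear[of _ q l _ _ 0] by auto
qed

text \<open>\<open>mat_act\<close> discards the coordinates beyond \<open>q\<close> and may move a
  point onto the sphere from outside, so the value 0 off the sphere is imposed explicitly.\<close>

definition pullback :: "nat \<Rightarrow> real mat \<Rightarrow> ((nat \<Rightarrow> real) \<Rightarrow> real) \<Rightarrow> (nat \<Rightarrow> real) \<Rightarrow> real" where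
  "pullback q A F x = (if x \<in> topspace (nsphere q) then F (mat_act A x) else 0)"

text \<open>Isometry invariance of the Laplacian: the pullback read in the chart
  \<open>\<sigma>\<close> is \<open>F\<close> read in the rotated chart, which has the same metric
  coefficients.\<close>

lemma pullback_in_sphere_eigenspace:
  assumes A: "A \<in> carrier (orthogonal_group (q + 1))" and F: "F \<in> sphere_eigenspace q l"
  shows "pullback q A F \<in> sphere_eigenspace q l"
proof (rule sphere_eigenspaceI)
  fix U \<sigma> assume p: "parametrization (q, {1\<^sub>m (q + 1)}) U \<sigma>"
  let ?\<sigma> = "\<lambda>u. mat_act A (\<sigma> u)"
  note p' = parametrization_mat_act[OF A p]
  have eq: "(F \<circ> ?\<sigma>) v = (pullback q A F \<circ> \<sigma>) v" if "v \<in> U" for v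
    using parametrization_sphere[OF p that] by (simp add: pullback_def)
  show "smooth_on_open q U (pullback q A F \<circ> \<sigma>)"
    by (rule smooth_on_open_cong[OF sphere_eigenspace_smooth[OF F p'] eq])
  fix u assume u: "u \<in> U"
  have "laplace_beltrami q \<sigma> (pullback q A F \<circ> \<sigma>) u = laplace_beltrami q ?\<sigma> (F \<circ> ?\<sigma>) u"
    by (rule laplace_beltrami_cong[OF parametrization_openin[OF p] u])
      (simp_all only: metric_mat_mat_act[OF A p] eq)
  then show "- laplace_beltrami q \<sigma> (pullback q A F \<circ> \<sigma>) u = l * pullback q A F (\<sigma> u)"
    using sphere_eigenspace_eigen[OF F p' u] eq[OF u] by simp
qed (simp add: pullback_def)

text \<open>Composition reverses the factors: the matrices act from the right.\<close>

lemma pullback_pullback: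
  assumes "A \<in> carrier (orthogonal_group (q + 1))" "B \<in> carrier (orthogonal_group (q + 1))"
  shows "pullback q A (pullback q B F) = pullback q (B * A) F"
proof -
  have "A \<in> carrier_mat (q + 1) (q + 1)" "B \<in> carrier_mat (q + 1) (q + 1)"
    using assms carrier_orthogonal_group by blast+
  then show ?thesis
    using mat_act_nsphere[OF assms(1)] by (auto simp: pullback_def fun_eq_iff mat_act_mult)
qed

lemma pullback_one:
  assumes "\<And>x. x \<notin> topspace (nsphere q) \<Longrightarrow> F x = 0"
  shows "pullback q (1\<^sub>m (q + 1)) F = F"
proof
  fix x
  show "pullback q (1\<^sub>m (q + 1)) F x = F x"
  proof (cases "x \<in> topspace (nsphere q)")
    case True
    then have "mat_act (1\<^sub>m (q + 1)) x = x"
      using mat_act_one[of x "q + 1"] topspace_nsphere_subset_Euclidean by auto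
    then show ?thesis using True unfolding pullback_def by simp
  qed (use assms in \<open>auto simp: pullback_def\<close>)
qed

lemma finite_operator_family_pullback:
  assumes sub: "\<Gamma> \<subseteq> carrier (orthogonal_group (q + 1))" and fin: "finite \<Gamma>" and one: "1\<^sub>m (q + 1) \<in> \<Gamma>"
    and mult: "\<And>A B. A \<in> \<Gamma> \<Longrightarrow> B \<in> \<Gamma> \<Longrightarrow> A * B \<in> \<Gamma>"
  shows "finite_operator_family (\<lambda>(c::real) f x. c * f x) (sphere_eigenspace q l) \<Gamma> (pullback q)"
proof -
  interpret vector_space "\<lambda>(c::real) (f::(nat \<Rightarrow> real) \<Rightarrow> real) x. c * f x" by (rule vector_space_fun)
  show ?thesis
  proof (intro finite_operator_family.intro finite_operator_family_axioms.intro vector_space_fun subspace_sphere_eigenspace fin)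
    fix A assume A: "A \<in> \<Gamma>"
    show "Vector_Spaces.linear (\<lambda>(c::real) f x. c * f x) (\<lambda>(c::real) f x. c * f x) (pullback q A)"
      unfolding linear_iff_module_hom module_hom_iff
      by (auto intro: module_axioms simp: pullback_def fun_eq_iff)
    show "pullback q A F \<in> sphere_eigenspace q l" if "F \<in> sphere_eigenspace q l" for F
      by (rule pullback_in_sphere_eigenspace[OF _ that]) (use A sub in blast)
    fix B assume B: "B \<in> \<Gamma>"
    have "pullback q A (pullback q B F) = pullback q (B * A) F" for F
      using A B sub by (intro pullback_pullback) auto
    then show "\<exists>k\<in>\<Gamma>. \<forall>v\<in>sphere_eigenspace q l. pullback q A (pullback q B v) = pullback q k v"
      using mult[OF B A] by blast
  next
    show "\<exists>e\<in>\<Gamma>. \<forall>v\<in>sphere_eigenspace q l. pullback q e v = v"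
      using one pullback_one sphere_eigenspace_zero by blast
  qed
qed

context space_form_group
begin

lemma parametrization_imp_trivial:
  assumes "parametrization (q, G) U \<sigma>"
  shows "parametrization (q, {1\<^sub>m (q + 1)}) U \<sigma>"
  using assms unfolding parametrization_trivial_iff
  by (auto simp: parametrization_def inj_on_def)

text \<open>On the preimage of a ball of radius 2 \<delta> around \<open>\<sigma> u\<close> the
  orbit projection is injective: two image points in one orbit are closer than 4 \<delta> and hence
  equal.\<close>

lemma local_parametrization:
  assumes p: "parametrization (q, {1\<^sub>m (q + 1)}) U \<sigma>" and u: "u \<in> U"
  obtains V where "V \<subseteq> U" "u \<in> V" "parametrization (q, G) V \<sigma>"
proof -
  have U: "openin (Euclidean_space q) U" and sm: "\<And>k. k \<le> q \<Longrightarrow> smooth_on_open q U (\<lambda>u. \<sigma> u k)"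
    and S: "\<sigma> ` U \<subseteq> topspace (nsphere q)" and inj: "inj_on \<sigma> U"
    and det: "\<forall>u\<in>U. Determinant.det (metric_mat q \<sigma> u) \<noteq> 0"
    using p unfolding parametrization_trivial_iff by blast+
  obtain \<delta> where \<delta>: "\<delta> > 0"
    "\<And>x y. x \<in> topspace (nsphere q) \<Longrightarrow> y \<in> proj (q, G) x \<Longrightarrow> edist q x y < 4 * \<delta> \<Longrightarrow> x = y"
    using separation by metis
  define V where "V = U \<inter> (\<lambda>v. edist q (\<sigma> u) (\<sigma> v)) -` {..<2 * \<delta>}"
  have UT: "U \<subseteq> {x. \<forall>i\<ge>q. x i = 0}"
    using openin_subset[OF U] by (simp add: topspace_Euclidean_space)
  have top: "subtopology (Euclidean_space q) U = top_of_set U"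
    unfolding Euclidean_space_eq_top_of_set subtopology_subtopology using UT by (simp add: inf.absorb2)
  have "continuous_on U (\<lambda>v. \<sigma> v k)" if "k \<le> q" for k
  proof -
    have "C_on q 0 U (\<lambda>v. \<sigma> v k)" using sm[OF that] unfolding smooth_on_open_def by blast
    then show ?thesis by (simp add: top)
  qed
  then have "continuous_on U (\<lambda>v. edist q (\<sigma> u) (\<sigma> v))"
    unfolding edist_def L2_set_def by (intro continuous_intros) auto
  then have "openin (top_of_set U) V"
    unfolding V_def by (simp add: continuous_openin_preimage_gen)
  then have V: "openin (Euclidean_space q) V"
    using U openin_trans_full unfolding top[symmetric] by blast
  have "inj_on (proj (q, G) \<circ> \<sigma>) V"
  proof (rule inj_onI)
    fix v w assume v: "v \<in> V" and w: "w \<in> V" and eq: "(proj (q, G) \<circ> \<sigma>) v = (proj (q, G) \<circ> \<sigma>) w"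
    have vS: "\<sigma> v \<in> topspace (nsphere q)" "\<sigma> w \<in> topspace (nsphere q)" using v w S by (auto simp: V_def)
    have "\<sigma> w \<in> proj (q, G) (\<sigma> v)" using eq in_proj[OF vS(2)] by simp
    moreover have "edist q (\<sigma> v) (\<sigma> w) < 4 * \<delta>"
      using edist_triangle[of q "\<sigma> v" "\<sigma> w" "\<sigma> u"] edist_commute[of q "\<sigma> v" "\<sigma> u"] v w by (simp add: V_def)
    ultimately have "\<sigma> v = \<sigma> w" using \<delta>(2) vS by blast
    then show "v = w" using inj v w by (auto simp: V_def inj_on_def)
  qed
  moreover have VU: "V \<subseteq> U" by (auto simp: V_def)
  moreover have "u \<in> V" using u \<delta>(1) by (simp add: V_def)
  moreover have "smooth_on_open q V (\<lambda>u. \<sigma> u k)" if "k \<le> q" for k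
    by (rule smooth_on_open_subset[OF sm[OF that] VU V])
  moreover have "\<sigma> ` V \<subseteq> topspace (nsphere q)" "\<forall>u\<in>V. Determinant.det (metric_mat q \<sigma> u) \<noteq> 0"
    using S det VU by auto
  ultimately show ?thesis using that[of V] V by (simp add: parametrization_def)
qed

definition lift :: "((nat \<Rightarrow> real) set \<Rightarrow> real) \<Rightarrow> (nat \<Rightarrow> real) \<Rightarrow> real" where
  "lift f x = (if x \<in> topspace (nsphere q) then f (proj (q, G) x) else 0)"

text \<open>Smoothness and the eigenvalue equation are local, and near each point of its domain a
  sphere chart is also a chart of the quotient.\<close>

lemma lift_eigenspace:
  assumes f: "f \<in> eigenspace (q, G) l"
  shows "lift f \<in> sphere_eigenspace q l"
proof (rule sphere_eigenspaceI)
  have f_smooth: "smooth_on_open q U (f \<circ> proj (q, G) \<circ> \<sigma>)"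
    and f_eigen: "\<And>u. u \<in> U \<Longrightarrow> - laplace_beltrami q \<sigma> (f \<circ> proj (q, G) \<circ> \<sigma>) u = l * f (proj (q, G) (\<sigma> u))"
    if "parametrization (q, G) U \<sigma>" for U \<sigma>
    using f that unfolding eigenspace_def fst_conv by blast+
  fix U \<sigma> assume p: "parametrization (q, {1\<^sub>m (q + 1)}) U \<sigma>"
  have eq: "(f \<circ> proj (q, G) \<circ> \<sigma>) v = (lift f \<circ> \<sigma>) v" if "v \<in> U" for v
    using parametrization_sphere[OF p that] by (simp add: lift_def)
  show "smooth_on_open q U (lift f \<circ> \<sigma>)"
  proof (rule smooth_on_open_local[OF parametrization_openin[OF p]])
    fix u assume "u \<in> U"
    then obtain V where V: "V \<subseteq> U" "u \<in> V" "parametrization (q, G) V \<sigma>"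
      using local_parametrization[OF p] by metis
    have "smooth_on_open q V (lift f \<circ> \<sigma>)"
      by (rule smooth_on_open_cong[OF f_smooth[OF V(3)]]) (use eq V in blast)
    then show "\<exists>V. u \<in> V \<and> V \<subseteq> U \<and> smooth_on_open q V (lift f \<circ> \<sigma>)" using V by blast
  qed
  fix u assume u: "u \<in> U"
  then obtain V where V: "V \<subseteq> U" "u \<in> V" "parametrization (q, G) V \<sigma>"
    using local_parametrization[OF p] by metis
  have "laplace_beltrami q \<sigma> (f \<circ> proj (q, G) \<circ> \<sigma>) u = laplace_beltrami q \<sigma> (lift f \<circ> \<sigma>) u"
    by (rule laplace_beltrami_cong[OF parametrization_openin[OF V(3)] V(2)]) (use eq V in blast)+
  then show "- laplace_beltrami q \<sigma> (lift f \<circ> \<sigma>) u = l * lift f (\<sigma> u)"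
    using f_eigen[OF V(3,2)] eq[OF u] by simp
qed (simp add: lift_def)

text \<open>Invariant functions descend to orbits, and every quotient chart is a sphere chart, so in
  this direction the equations carry over on the whole domain.\<close>

lemma lift_image_eigenspace:
  "lift ` eigenspace (q, G) l = {F \<in> sphere_eigenspace q l. \<forall>A\<in>G. pullback q A F = F}"
proof (intro equalityI subsetI)
  fix F assume "F \<in> lift ` eigenspace (q, G) l"
  then obtain f where f: "f \<in> eigenspace (q, G) l" "F = lift f" by auto
  then show "F \<in> {F \<in> sphere_eigenspace q l. \<forall>A\<in>G. pullback q A F = F}"
    unfolding f(2) using lift_eigenspace[OF f(1)] act_sphere proj_act
    by (auto simp: lift_def[abs_def] pullback_def fun_eq_iff)
next
  fix F assume "F \<in> {F \<in> sphere_eigenspace q l. \<forall>A\<in>G. pullback q A F = F}"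
  then have F: "F \<in> sphere_eigenspace q l" and inv: "\<And>A. A \<in> G \<Longrightarrow> pullback q A F = F" by auto
  \<comment> \<open>An arbitrary representative of the orbit; invariance of \<open>F\<close> makes
    the value independent of it, as \<open>f_proj\<close> shows.\<close>
  define f where "f P = (if P \<in> points (q, G) then F (SOME x. x \<in> P) else 0)" for P
  have f_proj: "f (proj (q, G) x) = F x" if x: "x \<in> topspace (nsphere q)" for x
  proof -
    have "(SOME y. y \<in> proj (q, G) x) \<in> proj (q, G) x" by (rule someI[of "\<lambda>y. y \<in> proj (q, G) x"]) (rule in_proj[OF x])
    then obtain A where A: "A \<in> G" "(SOME y. y \<in> proj (q, G) x) = mat_act A x" by (auto simp: proj_apply)
    have "F (mat_act A x) = F x" using inv[OF A(1)] x by (metis pullback_def)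
    then show ?thesis using x A by (simp add: f_def points_eq)
  qed
  have "lift f = F"
    using f_proj sphere_eigenspace_zero[OF F] by (auto simp: lift_def fun_eq_iff)
  moreover have "f \<in> eigenspace (q, G) l"
    unfolding eigenspace_def mem_Collect_eq fst_conv
  proof (intro conjI allI impI ballI)
    show "f P = 0" if "P \<notin> points (q, G)" for P using that by (simp add: f_def)
    fix U \<sigma> assume p: "parametrization (q, G) U \<sigma>"
    note p' = parametrization_imp_trivial[OF p]
    have eq: "(F \<circ> \<sigma>) v = (f \<circ> proj (q, G) \<circ> \<sigma>) v" if "v \<in> U" for v
      using parametrization_sphere[OF p that] f_proj by simp
    show "smooth_on_open q U (f \<circ> proj (q, G) \<circ> \<sigma>)"
      by (rule smooth_on_open_cong[OF sphere_eigenspace_smooth[OF F p'] eq])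
    fix u assume u: "u \<in> U"
    have "laplace_beltrami q \<sigma> (F \<circ> \<sigma>) u = laplace_beltrami q \<sigma> (f \<circ> proj (q, G) \<circ> \<sigma>) u"
      by (rule laplace_beltrami_cong[OF parametrization_openin[OF p] u refl eq])
    then show "- laplace_beltrami q \<sigma> (f \<circ> proj (q, G) \<circ> \<sigma>) u = l * f (proj (q, G) (\<sigma> u))"
      using sphere_eigenspace_eigen[OF F p' u] eq[OF u] by simp
  qed
  ultimately show "F \<in> lift ` eigenspace (q, G) l" by blast
qed

text \<open>Lifting is linear, and injective because eigenfunctions vanish off
  \<open>points\<close>, so it preserves dimensions.\<close>

lemma Spec_eq:
  "Spec (q, G) l = vector_space.dim (\<lambda>(c::real) f x. c * f x)
     {F \<in> sphere_eigenspace q l. \<forall>A\<in>G. pullback q A F = F}"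
proof -
  interpret v1: vector_space "\<lambda>(c::real) (f::(nat \<Rightarrow> real) set \<Rightarrow> real) x. c * f x" by (rule vector_space_fun)
  interpret v2: vector_space "\<lambda>(c::real) (f::(nat \<Rightarrow> real) \<Rightarrow> real) x. c * f x" by (rule vector_space_fun)
  interpret vector_space_pair "\<lambda>(c::real) (f::(nat \<Rightarrow> real) set \<Rightarrow> real) x. c * f x"
    "\<lambda>(c::real) (f::(nat \<Rightarrow> real) \<Rightarrow> real) x. c * f x" ..
  let ?W = "{F \<in> sphere_eigenspace q l. \<forall>A\<in>G. pullback q A F = F}"
  have inj: "f = g" if "\<And>P. P \<notin> points (q, G) \<Longrightarrow> f P = 0" "\<And>P. P \<notin> points (q, G) \<Longrightarrow> g P = 0" "lift f = lift g" for f g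
  proof
    fix P
    show "f P = g P"
    proof (cases "P \<in> points (q, G)")
      case True
      then obtain x where "x \<in> topspace (nsphere q)" "P = proj (q, G) x" by (auto simp: points_eq)
      then show ?thesis using fun_cong[OF that(3), of x] by (simp add: lift_def)
    qed (use that in simp)
  qed
  have zero: "f P = 0" if "f \<in> eigenspace (q, G) l" "P \<notin> points (q, G)" for f P
    using that unfolding eigenspace_def by blast
  \<comment> \<open>Membership is detected on lifts, so the subspace property of the eigenspace is
    inherited from \<open>?W\<close> without another computation in charts.\<close>
  have eig: "f \<in> eigenspace (q, G) l" if f: "\<And>P. P \<notin> points (q, G) \<Longrightarrow> f P = 0" "lift f \<in> ?W" for f
  proof -
    obtain g where "g \<in> eigenspace (q, G) l" "lift g = lift f"
      using f(2) lift_image_eigenspace[of l] by (metis (no_types, lifting) imageE)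
    then show ?thesis using inj[of f g] f(1) zero by metis
  qed
  have lin: "Vector_Spaces.linear (\<lambda>(c::real) (f::(nat \<Rightarrow> real) set \<Rightarrow> real) x. c * f x) (\<lambda>(c::real) f x. c * f x) lift"
    unfolding linear_iff_module_hom module_hom_iff
    by (auto intro: v1.module_axioms v2.module_axioms simp: lift_def fun_eq_iff)
  have W: "v2.subspace ?W"
    using subspace_sphere_eigenspace[of q l]
    unfolding v2.subspace_def by (auto simp: pullback_def fun_eq_iff)
  have lift_lin: "lift (f + g) = lift f + lift g" "lift 0 = 0" "lift (\<lambda>x. c * f x) = (\<lambda>x. c * lift f x)" for f g c
    by (auto simp: lift_def fun_eq_iff)
  have lift_W: "lift f \<in> ?W" if "f \<in> eigenspace (q, G) l" for f
    using that lift_image_eigenspace by blast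
  have "v1.subspace (eigenspace (q, G) l)"
    unfolding v1.subspace_def
  proof (intro conjI ballI allI)
    show "0 \<in> eigenspace (q, G) l"
      by (rule eig) (use W in \<open>simp_all only: lift_lin v2.subspace_def zero_fun_apply\<close>)
    show "f + g \<in> eigenspace (q, G) l" if "f \<in> eigenspace (q, G) l" "g \<in> eigenspace (q, G) l" for f g
    proof (rule eig)
      show "lift (f + g) \<in> ?W"
        unfolding lift_lin using W lift_W[OF that(1)] lift_W[OF that(2)] v2.subspace_add by blast
    qed (simp add: zero that)
    show "(\<lambda>x. c * f x) \<in> eigenspace (q, G) l" if "f \<in> eigenspace (q, G) l" for f c
    proof (rule eig)
      show "lift (\<lambda>x. c * f x) \<in> ?W"
        unfolding lift_lin using W lift_W[OF that] v2.subspace_scale by blast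
    qed (simp add: zero that)
  qed
  moreover have "inj_on lift (eigenspace (q, G) l)"
    using inj zero by (auto intro!: inj_onI)
  ultimately have "v2.dim (lift ` eigenspace (q, G) l) = v1.dim (eigenspace (q, G) l)"
    by (rule dim_image_eq_of_inj[OF lin])
  then show ?thesis by (simp only: Spec_def lift_image_eigenspace)
qed

end

text \<open>Elementwise conjugacy in \<open>\<Gamma>\<close> gives equal traces on the sphere
  eigenspaces; so the invariants of \<open>G\<close> and of \<open>H\<close>, which are the
  eigenspaces of the quotients, have equal dimensions.\<close>

theorem isospectral_of_almost_conjugate:
  assumes "spherical_space_form (q, G)" "spherical_space_form (q, H)"
    and sub: "\<Gamma> \<subseteq> carrier (orthogonal_group (q + 1))" and fin: "finite \<Gamma>"
    and mult: "\<And>A B. A \<in> \<Gamma> \<Longrightarrow> B \<in> \<Gamma> \<Longrightarrow> A * B \<in> \<Gamma>"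
    and G\<Gamma>: "G \<subseteq> \<Gamma>" and H\<Gamma>: "H \<subseteq> \<Gamma>" and \<beta>: "bij_betw \<beta> G H"
    and conj: "\<And>A. A \<in> G \<Longrightarrow> \<exists>S\<in>\<Gamma>. \<exists>T\<in>\<Gamma>. \<beta> A = T * A * S \<and> S * T = 1\<^sub>m (q + 1)"
  shows "isospectral (q, G) (q, H)"
  unfolding isospectral_def
proof
  fix l
  interpret G: space_form_group q G by unfold_locales (rule assms)
  interpret H: space_form_group q H by unfold_locales (rule assms)
  interpret finite_operator_family "\<lambda>(c::real) f x. c * f x" "sphere_eigenspace q l" \<Gamma> "pullback q"
    by (rule finite_operator_family_pullback[OF sub fin _ mult]) (use G.one_in_G G\<Gamma> in auto)
  have closed: "closed_under_action K" if "space_form_group q K" "K \<subseteq> \<Gamma>" for K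
  proof -
    interpret K: space_form_group q K by (rule that(1))
    \<comment> \<open>Right translations appear because pullback reverses products.\<close>
    have "bij_betw (\<lambda>B. B * A) K K" if A: "A \<in> K" for A
    proof -
      obtain C where C: "C \<in> K" "A * C = 1\<^sub>m (q + 1)" "C * A = 1\<^sub>m (q + 1)" using K.G_inverse[OF A] by blast
      have assoc: "X * Y * Z = X * (Y * Z)" if "X \<in> K" "Y \<in> K" "Z \<in> K" for X Y Z
        using that K.G_carrier_mat by (meson assoc_mult_mat)
      have one: "X * 1\<^sub>m (q + 1) = X" if "X \<in> K" for X
        using K.G_carrier_mat[OF that] by simp
      show ?thesis
        by (rule bij_betw_byWitness[where f' = "\<lambda>B. B * C"])
          (use A C K.mult_in_G in \<open>auto simp: assoc one simp del: One_nat_def\<close>)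
    qed
    moreover have "pullback q A (pullback q B F) = pullback q (B * A) F" if "A \<in> K" "B \<in> K" for A B F
      using that K.G_orthogonal by (intro pullback_pullback)
    ultimately show ?thesis
      unfolding closed_under_action_def using that(2) K.one_in_G by blast
  qed
  have "dim (fixed_space G) = dim (fixed_space H)"
  proof (rule dim_fixed_space_eq[OF closed[OF _ G\<Gamma>] closed[OF _ H\<Gamma>] \<beta>])
    show "space_form_group q G" "space_form_group q H" by unfold_locales
    fix A assume A: "A \<in> G"
    then obtain S T where ST: "S \<in> \<Gamma>" "T \<in> \<Gamma>" "\<beta> A = T * A * S" "S * T = 1\<^sub>m (q + 1)" using conj by blast
    have o: "A \<in> carrier (orthogonal_group (q + 1))" "S \<in> carrier (orthogonal_group (q + 1))"
      "T \<in> carrier (orthogonal_group (q + 1))" "T * A \<in> carrier (orthogonal_group (q + 1))"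
      using A ST sub G\<Gamma> mult by blast+
    \<comment> \<open>After the reversal, pullback by \<open>T\<close> comes first and by
      \<open>S\<close> last; the product that has to be the identity is therefore
      \<open>S * T\<close>.\<close>
    have "pullback q (\<beta> A) F = pullback q S (pullback q A (pullback q T F))" for F
      by (simp only: pullback_pullback o ST(3))
    moreover have "pullback q T (pullback q S F) = F" if "F \<in> sphere_eigenspace q l" for F
      unfolding pullback_pullback[OF o(3,2)] ST(4)
      by (rule pullback_one) (rule sphere_eigenspace_zero[OF that])
    ultimately show "\<exists>s\<in>\<Gamma>. \<exists>t\<in>\<Gamma>. (\<forall>v\<in>sphere_eigenspace q l. pullback q (\<beta> A) v = pullback q s (pullback q A (pullback q t v))) \<and>
        (\<forall>v\<in>sphere_eigenspace q l. pullback q t (pullback q s v) = v)"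
      using ST by blast
  qed
  then show "Spec (q, G) l = Spec (q, H) l"
    by (simp only: G.Spec_eq H.Spec_eq fixed_space_def)
qed

section \<open>Simple connectedness of the sphere\<close>

lemma continuous_map_nsphere_iff:
  "continuous_map (top_of_set I) (nsphere q) r \<longleftrightarrow> continuous_on I r \<and> r ` I \<subseteq> topspace (nsphere q)"
  by (subst nsphere_eq_top_of_set) (auto simp: continuous_map_in_subtopology)

text \<open>Two closed hemispheres are contractible and share the basis vector with index 1, which
  lies on the sphere since \<open>q \<ge> 1\<close>.\<close>

lemma nsphere_path_exists:
  assumes "q \<ge> 1" "x \<in> topspace (nsphere q)" "y \<in> topspace (nsphere q)"
  obtains r where "continuous_on {0..1} r" "r ` {0..1::real} \<subseteq> topspace (nsphere q)" "r 0 = x" "r 1 = y"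
proof -
  have "path_connectedin (nsphere q) (topspace (nsphere q) \<inter> {x. x 0 \<ge> 0})"
    "path_connectedin (nsphere q) (topspace (nsphere q) \<inter> {x. x 0 \<le> 0})"
    unfolding path_connectedin_def subtopology_restrict
    using contractible_imp_path_connected_space[OF contractible_space_upper_hemisphere[of 0 q]]
      contractible_imp_path_connected_space[OF contractible_space_lower_hemisphere[of 0 q]]
    by simp_all
  moreover have "(\<lambda>i. if i = 1 then 1 else 0) \<in> topspace (nsphere q)"
    using assms(1) by (auto simp: topspace_nsphere power2_eq_square if_distrib[where f = "\<lambda>x. x * _"] cong: if_cong)
  then have "(topspace (nsphere q) \<inter> {x. x 0 \<ge> 0}) \<inter> (topspace (nsphere q) \<inter> {x. x 0 \<le> 0}) \<noteq> {}"
    by force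
  ultimately have "path_connectedin (nsphere q)
      ((topspace (nsphere q) \<inter> {x. x 0 \<ge> 0}) \<union> (topspace (nsphere q) \<inter> {x. x 0 \<le> 0}))"
    by (rule path_connectedin_Un)
  moreover have "(topspace (nsphere q) \<inter> {x. x 0 \<ge> 0}) \<union> (topspace (nsphere q) \<inter> {x. x 0 \<le> 0}) = topspace (nsphere q)"
    by auto
  ultimately have "path_connected_space (nsphere q)" by (simp add: path_connectedin_topspace)
  then obtain r where "pathin (nsphere q) r" "r 0 = x" "r 1 = y"
    using assms(2,3) unfolding path_connected_space_def by blast
  then show ?thesis
    using that[of r] by (simp only: pathin_def continuous_map_nsphere_iff)
qed

section \<open>Normalisation, and homotopies of paths on the sphere relative to their ends\<close>

definition unitize :: "nat \<Rightarrow> (nat \<Rightarrow> real) \<Rightarrow> nat \<Rightarrow> real" where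
  "unitize q v = (\<lambda>i. if i \<le> q then v i / L2_set v {..q} else 0)"

lemma L2_set_nsphere: "x \<in> topspace (nsphere q) \<Longrightarrow> L2_set x {..q} = 1"
  by (simp add: topspace_nsphere L2_set_def)

lemma unitize_in_nsphere:
  assumes "L2_set v {..q} \<noteq> 0"
  shows "unitize q v \<in> topspace (nsphere q)"
proof -
  have "(\<Sum>i\<le>q. (v i)\<^sup>2) = (L2_set v {..q})\<^sup>2" by (simp add: L2_set_def sum_nonneg)
  then have "(\<Sum>i\<le>q. (v i / L2_set v {..q})\<^sup>2) = 1"
    using assms by (simp add: power_divide flip: sum_divide_distrib)
  then show ?thesis by (simp add: topspace_nsphere unitize_def)
qed

lemma unitize_nsphere: "x \<in> topspace (nsphere q) \<Longrightarrow> unitize q x = x"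
  using L2_set_nsphere[of x q] by (auto simp: unitize_def topspace_nsphere fun_eq_iff)

lemma continuous_on_unitize:
  assumes f: "continuous_on I f" and nz: "\<And>t. t \<in> I \<Longrightarrow> L2_set (f t) {..q} \<noteq> 0"
  shows "continuous_on I (\<lambda>t. unitize q (f t))"
proof (rule continuous_on_coordinatewise_then_product)
  fix i
  show "continuous_on I (\<lambda>t. unitize q (f t) i)"
  proof (cases "i \<le> q")
    case True
    have "continuous_on I (\<lambda>t. L2_set (f t) {..q})"
      unfolding L2_set_def by (intro continuous_intros continuous_on_apply[OF f])
    then have "continuous_on I (\<lambda>t. f t i / L2_set (f t) {..q})"
      using continuous_on_apply[OF f] nz by (intro continuous_on_divide) auto
    then show ?thesis using True by (simp add: unitize_def)
  qed (simp add: unitize_def)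
qed

definition rel_homotopic :: "nat \<Rightarrow> (real \<Rightarrow> nat \<Rightarrow> real) \<Rightarrow> (real \<Rightarrow> nat \<Rightarrow> real) \<Rightarrow> bool" where
  "rel_homotopic q r r' \<longleftrightarrow> homotopic_with (\<lambda>p. p 0 = r 0 \<and> p 1 = r 1) (top_of_set {0..1}) (nsphere q) r r'"

lemma rel_homotopic_iff:
  "rel_homotopic q r r' \<longleftrightarrow> (\<exists>H. continuous_on ({0..1::real} \<times> {0..1::real}) H \<and>
     H ` ({0..1} \<times> {0..1}) \<subseteq> topspace (nsphere q) \<and>
     (\<forall>t\<in>{0..1}. H (0, t) = r t) \<and> (\<forall>t\<in>{0..1}. H (1, t) = r' t) \<and>
     (\<forall>s\<in>{0..1}. H (s, 0) = r 0 \<and> H (s, 1) = r 1))"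
proof -
  have eq: "prod_topology (top_of_set {0..1::real}) (top_of_set {0..1::real}) = top_of_set ({0..1} \<times> {0..1})"
    using subtopology_Times[of euclidean euclidean "{0..1::real}" "{0..1::real}"] by simp
  have "rel_homotopic q r r' \<longleftrightarrow> (\<exists>H. continuous_map (top_of_set ({0..1::real} \<times> {0..1::real})) (nsphere q) H \<and>
     (\<forall>t\<in>{0..1}. H (0, t) = r t) \<and> (\<forall>t\<in>{0..1}. H (1, t) = r' t) \<and>
     (\<forall>s\<in>{0..1}. H (s, 0) = r 0 \<and> H (s, 1) = r 1))"
    unfolding rel_homotopic_def eq[symmetric] by (subst homotopic_with) auto
  then show ?thesis by (simp only: continuous_map_nsphere_iff conj_assoc)
qed

lemma rel_homotopic_sym:
  assumes "rel_homotopic q r r'" "r 0 = r' 0" "r 1 = r' 1"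
  shows "rel_homotopic q r' r"
  using assms(1) unfolding rel_homotopic_def assms(2,3)[symmetric] by (rule homotopic_with_symD)

lemma rel_homotopic_trans:
  assumes "rel_homotopic q r r'" "rel_homotopic q r' r''" "r 0 = r' 0" "r 1 = r' 1"
  shows "rel_homotopic q r r''"
  using assms(1,2) unfolding rel_homotopic_def assms(3,4)[symmetric] by (rule homotopic_with_trans)

text \<open>The segment from \<open>r t\<close> to \<open>w t\<close> misses the origin, as it
  starts at norm 1 and is shorter than 1; the straight-line homotopy can therefore be
  normalised.\<close>

lemma rel_homotopic_unitize:
  assumes r: "continuous_on {0..1} r" "r ` {0..1::real} \<subseteq> topspace (nsphere q)" and w: "continuous_on {0..1} w"
    and near: "\<And>t. t \<in> {0..1} \<Longrightarrow> edist q (r t) (w t) < 1" and ends: "w 0 = r 0" "w 1 = r 1"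
  shows "rel_homotopic q r (\<lambda>t. unitize q (w t))"
proof -
  define K where "K z = (\<lambda>i. (1 - fst z) * r (snd z) i + fst z * w (snd z) i)" for z :: "real \<times> real"
  let ?Q = "{0..1::real} \<times> {0..1::real}"
  have nz: "L2_set (K z) {..q} \<noteq> 0" if zQ: "z \<in> ?Q" for z
  proof
    assume 0: "L2_set (K z) {..q} = 0"
    obtain s t where z: "z = (s, t)" "s \<in> {0..1}" "t \<in> {0..1}" using zQ by blast
    have Ki: "(1 - s) * r t i + s * w t i = 0" if "i \<le> q" for i
      using 0 that by (simp add: L2_set_eq_0_iff K_def z)
    then have "r t i = s * (r t i - w t i)" if "i \<le> q" for i
      using Ki[OF that] by (simp add: algebra_simps)
    then have "L2_set (r t) {..q} = L2_set (\<lambda>i. s * (r t i - w t i)) {..q}"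
      by (intro L2_set_cong) auto
    also have "\<dots> = s * edist q (r t) (w t)"
      using z by (simp add: edist_def L2_set_right_distrib)
    also have "\<dots> \<le> edist q (r t) (w t)" using z by (simp add: mult_left_le_one_le)
    also have "\<dots> < 1" by (rule near[OF z(3)])
    finally have "L2_set (r t) {..q} < 1" .
    moreover have "r t \<in> topspace (nsphere q)" using r(2) z(3) by blast
    ultimately show False by (simp add: L2_set_nsphere)
  qed
  have "continuous_on ?Q (\<lambda>z. r (snd z) i)" "continuous_on ?Q (\<lambda>z. w (snd z) i)" for i
    by (rule continuous_on_compose2[OF continuous_on_apply[OF r(1)] continuous_on_snd[OF continuous_on_id]]
        continuous_on_compose2[OF continuous_on_apply[OF w] continuous_on_snd[OF continuous_on_id]]; force)+
  then have "continuous_on ?Q K"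
    unfolding K_def by (intro continuous_on_coordinatewise_then_product continuous_intros)
  then have "continuous_on ?Q (\<lambda>z. unitize q (K z))" using nz by (rule continuous_on_unitize)
  moreover have "unitize q (K z) \<in> topspace (nsphere q)" if "z \<in> ?Q" for z
    using nz[OF that] by (rule unitize_in_nsphere)
  moreover have "unitize q (K (0, t)) = r t" if "t \<in> {0..1}" for t
  proof -
    have "r t \<in> topspace (nsphere q)" using that r(2) by blast
    then show ?thesis by (simp add: K_def unitize_nsphere)
  qed
  moreover have "unitize q (K (1, t)) = unitize q (w t)" for t by (simp add: K_def)
  moreover have "unitize q (K (s, 0)) = r 0 \<and> unitize q (K (s, 1)) = r 1" for s
  proof -
    have "r 0 \<in> topspace (nsphere q)" "r 1 \<in> topspace (nsphere q)" using r(2) by (auto simp: image_subset_iff)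
    then show ?thesis by (simp add: K_def ends unitize_nsphere flip: distrib_right)
  qed
  ultimately show ?thesis unfolding rel_homotopic_iff by (intro exI[of _ "\<lambda>z. unitize q (K z)"]) auto
qed

lemma real_polynomial_function_ident: "real_polynomial_function (\<lambda>t::real. t)"
  by (rule real_polynomial_function.intros(1)) (rule bounded_linear_ident)

text \<open>Stone-Weierstrass with error \<open>e / 2\<close>, corrected by the affine function that
  interpolates the errors at 0 and 1 and is bounded by \<open>e / 2\<close> as well.\<close>

lemma polynomial_approximation_fixing_ends:
  fixes f :: "real \<Rightarrow> real"
  assumes f: "continuous_on {0..1} f" and e: "e > 0"
  shows "\<exists>g. real_polynomial_function g \<and> (\<forall>t\<in>{0..1}. \<bar>f t - g t\<bar> < e) \<and> g 0 = f 0 \<and> g 1 = f 1"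
proof -
  obtain g where g: "real_polynomial_function g" "\<And>t. t \<in> {0..1} \<Longrightarrow> \<bar>f t - g t\<bar> < e / 2"
    using Stone_Weierstrass_real_polynomial_function[OF compact_Icc f, of "e / 2"] e by auto
  define g' where "g' t = g t + ((1 - t) * (f 0 - g 0) + t * (f 1 - g 1))" for t
  have "real_polynomial_function g'"
    unfolding g'_def
    by (intro g(1) real_polynomial_function_ident real_polynomial_function.intros(2-4) real_polynomial_function_diff)
  moreover have "\<bar>f t - g' t\<bar> < e" if t: "t \<in> {0..1}" for t
  proof -
    have "\<bar>(1 - t) * (f 0 - g 0) + t * (f 1 - g 1)\<bar> \<le> (1 - t) * \<bar>f 0 - g 0\<bar> + t * \<bar>f 1 - g 1\<bar>"
      using t abs_triangle_ineq[of "(1 - t) * (f 0 - g 0)" "t * (f 1 - g 1)"] by (simp add: abs_mult)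
    also have "\<dots> \<le> (1 - t) * (e / 2) + t * (e / 2)"
      using t g(2)[of 0] g(2)[of 1] by (intro add_mono mult_left_mono) auto
    also have "\<dots> = e / 2" by (simp add: field_simps)
    finally show ?thesis
      using g(2)[OF t] abs_triangle_ineq4[of "f t - g t" "(1 - t) * (f 0 - g 0) + t * (f 1 - g 1)"]
      unfolding g'_def diff_diff_eq by linarith
  qed
  moreover have "g' 0 = f 0" "g' 1 = f 1" by (simp_all add: g'_def)
  ultimately show ?thesis by blast
qed

text \<open>Polynomial coordinates serve to find a direction that the curve misses. Three of them
  are enough for that and exist as \<open>q \<ge> 2\<close>; the others are kept.\<close>

lemma rel_homotopic_polynomial:
  assumes q: "q \<ge> 2" and r: "continuous_on {0..1} r" "r ` {0..1::real} \<subseteq> topspace (nsphere q)"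
  shows "\<exists>w. continuous_on {0..1} w \<and> (\<forall>t\<in>{0..1}. L2_set (w t) {..q} \<noteq> 0) \<and>
    (\<forall>i<3. real_polynomial_function (\<lambda>t. w t i)) \<and> w 0 = r 0 \<and> w 1 = r 1 \<and>
    rel_homotopic q r (\<lambda>t. unitize q (w t))"
proof -
  have "\<exists>g. real_polynomial_function g \<and> (\<forall>t\<in>{0..1}. \<bar>r t i - g t\<bar> < 1 / 2) \<and> g 0 = r 0 i \<and> g 1 = r 1 i" for i
    by (rule polynomial_approximation_fixing_ends[OF continuous_on_apply[OF r(1)]]) simp
  then obtain g where g: "\<And>i. real_polynomial_function (g i) \<and> (\<forall>t\<in>{0..1}. \<bar>r t i - g i t\<bar> < 1 / 2) \<and> g i 0 = r 0 i \<and> g i 1 = r 1 i"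
    by metis
  define w where "w t i = (if i < 3 then g i t else r t i)" for t i
  have w: "continuous_on {0..1} w"
  proof (rule continuous_on_coordinatewise_then_product)
    show "continuous_on {0..1} (\<lambda>t. w t i)" for i
      using g[of i] continuous_on_apply[OF r(1), of i] continuous_on_polymonial_function
      by (cases "i < 3") (auto simp: w_def real_polynomial_function_eq)
  qed
  have near: "edist q (r t) (w t) < 1" if t: "t \<in> {0..1}" for t
  proof -
    have "(\<Sum>i\<le>q. (r t i - w t i)\<^sup>2) = (\<Sum>i<3. (r t i - w t i)\<^sup>2)"
      using q by (intro sum.mono_neutral_right) (auto simp: w_def)
    \<comment> \<open>Three errors of at most 1/2 give a squared distance of at most 3/4.\<close>
    also have "\<dots> \<le> (\<Sum>i<(3::nat). (1 / 2)\<^sup>2)"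
    proof (rule sum_mono)
      fix i :: nat assume "i \<in> {..<3}"
      then have "\<bar>r t i - w t i\<bar> \<le> 1 / 2" using g[of i] t by (auto simp: w_def less_imp_le)
      then show "(r t i - w t i)\<^sup>2 \<le> (1 / 2)\<^sup>2" using abs_le_square_iff[of "r t i - w t i" "1/2"] by simp
    qed
    also have "\<dots> < 1" by (simp add: power2_eq_square)
    finally show ?thesis by (simp add: edist_def L2_set_def)
  qed
  have nz: "L2_set (w t) {..q} \<noteq> 0" if t: "t \<in> {0..1}" for t
  proof
    assume "L2_set (w t) {..q} = 0"
    then have "\<And>i. i \<le> q \<Longrightarrow> w t i = 0" by (simp add: L2_set_eq_0_iff)
    then have "edist q (r t) (w t) = L2_set (r t) {..q}"
      unfolding edist_def by (intro L2_set_cong) auto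
    moreover have "r t \<in> topspace (nsphere q)" using r(2) t by blast
    ultimately show False using near[OF t] by (simp add: L2_set_nsphere)
  qed
  have ends: "w 0 = r 0" "w 1 = r 1" using g by (auto simp: w_def)
  have "\<forall>i<3. real_polynomial_function (\<lambda>t. w t i)" using g by (simp add: w_def)
  then show ?thesis using w nz ends rel_homotopic_unitize[OF r w near ends] by blast
qed

lemma finite_roots_real_polynomial_function:
  fixes f :: "real \<Rightarrow> real"
  assumes "real_polynomial_function f" "f t0 \<noteq> 0"
  shows "finite {t. f t = 0}"
proof -
  obtain a n where f: "f = (\<lambda>t. \<Sum>i\<le>n. a i * t ^ i)"
    using assms(1) unfolding real_polynomial_function_iff_sum by blast
  have "\<exists>k\<le>n. a k \<noteq> 0"
  proof (rule ccontr)
    assume "\<not> (\<exists>k\<le>n. a k \<noteq> 0)"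
    then have "f t0 = 0" by (simp add: f)
    then show False using assms by simp
  qed
  then show ?thesis unfolding f using polyfun_finite_roots[of a n] by simp
qed

text \<open>The cone over a polynomial curve in space misses almost all rays of the form \<open>(1, c, d)\<close>.\<close>

lemma polynomial_curve_avoids:
  fixes f g h :: "real \<Rightarrow> real"
  assumes "real_polynomial_function f" "real_polynomial_function g" "real_polynomial_function h"
  shows "\<exists>C. finite C \<and> (\<forall>c. c \<notin> C \<longrightarrow> (\<exists>D. finite D \<and> (\<forall>d. d \<notin> D \<longrightarrow>
    (\<forall>t. f t \<noteq> 0 \<longrightarrow> g t = c * f t \<longrightarrow> h t \<noteq> d * f t))))"
proof (cases "\<forall>t. f t = 0")
  case False
  then obtain t0 where t0: "f t0 \<noteq> 0" by blast
  \<comment> \<open>The excluded slope is the only one for which \<open>g - c * f\<close> can vanish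
    identically. For any other \<open>c\<close> it has finitely many roots, and the ratios
    \<open>h / f\<close> at these roots are the excluded values of \<open>d\<close>.\<close>
  have "\<exists>D. finite D \<and> (\<forall>d. d \<notin> D \<longrightarrow> (\<forall>t. f t \<noteq> 0 \<longrightarrow> g t = c * f t \<longrightarrow> h t \<noteq> d * f t))"
    if c: "c \<notin> {g t0 / f t0}" for c
  proof (intro exI[of _ "(\<lambda>t. h t / f t) ` {t. g t - c * f t = 0}"] conjI allI impI)
    have "g t0 - c * f t0 \<noteq> 0" using c t0 by (auto simp: field_simps)
    moreover have "real_polynomial_function (\<lambda>t. g t - c * f t)"
      by (intro assms real_polynomial_function_diff real_polynomial_function.intros(2,4))
    ultimately show "finite ((\<lambda>t. h t / f t) ` {t. g t - c * f t = 0})"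
      using finite_roots_real_polynomial_function by blast
    show "h t \<noteq> d * f t" if "d \<notin> (\<lambda>t. h t / f t) ` {t. g t - c * f t = 0}" "f t \<noteq> 0" "g t = c * f t" for d t
      using that by (auto simp: image_iff)
  qed
  then show ?thesis by (intro exI[of _ "{g t0 / f t0}"]) auto
qed auto

text \<open>Stereographic projection from the pole \<open>v\<close> onto the hyperplane through the
  origin orthogonal to \<open>v\<close>.\<close>

definition stereographic :: "nat \<Rightarrow> (nat \<Rightarrow> real) \<Rightarrow> (nat \<Rightarrow> real) \<Rightarrow> nat \<Rightarrow> real" where
  "stereographic q v x = (\<lambda>i. (x i - (\<Sum>j\<le>q. x j * v j) * v i) / (1 - (\<Sum>j\<le>q. x j * v j)))"

definition inverse_stereographic :: "nat \<Rightarrow> (nat \<Rightarrow> real) \<Rightarrow> (nat \<Rightarrow> real) \<Rightarrow> nat \<Rightarrow> real" where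
  "inverse_stereographic q v y = (\<lambda>i. if i \<le> q
     then (2 * y i + ((\<Sum>j\<le>q. (y j)\<^sup>2) - 1) * v i) / ((\<Sum>j\<le>q. (y j)\<^sup>2) + 1) else 0)"

text \<open>From |x - v|^2 = 2 - 2 <x, v>; it makes the denominator of \<open>stereographic\<close>
  positive away from the pole.\<close>

lemma nsphere_inner_less_1:
  assumes "x \<in> topspace (nsphere q)" "v \<in> topspace (nsphere q)" "x \<noteq> v"
  shows "(\<Sum>j\<le>q. x j * v j) < 1"
proof -
  have x: "(\<Sum>j\<le>q. (x j)\<^sup>2) = 1" and v: "(\<Sum>j\<le>q. (v j)\<^sup>2) = 1"
    using assms by (auto simp: topspace_nsphere)
  have "(\<Sum>j\<le>q. (x j - v j)\<^sup>2) = 2 - 2 * (\<Sum>j\<le>q. x j * v j)"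
    by (simp add: power2_diff sum.distrib sum_subtractf x v mult.assoc flip: sum_distrib_left)
  moreover have "(\<Sum>j\<le>q. (x j - v j)\<^sup>2) \<noteq> 0"
    using edist_eq_0_iff[OF assms(1,2)] assms(3) by (auto simp: edist_def L2_set_def)
  moreover have "(\<Sum>j\<le>q. (x j - v j)\<^sup>2) \<ge> 0" by (simp add: sum_nonneg)
  ultimately show ?thesis by linarith
qed

lemma stereographic_orthogonal:
  assumes "v \<in> topspace (nsphere q)"
  shows "(\<Sum>j\<le>q. stereographic q v x j * v j) = 0"
proof -
  define c where "c = (\<Sum>j\<le>q. x j * v j)"
  have "(\<Sum>j\<le>q. (v j)\<^sup>2) = 1" using assms by (auto simp: topspace_nsphere)
  then have "(\<Sum>j\<le>q. (x j - c * v j) * v j) = 0"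
    by (simp add: left_diff_distrib sum_subtractf power2_eq_square mult.assoc c_def flip: sum_distrib_left)
  then show ?thesis
    by (simp add: stereographic_def flip: c_def sum_divide_distrib)
qed

text \<open>Orthogonality removes the mixed terms, and 4 n + (n - 1)^2 = (n + 1)^2 for n the squared
  norm of \<open>y\<close>.\<close>

lemma inverse_stereographic_nsphere:
  assumes "v \<in> topspace (nsphere q)" "(\<Sum>j\<le>q. y j * v j) = 0"
  shows "inverse_stereographic q v y \<in> topspace (nsphere q)"
proof -
  define n where "n = (\<Sum>j\<le>q. (y j)\<^sup>2)"
  have n: "n \<ge> 0" by (simp add: n_def sum_nonneg)
  have v: "(\<Sum>j\<le>q. (v j)\<^sup>2) = 1" using assms by (auto simp: topspace_nsphere)
  have "(\<Sum>i\<le>q. (2 * y i + (n - 1) * v i)\<^sup>2)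
      = (\<Sum>i\<le>q. 4 * (y i)\<^sup>2 + (n - 1)\<^sup>2 * (v i)\<^sup>2 + 4 * (n - 1) * (y i * v i))"
    by (intro sum.cong refl) (simp add: power2_eq_square algebra_simps)
  also have "\<dots> = 4 * n + (n - 1)\<^sup>2"
    by (simp add: sum.distrib v assms(2) n_def flip: sum_distrib_left)
  also have "\<dots> = (n + 1)\<^sup>2" by (simp add: power2_eq_square algebra_simps)
  finally have "(\<Sum>i\<le>q. ((2 * y i + (n - 1) * v i) / (n + 1))\<^sup>2) = 1"
    using n by (simp add: power_divide flip: sum_divide_distrib)
  then show ?thesis
    by (simp add: topspace_nsphere inverse_stereographic_def n_def)
qed

text \<open>A point at height c along \<open>v\<close> is projected to squared norm (1 + c) / (1 -
  c), with which the inverse formula simplifies to \<open>x\<close>.\<close>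

lemma inverse_stereographic_stereographic:
  assumes x: "x \<in> topspace (nsphere q)" and v: "v \<in> topspace (nsphere q)" and "x \<noteq> v"
  shows "inverse_stereographic q v (stereographic q v x) = x"
proof -
  define c where "c = (\<Sum>j\<le>q. x j * v j)"
  have c: "c < 1" using nsphere_inner_less_1[OF assms] by (simp add: c_def)
  have sx: "(\<Sum>j\<le>q. (x j)\<^sup>2) = 1" and sv: "(\<Sum>j\<le>q. (v j)\<^sup>2) = 1"
    using x v by (auto simp: topspace_nsphere)
  have "(\<Sum>j\<le>q. (x j - c * v j)\<^sup>2) = (\<Sum>j\<le>q. (x j)\<^sup>2 + c\<^sup>2 * (v j)\<^sup>2 - 2 * c * (x j * v j))"
    by (intro sum.cong refl) (simp add: power2_eq_square algebra_simps)
  also have "\<dots> = 1 - c\<^sup>2"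
    unfolding sum.distrib sum_subtractf sum_distrib_left[symmetric] sx sv c_def[symmetric]
    by (simp add: power2_eq_square)
  also have "\<dots> = (1 + c) * (1 - c)" by (simp add: power2_eq_square algebra_simps)
  finally have "(\<Sum>j\<le>q. ((x j - c * v j) / (1 - c))\<^sup>2) = (1 + c) * (1 - c) / (1 - c)\<^sup>2"
    by (simp add: power_divide flip: sum_divide_distrib)
  also have "\<dots> = (1 + c) / (1 - c)" using c by (simp add: power2_eq_square)
  finally have n: "(\<Sum>j\<le>q. (stereographic q v x j)\<^sup>2) = (1 + c) / (1 - c)"
    by (simp add: stereographic_def c_def)
  have "inverse_stereographic q v (stereographic q v x) i = x i" for i
  proof (cases "i \<le> q")
    case True
    have "(1 + c) / (1 - c) - 1 = 2 * c / (1 - c)" "(1 + c) / (1 - c) + 1 = 2 / (1 - c)"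
      using c by (simp_all add: field_simps)
    then have "inverse_stereographic q v (stereographic q v x) i
      = (2 * ((x i - c * v i) / (1 - c)) + 2 * c / (1 - c) * v i) / (2 / (1 - c))"
      unfolding inverse_stereographic_def n using True by (simp add: stereographic_def c_def)
    also have "2 * ((x i - c * v i) / (1 - c)) + 2 * c / (1 - c) * v i = 2 * x i / (1 - c)"
      by (simp add: diff_divide_distrib right_diff_distrib)
    also have "2 * x i / (1 - c) / (2 / (1 - c)) = x i" using c by simp
    finally show ?thesis .
  next
    case False
    then show ?thesis using x by (simp add: inverse_stereographic_def topspace_nsphere)
  qed
  then show ?thesis by blast
qed

lemma continuous_on_stereographic:
  assumes r: "continuous_on I r" "\<And>t. t \<in> I \<Longrightarrow> r t \<in> topspace (nsphere q)" and v: "v \<in> topspace (nsphere q)"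
    and avoid: "\<And>t. t \<in> I \<Longrightarrow> r t \<noteq> v"
  shows "continuous_on I (\<lambda>t. stereographic q v (r t) i)"
proof -
  have "1 - (\<Sum>j\<le>q. r t j * v j) \<noteq> 0" if "t \<in> I" for t
    using nsphere_inner_less_1[OF r(2)[OF that] v avoid[OF that]] by simp
  then show ?thesis
    unfolding stereographic_def by (intro continuous_intros continuous_on_apply[OF r(1)]) auto
qed

text \<open>Projection from the missed point \<open>v\<close> turns both paths into paths in a
  linear subspace, where the straight-line homotopy is constant at the common ends.\<close>

lemma rel_homotopic_avoiding_point:
  assumes r: "continuous_on {0..1} r" "r ` {0..1::real} \<subseteq> topspace (nsphere q)"
    and r': "continuous_on {0..1} r'" "r' ` {0..1::real} \<subseteq> topspace (nsphere q)"
    and ends: "r 0 = r' 0" "r 1 = r' 1" and v: "v \<in> topspace (nsphere q)"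
    and avoid: "\<And>t. t \<in> {0..1} \<Longrightarrow> r t \<noteq> v" "\<And>t. t \<in> {0..1} \<Longrightarrow> r' t \<noteq> v"
  shows "rel_homotopic q r r'"
proof -
  let ?Q = "{0..1::real} \<times> {0..1::real}"
  define Y where "Y z = (\<lambda>i. (1 - fst z) * stereographic q v (r (snd z)) i + fst z * stereographic q v (r' (snd z)) i)"
    for z :: "real \<times> real"
  have rS: "r t \<in> topspace (nsphere q)" "r' t \<in> topspace (nsphere q)" if "t \<in> {0..1}" for t
    using that r(2) r'(2) by blast+
  have Yc: "continuous_on ?Q (\<lambda>z. Y z i)" for i
  proof -
    have 1: "continuous_on ?Q (\<lambda>z. stereographic q v (r (snd z)) i)"
      by (rule continuous_on_compose2[OF continuous_on_stereographic[OF r(1) rS(1) v avoid(1)] continuous_on_snd[OF continuous_on_id]]) auto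
    have 2: "continuous_on ?Q (\<lambda>z. stereographic q v (r' (snd z)) i)"
      by (rule continuous_on_compose2[OF continuous_on_stereographic[OF r'(1) rS(2) v avoid(2)] continuous_on_snd[OF continuous_on_id]]) auto
    show ?thesis unfolding Y_def by (intro continuous_intros 1 2)
  qed
  have Yv: "(\<Sum>j\<le>q. Y z j * v j) = 0" for z
    using stereographic_orthogonal[OF v]
    by (simp add: Y_def distrib_right sum.distrib mult.assoc flip: sum_distrib_left)
  define H where "H z = inverse_stereographic q v (Y z)" for z
  have "continuous_on ?Q H"
  proof (rule continuous_on_coordinatewise_then_product)
    fix i
    have "(\<Sum>j\<le>q. (Y z j)\<^sup>2) + 1 \<noteq> 0" for z
      using sum_nonneg[of "{..q}" "\<lambda>j. (Y z j)\<^sup>2"] by auto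
    then have "continuous_on ?Q (\<lambda>z. (2 * Y z i + ((\<Sum>j\<le>q. (Y z j)\<^sup>2) - 1) * v i) / ((\<Sum>j\<le>q. (Y z j)\<^sup>2) + 1))"
      by (intro continuous_intros Yc) auto
    then show "continuous_on ?Q (\<lambda>z. H z i)"
      unfolding H_def inverse_stereographic_def by (cases "i \<le> q") simp_all
  qed
  moreover have "H z \<in> topspace (nsphere q)" for z
    unfolding H_def by (rule inverse_stereographic_nsphere[OF v Yv])
  moreover have "H (0, t) = r t" "H (1, t) = r' t" if "t \<in> {0..1}" for t
    using inverse_stereographic_stereographic[OF rS(1)[OF that] v avoid(1)[OF that]]
      inverse_stereographic_stereographic[OF rS(2)[OF that] v avoid(2)[OF that]]
    by (simp_all add: H_def Y_def)
  moreover have "H (s, 0) = r 0 \<and> H (s, 1) = r 1" for s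
  proof -
    have "Y (s, 0) = stereographic q v (r 0)" "Y (s, 1) = stereographic q v (r 1)"
      by (auto simp: Y_def ends fun_eq_iff algebra_simps)
    then show ?thesis
      using inverse_stereographic_stereographic[OF rS(1) v avoid(1), of 0]
        inverse_stereographic_stereographic[OF rS(1) v avoid(1), of 1] by (simp add: H_def)
  qed
  ultimately show ?thesis unfolding rel_homotopic_iff by (intro exI[of _ H]) auto
qed

text \<open>Both paths are deformed to normalised curves with polynomial first coordinates. Each
  curve excludes only finitely many slopes, so some direction is missed by both.\<close>

theorem nsphere_paths_rel_homotopic:
  assumes q: "q \<ge> 2" and r: "continuous_on {0..1} r" "r ` {0..1::real} \<subseteq> topspace (nsphere q)"
    and r': "continuous_on {0..1} r'" "r' ` {0..1::real} \<subseteq> topspace (nsphere q)"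
    and ends: "r 0 = r' 0" "r 1 = r' 1"
  shows "rel_homotopic q r r'"
proof -
  obtain w where w: "continuous_on {0..1} w" "\<And>t. t \<in> {0..1} \<Longrightarrow> L2_set (w t) {..q} \<noteq> 0"
    "\<And>i. i < 3 \<Longrightarrow> real_polynomial_function (\<lambda>t. w t i)" "w 0 = r 0" "w 1 = r 1"
    "rel_homotopic q r (\<lambda>t. unitize q (w t))"
    using rel_homotopic_polynomial[OF q r] by blast
  obtain w' where w': "continuous_on {0..1} w'" "\<And>t. t \<in> {0..1} \<Longrightarrow> L2_set (w' t) {..q} \<noteq> 0"
    "\<And>i. i < 3 \<Longrightarrow> real_polynomial_function (\<lambda>t. w' t i)" "w' 0 = r' 0" "w' 1 = r' 1"
    "rel_homotopic q r' (\<lambda>t. unitize q (w' t))"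
    using rel_homotopic_polynomial[OF q r'] by blast
  define avoids where "avoids u c d \<longleftrightarrow> (\<forall>t. u t 0 \<noteq> 0 \<longrightarrow> u t 1 = c * u t 0 \<longrightarrow> u t 2 \<noteq> d * u t 0)"
    for u :: "real \<Rightarrow> nat \<Rightarrow> real" and c d
  have "\<exists>C. finite C \<and> (\<forall>c. c \<notin> C \<longrightarrow> (\<exists>D. finite D \<and> (\<forall>d. d \<notin> D \<longrightarrow> avoids u c d)))"
    if "\<And>i. i < 3 \<Longrightarrow> real_polynomial_function (\<lambda>t. u t i)" for u
    unfolding avoids_def by (rule polynomial_curve_avoids) (auto intro: that)
  note av = this
  obtain C where C: "finite C" "\<And>c. c \<notin> C \<Longrightarrow> \<exists>D. finite D \<and> (\<forall>d. d \<notin> D \<longrightarrow> avoids w c d)"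
    using av[of w] w(3) by blast
  obtain C' where C': "finite C'" "\<And>c. c \<notin> C' \<Longrightarrow> \<exists>D. finite D \<and> (\<forall>d. d \<notin> D \<longrightarrow> avoids w' c d)"
    using av[of w'] w'(3) by blast
  obtain c :: real where c: "c \<notin> C \<union> C'"
    using ex_new_if_finite[OF infinite_UNIV_char_0, of "C \<union> C'"] C(1) C'(1) by blast
  obtain D D' where D: "finite D" "\<And>d. d \<notin> D \<Longrightarrow> avoids w c d" and D': "finite D'" "\<And>d. d \<notin> D' \<Longrightarrow> avoids w' c d"
    using C(2)[of c] C'(2)[of c] c by blast
  obtain d :: real where d: "d \<notin> D \<union> D'"
    using ex_new_if_finite[OF infinite_UNIV_char_0, of "D \<union> D'"] D(1) D'(1) by blast
  \<comment> \<open>On the line spanned by (1, c, d, 0, ...) the coordinates satisfy u1 = c u0 and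
    u2 = d u0, with u0 nonzero away from the origin; the choice of \<open>c\<close> and
    \<open>d\<close> rules this out for both curves.\<close>
  define v0 :: "nat \<Rightarrow> real" where "v0 = (\<lambda>i. if i = 0 then 1 else if i = 1 then c else if i = 2 then d else 0)"
  have nz0: "L2_set v0 {..q} \<noteq> 0"
    by (auto simp: L2_set_eq_0_iff v0_def intro!: bexI[of _ 0])
  define v where "v = unitize q v0"
  have v: "v \<in> topspace (nsphere q)" unfolding v_def by (rule unitize_in_nsphere[OF nz0])
  have avoid: "unitize q (u t) \<noteq> v" if u: "avoids u c d" and nz: "L2_set (u t) {..q} \<noteq> 0" for u t
  proof
    assume eq: "unitize q (u t) = v"
    define k where "k = L2_set (u t) {..q} / L2_set v0 {..q}"
    have k: "k \<noteq> 0" using nz nz0 by (simp add: k_def)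
    have "u t i = k * v0 i" if "i \<le> q" for i
    proof -
      have "u t i / L2_set (u t) {..q} = v0 i / L2_set v0 {..q}"
        using fun_cong[OF eq, of i] that by (simp add: v_def unitize_def)
      then show ?thesis using nz nz0 by (simp add: k_def field_simps)
    qed
    then have "u t 0 = k" "u t 1 = k * c" "u t 2 = k * d" using q by (auto simp: v0_def)
    then show False using u k unfolding avoids_def by (metis mult.commute)
  qed
  let ?u = "\<lambda>t. unitize q (w t)" and ?u' = "\<lambda>t. unitize q (w' t)"
  have r01: "r 0 \<in> topspace (nsphere q)" "r 1 \<in> topspace (nsphere q)" using r(2) by auto
  have e: "?u 0 = r 0" "?u 1 = r 1" "?u' 0 = r' 0" "?u' 1 = r' 1"
    using w(4,5) w'(4,5) ends r01 unitize_nsphere by auto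
  have "rel_homotopic q ?u ?u'"
  proof (rule rel_homotopic_avoiding_point[OF _ _ _ _ _ _ v])
    show "continuous_on {0..1} ?u" "continuous_on {0..1} ?u'"
      using continuous_on_unitize w(1,2) w'(1,2) by blast+
    show "?u ` {0..1} \<subseteq> topspace (nsphere q)" "?u' ` {0..1} \<subseteq> topspace (nsphere q)"
      using unitize_in_nsphere w(2) w'(2) by blast+
    show "?u t \<noteq> v" "?u' t \<noteq> v" if "t \<in> {0..1}" for t
      using avoid D(2) D'(2) d w(2)[OF that] w'(2)[OF that] by blast+
  qed (use e ends in auto)
  from rel_homotopic_trans[OF w(6) this] have "rel_homotopic q r ?u'" using e by simp
  from rel_homotopic_trans[OF this rel_homotopic_sym[OF w'(6)]] show ?thesis using e ends by simp
qed

section \<open>Fundamental groups of spherical space forms\<close>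

lemma openin_quotient_top:
  "openin (quotient_top M) V \<longleftrightarrow> V \<subseteq> points M \<and>
     openin (nsphere (fst M)) {x \<in> topspace (nsphere (fst M)). proj M x \<in> V}"
proof -
  let ?S = "topspace (nsphere (fst M))"
  have "istopology (\<lambda>V. V \<subseteq> points M \<and> openin (nsphere (fst M)) {x \<in> ?S. proj M x \<in> V})"
    unfolding istopology_def
  proof (intro conjI allI impI)
    fix V W assume "V \<subseteq> points M \<and> openin (nsphere (fst M)) {x \<in> ?S. proj M x \<in> V}"
      "W \<subseteq> points M \<and> openin (nsphere (fst M)) {x \<in> ?S. proj M x \<in> W}"
    moreover have "{x \<in> ?S. proj M x \<in> V \<inter> W} = {x \<in> ?S. proj M x \<in> V} \<inter> {x \<in> ?S. proj M x \<in> W}" by auto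
    ultimately show "V \<inter> W \<subseteq> points M" "openin (nsphere (fst M)) {x \<in> ?S. proj M x \<in> V \<inter> W}"
      by (auto intro: openin_Int)
  next
    fix K assume K: "\<forall>V\<in>K. V \<subseteq> points M \<and> openin (nsphere (fst M)) {x \<in> ?S. proj M x \<in> V}"
    have "{x \<in> ?S. proj M x \<in> \<Union>K} = (\<Union>V\<in>K. {x \<in> ?S. proj M x \<in> V})" by auto
    then show "openin (nsphere (fst M)) {x \<in> ?S. proj M x \<in> \<Union>K}" using K by auto
    show "\<Union>K \<subseteq> points M" using K by auto
  qed
  then show ?thesis by (simp add: quotient_top_def)
qed

lemma topspace_quotient_top [simp]: "topspace (quotient_top M) = points M"
proof
  show "topspace (quotient_top M) \<subseteq> points M"
    using openin_topspace[of "quotient_top M"] openin_quotient_top by blast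
  have "{x \<in> topspace (nsphere (fst M)). proj M x \<in> points M} = topspace (nsphere (fst M))"
    by (auto simp: points_def)
  then have "openin (quotient_top M) (points M)" by (simp add: openin_quotient_top)
  then show "points M \<subseteq> topspace (quotient_top M)" by (rule openin_subset)
qed

lemma continuous_map_proj: "continuous_map (nsphere (fst M)) (quotient_top M) (proj M)"
  unfolding continuous_map_def by (auto simp: openin_quotient_top points_def)

context space_form_group
begin

abbreviation "S \<equiv> topspace (nsphere q)"

abbreviation "X \<equiv> quotient_top (q, G)"

text \<open>The union of all orbits meeting \<open>W\<close> is the union of the preimages of
  \<open>W\<close> under the continuous maps given by \<open>G\<close>.\<close>

lemma openin_proj_image:
  assumes W: "openin (nsphere q) W"
  shows "openin X (proj (q, G) ` W)"
  unfolding openin_quotient_top fst_conv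
proof
  have WS: "W \<subseteq> S" using W by (rule openin_subset)
  then show "proj (q, G) ` W \<subseteq> points (q, G)" by (auto simp: points_eq)
  have "openin (nsphere q) {x \<in> S. mat_act A x \<in> W}" if A: "A \<in> G" for A
  proof -
    have "continuous_map (nsphere q) (nsphere q) (mat_act A)"
      by (subst nsphere_eq_top_of_set)
        (use act_sphere[OF A] in \<open>auto simp: continuous_map_nsphere_iff intro!: continuous_on_mat_act continuous_on_id\<close>)
    then show ?thesis using W by (rule openin_continuous_map_preimage)
  qed
  moreover have "{x \<in> S. proj (q, G) x \<in> proj (q, G) ` W} = (\<Union>A\<in>G. {x \<in> S. mat_act A x \<in> W})"
  proof (intro equalityI subsetI)
    fix x assume "x \<in> {x \<in> S. proj (q, G) x \<in> proj (q, G) ` W}"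
    then obtain y where "x \<in> S" "y \<in> W" "proj (q, G) x = proj (q, G) y" by auto
    then show "x \<in> (\<Union>A\<in>G. {x \<in> S. mat_act A x \<in> W})" using proj_eq_iff[of x y] WS by auto
  next
    fix x assume "x \<in> (\<Union>A\<in>G. {x \<in> S. mat_act A x \<in> W})"
    then obtain A where A: "A \<in> G" "x \<in> S" "mat_act A x \<in> W" by auto
    then show "x \<in> {x \<in> S. proj (q, G) x \<in> proj (q, G) ` W}"
      using proj_act[OF A(1), of x] by (metis (mono_tags, lifting) image_eqI mem_Collect_eq)
  qed
  ultimately show "openin (nsphere q) {x \<in> S. proj (q, G) x \<in> proj (q, G) ` W}" by auto
qed

section \<open>Lifting maps through the orbit projection\<close>

definition sep :: real where
  "sep = (SOME \<delta>. \<delta> > 0 \<and> (\<forall>x y. x \<in> S \<longrightarrow> y \<in> proj (q, G) x \<longrightarrow> edist q x y < 4 * \<delta> \<longrightarrow> x = y))"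

lemma sep_pos: "sep > 0" and sep: "x \<in> S \<Longrightarrow> y \<in> proj (q, G) x \<Longrightarrow> edist q x y < 4 * sep \<Longrightarrow> x = y"
proof -
  have "\<exists>\<delta>. \<delta> > 0 \<and> (\<forall>x y. x \<in> S \<longrightarrow> y \<in> proj (q, G) x \<longrightarrow> edist q x y < 4 * \<delta> \<longrightarrow> x = y)"
    using separation by metis
  from someI_ex[OF this] show "sep > 0" "x \<in> S \<Longrightarrow> y \<in> proj (q, G) x \<Longrightarrow> edist q x y < 4 * sep \<Longrightarrow> x = y"
    unfolding sep_def by blast+
qed

text \<open>Both points are within 2 \<open>sep\<close> of each other, so \<open>x\<close> singles
  out at most one nearby member of each orbit.\<close>

lemma sep_points:
  assumes "P \<in> points (q, G)" "y \<in> P" "z \<in> P" "edist q x y < sep" "edist q x z < sep"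
  shows "y = z"
proof (rule sep)
  show "y \<in> S" "z \<in> proj (q, G) y" using mem_points[OF assms(1,2)] assms(3) by auto
  show "edist q y z < 4 * sep"
    using edist_triangle[of q y z x] edist_commute[of q x y] assms(4,5) sep_pos by simp
qed

lemma in_points_image: "continuous_map Z X p \<Longrightarrow> z \<in> topspace Z \<Longrightarrow> p z \<in> points (q, G)"
  using continuous_map_image_subset_topspace by fastforce

text \<open>The member of \<open>p z\<close> near \<open>a z\<close> is unique, and this choice is
  continuous. With a constant \<open>a\<close> the lemma lifts paths locally; with \<open>a\<close>
  the lift of a neighbouring path it carries lifts along a homotopy.\<close>

lemma continuous_near_lift:
  assumes p: "continuous_map Z X p" and a: "continuous_map Z (nsphere q) a"
    and near: "\<And>z. z \<in> topspace Z \<Longrightarrow> \<exists>y\<in>p z. edist q (a z) y < sep"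
  obtains b where "continuous_map Z (nsphere q) b"
    "\<And>z. z \<in> topspace Z \<Longrightarrow> b z \<in> p z" "\<And>z. z \<in> topspace Z \<Longrightarrow> edist q (a z) (b z) < sep"
proof -
  obtain b where b: "\<And>z. z \<in> topspace Z \<Longrightarrow> b z \<in> p z \<and> edist q (a z) (b z) < sep"
    using near by metis
  have bS: "b z \<in> S" if "z \<in> topspace Z" for z
    using mem_points(1)[OF in_points_image[OF p that]] b[OF that] by blast
  have "continuous_map Z (nsphere q) b"
    unfolding continuous_map_def
  proof (intro conjI allI impI)
    fix W assume W: "openin (nsphere q) W"
    show "openin Z {z \<in> topspace Z. b z \<in> W}"
    proof (subst openin_subopen, intro ballI)
      fix z0 assume "z0 \<in> {z \<in> topspace Z. b z \<in> W}"
      then have z0: "z0 \<in> topspace Z" "b z0 \<in> W" by auto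
      define d0 where "d0 = edist q (a z0) (b z0)"
      \<comment> \<open>The slack is split in two: if \<open>a z\<close> is within
        \<open>d0 + e\<close> of \<open>b z0\<close> and \<open>y\<close> within \<open>e\<close> of
        it, then \<open>y\<close> is within \<open>sep\<close> of \<open>a z\<close>.\<close>
      define e where "e = (sep - d0) / 2"
      have e: "e > 0" using b[OF z0(1)] by (simp add: e_def d0_def)
      define W' where "W' = W \<inter> {y \<in> S. edist q (b z0) y < e}"
      have W': "openin (nsphere q) W'" unfolding W'_def by (intro openin_Int W openin_nsphere_edist_ball)
      let ?T = "{z \<in> topspace Z. p z \<in> proj (q, G) ` W'} \<inter> {z \<in> topspace Z. a z \<in> {y \<in> S. edist q (b z0) y < d0 + e}}"
      have "openin Z ?T"
        by (intro openin_Int openin_continuous_map_preimage[OF p] openin_continuous_map_preimage[OF a]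
            openin_proj_image W' openin_nsphere_edist_ball)
      moreover have "z0 \<in> ?T"
      proof -
        have "p z0 = proj (q, G) (b z0)"
          using mem_points(2)[OF in_points_image[OF p z0(1)]] b[OF z0(1)] by blast
        moreover have "b z0 \<in> W'" using z0 bS e by (simp add: W'_def)
        moreover have "a z0 \<in> S" using a z0 continuous_map_image_subset_topspace by fastforce
        ultimately show ?thesis using z0 e by (auto simp: d0_def edist_commute)
      qed
      moreover have "?T \<subseteq> {z \<in> topspace Z. b z \<in> W}"
      proof
        fix z assume "z \<in> ?T"
        then obtain y where z: "z \<in> topspace Z" "p z = proj (q, G) y" "y \<in> W'" "edist q (b z0) (a z) < d0 + e" by auto
        have y: "y \<in> S" "y \<in> W" "edist q (b z0) y < e" using z(3) by (auto simp: W'_def)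
        have "edist q (a z) y < sep"
          using edist_triangle[of q "a z" y "b z0"] edist_commute[of q "a z" "b z0"] y z(4)
          by (simp add: e_def field_simps)
        moreover have "y \<in> p z" using z(2) in_proj[OF y(1)] by simp
        ultimately have "b z = y"
          using sep_points[OF in_points_image[OF p z(1)], of "b z" y "a z"] b[OF z(1)] by blast
        then show "z \<in> {z \<in> topspace Z. b z \<in> W}" using z(1) y(2) by simp
      qed
      ultimately show "\<exists>T. openin Z T \<and> z0 \<in> T \<and> T \<subseteq> {z \<in> topspace Z. b z \<in> W}" by blast
    qed
  qed (use bS in auto)
  then show ?thesis using that b by blast
qed

definition lift_on :: "real set \<Rightarrow> (real \<Rightarrow> (nat \<Rightarrow> real) set) \<Rightarrow> (real \<Rightarrow> nat \<Rightarrow> real) \<Rightarrow> bool" where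
  "lift_on I p r \<longleftrightarrow> continuous_on I r \<and> (\<forall>t\<in>I. r t \<in> p t)"

lemma lift_on_act:
  assumes "lift_on I p r" "A \<in> G" "\<And>t. t \<in> I \<Longrightarrow> p t \<in> points (q, G)"
  shows "lift_on I p (\<lambda>t. mat_act A (r t))"
  unfolding lift_on_def
proof (intro conjI ballI)
  show "continuous_on I (\<lambda>t. mat_act A (r t))"
    using assms(1) by (intro continuous_on_mat_act) (simp add: lift_on_def)
  fix t assume t: "t \<in> I"
  have "p t = proj (q, G) (r t)"
    using mem_points(2)[OF assms(3)[OF t]] assms(1) t by (simp add: lift_on_def)
  then show "mat_act A (r t) \<in> p t" using assms(2) by (auto simp: proj_apply)
qed

lemma lift_on_sphere:
  assumes "lift_on I p r" "\<And>t. t \<in> I \<Longrightarrow> p t \<in> points (q, G)" "t \<in> I"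
  shows "r t \<in> S" "p t = proj (q, G) (r t)"
  using mem_points[OF assms(2)[OF assms(3)], of "r t"] assms(1,3) by (auto simp: lift_on_def)

text \<open>Bisection: liftability from every starting point passes to concatenated intervals, and
  holds on short ones, where a lift near a fixed \<open>y\<close> is moved to the prescribed start
  by a group element.\<close>

lemma path_lift:
  assumes p: "continuous_map (top_of_set {0..1}) X p" and x: "x \<in> p 0"
  obtains r where "lift_on {0..1} p r" "r 0 = x"
proof -
  have pP: "p t \<in> points (q, G)" if "t \<in> {0..1}" for t
    using in_points_image[OF p] that by simp
  \<comment> \<open>The guard makes the property vacuous for intervals that stick out of [0, 1],
    which \<open>Bolzano\<close> also asks about.\<close>
  define P where "P a b \<longleftrightarrow> (0 \<le> a \<and> b \<le> 1 \<longrightarrow> (\<forall>x\<in>p a. \<exists>r. lift_on {a..b} p r \<and> r a = x))" for a b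
  have "P 0 1"
  proof (rule Bolzano)
    fix a b c :: real assume ab: "P a b" and bc: "P b c" and le: "a \<le> b" "b \<le> c"
    show "P a c"
      unfolding P_def
    proof (intro impI ballI)
      fix x assume ac: "0 \<le> a \<and> c \<le> 1" and x: "x \<in> p a"
      obtain r where r: "lift_on {a..b} p r" "r a = x" using ab ac x le unfolding P_def by fastforce
      then have "r b \<in> p b" using le by (auto simp: lift_on_def)
      then obtain r' where r': "lift_on {b..c} p r'" "r' b = r b" using bc ac le unfolding P_def by fastforce
      have eqs: "{t \<in> {a..c}. t \<le> b} = {a..b}" "{t \<in> {a..c}. b \<le> t} = {b..c}" using le by auto
      have "continuous_on {a..c} (\<lambda>t. if t \<le> b then r t else r' t)"
      proof (rule continuous_on_cases_le)
        show "continuous_on {t \<in> {a..c}. t \<le> b} r" unfolding eqs using r by (simp add: lift_on_def)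
        show "continuous_on {t \<in> {a..c}. b \<le> t} r'" unfolding eqs using r' by (simp add: lift_on_def)
        show "continuous_on {a..c} (\<lambda>t. t)" by (rule continuous_on_id)
        show "r t = r' t" if "t = b" for t using that r'(2) by simp
      qed
      then have "lift_on {a..c} p (\<lambda>t. if t \<le> b then r t else r' t)"
        using r r' by (auto simp: lift_on_def)
      then show "\<exists>r. lift_on {a..c} p r \<and> r a = x" using r(2) le by (intro exI[of _ "\<lambda>t. if t \<le> b then r t else r' t"]) auto
    qed
  next
    fix x :: real assume x: "0 \<le> x" "x \<le> 1"
    obtain y where y: "y \<in> S" "p x = proj (q, G) y" using pP[of x] x by (auto simp: points_eq)
    let ?W = "{z \<in> S. edist q y z < sep}"
    have "openin (top_of_set {0..1}) {t \<in> topspace (top_of_set {0..1}). p t \<in> proj (q, G) ` ?W}"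
      by (intro openin_continuous_map_preimage[OF p] openin_proj_image openin_nsphere_edist_ball)
    then obtain T where T: "open T" "{t \<in> topspace (top_of_set {0..1}). p t \<in> proj (q, G) ` ?W} = {0..1} \<inter> T"
      by (auto simp: openin_open)
    have "x \<in> {t \<in> topspace (top_of_set {0..1}). p t \<in> proj (q, G) ` ?W}"
      using x y sep_pos by auto
    then have "x \<in> T" using T(2) by auto
    then obtain d where d: "d > 0" "\<forall>t. dist t x < d \<longrightarrow> t \<in> T" using T(1) unfolding open_dist by blast
    have dW: "p t \<in> proj (q, G) ` ?W" if "t \<in> {0..1}" "dist t x < d" for t
    proof -
      have "t \<in> {0..1} \<inter> T" using that d(2) by blast
      then show ?thesis unfolding T(2)[symmetric] by blast
    qed
    have "P a b" if ab: "a \<le> x" "x \<le> b" "b - a < d" for a b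
      unfolding P_def
    proof (intro impI ballI)
      fix x' assume ab01: "0 \<le> a \<and> b \<le> 1" and x': "x' \<in> p a"
      have pab: "continuous_map (top_of_set {a..b}) X p"
        by (rule continuous_map_from_subtopology_mono[OF p]) (use ab01 in auto)
      obtain r0 where r0: "continuous_map (top_of_set {a..b}) (nsphere q) r0" "\<And>t. t \<in> {a..b} \<Longrightarrow> r0 t \<in> p t"
      proof (rule continuous_near_lift[OF pab, of "\<lambda>_. y"])
        show "continuous_map (top_of_set {a..b}) (nsphere q) (\<lambda>_. y)" using y by simp
        fix t assume "t \<in> topspace (top_of_set {a..b})"
        then have "p t \<in> proj (q, G) ` ?W" using dW[of t] ab ab01 by (auto simp: dist_real_def)
        then show "\<exists>z\<in>p t. edist q y z < sep" using in_proj by auto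
      qed auto
      have l0: "lift_on {a..b} p r0"
        using r0 by (auto simp: lift_on_def continuous_map_nsphere_iff)
      have a_in: "a \<in> {a..b}" using ab by auto
      have "p t \<in> points (q, G)" if "t \<in> {a..b}" for t using pP[of t] that ab01 by auto
      note pts = this
      have "x' \<in> proj (q, G) (r0 a)" using x' lift_on_sphere(2)[OF l0 pts a_in] by simp
      then obtain A where A: "A \<in> G" "x' = mat_act A (r0 a)" by (auto simp: proj_apply)
      show "\<exists>r. lift_on {a..b} p r \<and> r a = x'"
        using lift_on_act[OF l0 A(1) pts] A(2) by blast
    qed
    then show "\<exists>d>0. \<forall>a b. a \<le> x \<and> x \<le> b \<and> b - a < d \<longrightarrow> P a b" using d(1) by blast
  qed simp
  then show ?thesis using that x unfolding P_def by auto
qed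

text \<open>The distance of two lifts is 0 or at least 4 \<open>sep\<close>; passing from one to the
  other would take the value 2 \<open>sep\<close> in between.\<close>

lemma lift_unique:
  assumes p: "\<And>t. t \<in> {0..1} \<Longrightarrow> p t \<in> points (q, G)"
    and r: "lift_on {0..1} p r" and r': "lift_on {0..1} p r'" and "r 0 = r' 0" and t: "t \<in> {0..1}"
  shows "r t = r' t"
proof -
  have dich: "edist q (r s) (r' s) = 0 \<or> 4 * sep \<le> edist q (r s) (r' s)" if "s \<in> {0..1}" for s
    using sep[OF lift_on_sphere(1)[OF r p that], of "r' s"] lift_on_sphere(2)[OF r p that] r' that
    by (force simp: lift_on_def)
  have "\<not> 4 * sep \<le> edist q (r t) (r' t)"
  proof
    assume *: "4 * sep \<le> edist q (r t) (r' t)"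
    have "continuous_on {0..1} (\<lambda>s. edist q (r s) (r' s))"
      using r r' by (intro continuous_on_edist) (auto simp: lift_on_def)
    then have "continuous_on {0..t} (\<lambda>s. edist q (r s) (r' s))"
      by (rule continuous_on_subset) (use t in auto)
    then obtain s where s: "0 \<le> s" "s \<le> t" "edist q (r s) (r' s) = 2 * sep"
      using IVT'[of "\<lambda>s. edist q (r s) (r' s)" 0 "2 * sep" t] * assms(4) sep_pos t by auto
    then show False using dich[of s] t sep_pos by auto
  qed
  then have "edist q (r t) (r' t) = 0" using dich[OF t] by blast
  then show ?thesis
    using edist_eq_0_iff lift_on_sphere(1)[OF r p t] lift_on_sphere(1)[OF r' p t] by blast
qed

end

lemma homotopic_loops_at_iff:
  "homotopic_loops_at X x p p' \<longleftrightarrow> (\<exists>h. continuous_map (top_of_set ({0..1::real} \<times> {0..1::real})) X h \<and>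
     (\<forall>t\<in>{0..1}. h (0, t) = p t) \<and> (\<forall>t\<in>{0..1}. h (1, t) = p' t) \<and>
     (\<forall>s\<in>{0..1}. h (s, 0) = x \<and> h (s, 1) = x))"
proof -
  have "prod_topology (top_of_set {0..1::real}) (top_of_set {0..1::real}) = top_of_set ({0..1} \<times> {0..1})"
    using subtopology_Times[of euclidean euclidean "{0..1::real}" "{0..1::real}"] by simp
  then show ?thesis
    unfolding homotopic_loops_at_def by (subst homotopic_with) auto
qed

context space_form_group
begin

text \<open>The monodromy of a loop: \<open>A\<close> is the deck transformation that carries the
  start of the lift to its end.\<close>

definition lift_end :: "(nat \<Rightarrow> real) \<Rightarrow> (real \<Rightarrow> (nat \<Rightarrow> real) set) \<Rightarrow> real mat \<Rightarrow> bool" where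
  "lift_end x p A \<longleftrightarrow> (\<exists>r. lift_on {0..1} p r \<and> r 0 = x \<and> r 1 = mat_act A x)"

lemma pathin_points: "pathin X p \<Longrightarrow> t \<in> {0..1} \<Longrightarrow> p t \<in> points (q, G)"
  unfolding pathin_def using in_points_image[of "top_of_set {0..1}" p t] by simp

lemma lift_end_exists:
  assumes x: "x \<in> S" and p: "p \<in> loops X (proj (q, G) x)"
  obtains A where "A \<in> G" "lift_end x p A"
proof -
  have pc: "continuous_map (top_of_set {0..1}) X p" and p01: "p 0 = proj (q, G) x" "p 1 = proj (q, G) x"
    using p by (auto simp: loops_def pathin_def)
  obtain r where r: "lift_on {0..1} p r" "r 0 = x"
    using path_lift[OF pc, of x] in_proj[OF x] p01 by auto
  then have "r 1 \<in> proj (q, G) x" using p01 by (auto simp: lift_on_def)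
  then obtain A where "A \<in> G" "r 1 = mat_act A x" by (auto simp: proj_apply)
  then show ?thesis using that r by (auto simp: lift_end_def)
qed

lemma lift_end_unique:
  assumes x: "x \<in> S" and p: "pathin X p" and "A \<in> G" "B \<in> G" "lift_end x p A" "lift_end x p B"
  shows "A = B"
proof -
  obtain r r' where r: "lift_on {0..1} p r" "r 0 = x" "r 1 = mat_act A x"
    and r': "lift_on {0..1} p r'" "r' 0 = x" "r' 1 = mat_act B x"
    using assms by (auto simp: lift_end_def)
  have "r 1 = r' 1"
    by (rule lift_unique[OF pathin_points[OF p] r(1) r'(1)]) (use r r' in auto)
  then show ?thesis using r r' act_eq_iff assms by simp
qed

text \<open>For \<open>s\<close> near \<open>s0\<close> the lift of the slice at \<open>s\<close>
  can be chosen close to that at \<open>s0\<close>. Its ends lie in the fixed orbit of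
  \<open>x\<close>, which is discrete, so they do not move.\<close>

lemma lift_end_near:
  fixes h :: "real \<times> real \<Rightarrow> (nat \<Rightarrow> real) set"
  assumes h: "continuous_map (top_of_set ({0..1} \<times> {0..1})) X h"
    and x: "x \<in> S" and ends: "\<And>s. s \<in> {0..1} \<Longrightarrow> h (s, 0) = proj (q, G) x \<and> h (s, 1) = proj (q, G) x"
    and s0: "s0 \<in> {0..1}"
  shows "\<exists>d>0. \<forall>s\<in>{0..1}. \<bar>s - s0\<bar> < d \<longrightarrow> (\<forall>A\<in>G. lift_end x (\<lambda>t. h (s0, t)) A \<longrightarrow> lift_end x (\<lambda>t. h (s, t)) A)"
proof -
  let ?I = "{0..1::real}"
  have slice: "continuous_map (top_of_set ?I) X (\<lambda>t. h (s, t))" if "s \<in> ?I" for s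
  proof -
    have "continuous_map (top_of_set ?I) (top_of_set (?I \<times> ?I)) (\<lambda>t. (s, t))"
      using that by (auto intro!: continuous_intros)
    from continuous_map_compose[OF this h] show ?thesis by (simp add: o_def)
  qed
  have xP: "x \<in> proj (q, G) x" by (rule in_proj[OF x])
  obtain r where r: "lift_on ?I (\<lambda>t. h (s0, t)) r" "r 0 = x"
    using path_lift[OF slice[OF s0], of x] ends[OF s0] xP by metis
  have rpts: "h (s0, t) \<in> points (q, G)" if "t \<in> ?I" for t
    using in_points_image[OF slice[OF s0]] that by simp
  have rS: "r t \<in> S" if "t \<in> ?I" for t using lift_on_sphere(1)[OF r(1) rpts that] .
  have rc: "continuous_map (top_of_set ?I) (nsphere q) r"
    using r(1) rS by (auto simp: continuous_map_nsphere_iff lift_on_def)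
  have rc2: "continuous_map (top_of_set (?I \<times> ?I)) (nsphere q) (\<lambda>z. r (snd z))"
  proof -
    have "continuous_map (top_of_set (?I \<times> ?I)) (top_of_set ?I) snd"
      by (auto intro!: continuous_intros)
    from continuous_map_compose[OF this rc] show ?thesis by (simp add: o_def)
  qed
  \<comment> \<open>The parameters at which the orbit has a member near the reference lift
    \<open>r\<close>. This set is open and contains the slice at \<open>s0\<close>, so the tube
    lemma gives a width uniform in \<open>t\<close>.\<close>
  define N where "N = {z \<in> ?I \<times> ?I. \<exists>y\<in>h z. edist q (r (snd z)) y < sep}"
  have "openin (top_of_set (?I \<times> ?I)) N"
  proof (subst openin_subopen, intro ballI)
    fix z1 assume "z1 \<in> N"
    then obtain y1 where z1: "z1 \<in> ?I \<times> ?I" "y1 \<in> h z1" "edist q (r (snd z1)) y1 < sep" by (auto simp: N_def)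
    have hz1: "h z1 \<in> points (q, G)" using in_points_image[OF h] z1(1) by simp
    have y1S: "y1 \<in> S" "h z1 = proj (q, G) y1" using mem_points[OF hz1 z1(2)] by auto
    \<comment> \<open>The slack is shared evenly between the movement of the orbit and that of
      \<open>r\<close>.\<close>
    define e where "e = (sep - edist q (r (snd z1)) y1) / 2"
    have e: "e > 0" using z1 by (simp add: e_def)
    let ?top = "top_of_set (?I \<times> ?I)"
    let ?T = "{z \<in> topspace ?top. h z \<in> proj (q, G) ` {y \<in> S. edist q y1 y < e}} \<inter>
      {z \<in> topspace ?top. r (snd z) \<in> {y \<in> S. edist q y1 y < edist q (r (snd z1)) y1 + e}}"
    have "openin ?top ?T"
      by (intro openin_Int openin_continuous_map_preimage[OF h] openin_continuous_map_preimage[OF rc2]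
            openin_proj_image openin_nsphere_edist_ball)
    moreover have "z1 \<in> ?T"
      using z1 y1S e rS by (auto simp: edist_commute)
    moreover have "?T \<subseteq> N"
    proof
      fix z assume "z \<in> ?T"
      then obtain y where z: "z \<in> ?I \<times> ?I" "h z = proj (q, G) y" "y \<in> S" "edist q y1 y < e"
        "edist q y1 (r (snd z)) < edist q (r (snd z1)) y1 + e" by auto
      have "edist q (r (snd z)) y < sep"
        using edist_triangle[of q "r (snd z)" y y1] edist_commute[of q "r (snd z)" y1] z(4,5)
        by (simp add: e_def field_simps)
      then show "z \<in> N" using z in_proj[OF z(3)] by (auto simp: N_def)
    qed
    ultimately show "\<exists>T. openin ?top T \<and> z1 \<in> T \<and> T \<subseteq> N" by blast
  qed
  then obtain W where W: "open W" "N = (?I \<times> ?I) \<inter> W" by (auto simp: openin_open)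
  have "{s0} \<times> ?I \<subseteq> N"
    using r(1) s0 sep_pos by (force simp: N_def lift_on_def)
  then have "{s0} \<times> ?I \<subseteq> W" using W by auto
  then obtain X0 where X0: "s0 \<in> X0" "open X0" "X0 \<times> ?I \<subseteq> W"
    using Elementary_Topology.tube_lemma[of ?I W s0] W(1) compact_Icc by blast
  obtain d where d: "d > 0" "\<And>s. dist s s0 < d \<Longrightarrow> s \<in> X0"
    using X0 unfolding open_dist by blast
  have "lift_end x (\<lambda>t. h (s, t)) A"
    if s: "s \<in> ?I" "\<bar>s - s0\<bar> < d" and A: "A \<in> G" "lift_end x (\<lambda>t. h (s0, t)) A" for s A
  proof -
    have rA: "r 1 = mat_act A x"
    proof -
      obtain r' where r': "lift_on ?I (\<lambda>t. h (s0, t)) r'" "r' 0 = x" "r' 1 = mat_act A x"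
        using A by (auto simp: lift_end_def)
      have "r 1 = r' 1" by (rule lift_unique[OF rpts r(1) r'(1)]) (use r r' in auto)
      then show ?thesis using r' by simp
    qed
    have sX0: "s \<in> X0" using d(2)[of s] s by (simp add: dist_real_def)
    obtain b where b: "continuous_map (top_of_set ?I) (nsphere q) b"
      "\<And>t. t \<in> ?I \<Longrightarrow> b t \<in> h (s, t)" "\<And>t. t \<in> ?I \<Longrightarrow> edist q (r t) (b t) < sep"
    proof (rule continuous_near_lift[OF slice[OF s(1)] rc])
      fix t assume "t \<in> topspace (top_of_set ?I)"
      then have "(s, t) \<in> N" using s X0 sX0 W by auto
      then show "\<exists>y\<in>h (s, t). edist q (r t) y < sep" by (auto simp: N_def)
    qed auto
    have Px: "proj (q, G) x \<in> points (q, G)" using x by (auto simp: points_eq)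
    \<comment> \<open>At both ends the chosen member and the end of \<open>r\<close> lie in one
      orbit and within \<open>sep\<close>, so they coincide.\<close>
    have "b 0 = x"
      by (rule sep_points[OF Px, of _ _ x]) (use b(2)[of 0] b(3)[of 0] ends[OF s(1)] r(2) xP sep_pos in auto)
    moreover have "b 1 = r 1"
    proof (rule sep_points[OF Px, of _ _ "r 1"])
      show "r 1 \<in> proj (q, G) x" using rA A by (auto simp: proj_apply)
    qed (use b(2)[of 1] b(3)[of 1] ends[OF s(1)] sep_pos in auto)
    moreover have "lift_on ?I (\<lambda>t. h (s, t)) b"
      using b by (auto simp: lift_on_def continuous_map_nsphere_iff)
    ultimately show ?thesis using rA by (auto simp: lift_end_def)
  qed
  then show ?thesis using d(1) by blast
qed

text \<open>Bisection in the homotopy parameter: the label of the slice is locally constant.\<close>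

lemma lift_end_homotopic:
  assumes x: "x \<in> S" and hom: "homotopic_loops_at X (proj (q, G) x) p p'"
    and A: "A \<in> G" "lift_end x p A"
  shows "lift_end x p' A"
proof -
  let ?I = "{0..1::real}"
  obtain h where h: "continuous_map (top_of_set (?I \<times> ?I)) X h"
    "\<And>t. t \<in> ?I \<Longrightarrow> h (0, t) = p t" "\<And>t. t \<in> ?I \<Longrightarrow> h (1, t) = p' t"
    "\<And>s. s \<in> ?I \<Longrightarrow> h (s, 0) = proj (q, G) x \<and> h (s, 1) = proj (q, G) x"
    using hom unfolding homotopic_loops_at_iff by blast
  have loop: "(\<lambda>t. h (s, t)) \<in> loops X (proj (q, G) x)" if "s \<in> ?I" for s
  proof -
    have "continuous_map (top_of_set ?I) (top_of_set (?I \<times> ?I)) (\<lambda>t. (s, t))"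
      using that by (auto intro!: continuous_intros)
    from continuous_map_compose[OF this h(1)] show ?thesis
      using h(4)[OF that] by (simp add: o_def loops_def pathin_def)
  qed
  define P where "P a b \<longleftrightarrow> (0 \<le> a \<and> b \<le> 1 \<longrightarrow>
    (\<forall>A\<in>G. lift_end x (\<lambda>t. h (a, t)) A \<longrightarrow> lift_end x (\<lambda>t. h (b, t)) A))" for a b
  have "P 0 1"
  proof (rule Bolzano)
    fix a b c :: real assume "P a b" "P b c" "a \<le> b" "b \<le> c"
    then show "P a c" by (simp add: P_def)
  next
    fix s :: real assume s: "0 \<le> s" "s \<le> 1"
    obtain d where d: "d > 0" "\<And>s' A. s' \<in> ?I \<Longrightarrow> \<bar>s' - s\<bar> < d \<Longrightarrow> A \<in> G \<Longrightarrow>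
        lift_end x (\<lambda>t. h (s, t)) A \<Longrightarrow> lift_end x (\<lambda>t. h (s', t)) A"
      using lift_end_near[OF h(1) x h(4), of s] s by auto
    have "P a b" if ab: "a \<le> s" "s \<le> b" "b - a < d" for a b
      unfolding P_def
    proof (intro impI ballI)
      fix A assume ab01: "0 \<le> a \<and> b \<le> 1" and A: "A \<in> G" "lift_end x (\<lambda>t. h (a, t)) A"
      have s_in: "s \<in> ?I" using s by simp
      \<comment> \<open>\<open>d\<close> only transports labels away from the central slice
        \<open>s\<close>. So the label \<open>B\<close> at \<open>s\<close> is carried to
        \<open>a\<close>, identified there with \<open>A\<close> by uniqueness, and then carried to
        \<open>b\<close>.\<close>
      obtain B where B: "B \<in> G" "lift_end x (\<lambda>t. h (s, t)) B"
        using lift_end_exists[OF x loop[OF s_in]] by metis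
      have a_in: "a \<in> ?I" using ab ab01 s by auto
      have "lift_end x (\<lambda>t. h (a, t)) B"
        by (rule d(2)[OF a_in _ B]) (use ab in auto)
      then have "A = B"
        using lift_end_unique[OF x _ A(1) B(1) A(2)] loop[OF a_in] by (auto simp: loops_def)
      then show "lift_end x (\<lambda>t. h (b, t)) A"
        using d(2)[OF _ _ B, of b] ab ab01 s by auto
    qed
    then show "\<exists>d>0. \<forall>a b. a \<le> s \<and> s \<le> b \<and> b - a < d \<longrightarrow> P a b" using d(1) by blast
  qed simp
  then have "lift_end x (\<lambda>t. h (0, t)) A \<Longrightarrow> lift_end x (\<lambda>t. h (1, t)) A" using A by (simp add: P_def)
  moreover have "lift_end x (\<lambda>t. h (0, t)) A \<longleftrightarrow> lift_end x p A" "lift_end x (\<lambda>t. h (1, t)) A \<longleftrightarrow> lift_end x p' A"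
    using h(2,3) by (auto simp: lift_end_def lift_on_def)
  ultimately show ?thesis using A by blast
qed

text \<open>Lifts with the same ends are homotopic since the sphere is simply connected, and the
  homotopy is projected back.\<close>

lemma homotopic_of_lift_end:
  assumes x: "x \<in> S" and p: "p \<in> loops X (proj (q, G) x)" and p': "p' \<in> loops X (proj (q, G) x)"
    and A: "A \<in> G" "lift_end x p A" "lift_end x p' A"
  shows "homotopic_loops_at X (proj (q, G) x) p p'"
proof -
  let ?I = "{0..1::real}"
  obtain r r' where r: "lift_on ?I p r" "r 0 = x" "r 1 = mat_act A x"
    and r': "lift_on ?I p' r'" "r' 0 = x" "r' 1 = mat_act A x"
    using A by (auto simp: lift_end_def)
  have pp: "\<And>t. t \<in> ?I \<Longrightarrow> p t \<in> points (q, G)" "\<And>t. t \<in> ?I \<Longrightarrow> p' t \<in> points (q, G)"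
    using p p' pathin_points by (auto simp: loops_def)
  have "rel_homotopic q r r'"
  proof (rule nsphere_paths_rel_homotopic[OF q_ge_2])
    show "continuous_on ?I r" "continuous_on ?I r'" using r r' by (auto simp: lift_on_def)
    show "r ` ?I \<subseteq> S" "r' ` ?I \<subseteq> S"
      using lift_on_sphere(1)[OF r(1) pp(1)] lift_on_sphere(1)[OF r'(1) pp(2)] by auto
    show "r 0 = r' 0" "r 1 = r' 1" using r r' by auto
  qed
  then obtain H where H: "continuous_on (?I \<times> ?I) H" "H ` (?I \<times> ?I) \<subseteq> S"
    "\<forall>t\<in>?I. H (0, t) = r t" "\<forall>t\<in>?I. H (1, t) = r' t" "\<forall>s\<in>?I. H (s, 0) = r 0 \<and> H (s, 1) = r 1"
    unfolding rel_homotopic_iff by blast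
  have "continuous_map (top_of_set (?I \<times> ?I)) (nsphere q) H"
    using H by (simp add: continuous_map_nsphere_iff)
  from continuous_map_compose[OF this] have "continuous_map (top_of_set (?I \<times> ?I)) X (proj (q, G) \<circ> H)"
    using continuous_map_proj[of "(q, G)"] by simp
  moreover have "proj (q, G) (mat_act A x) = proj (q, G) x" by (rule proj_act[OF A(1)])
  ultimately show ?thesis
    unfolding homotopic_loops_at_iff
    using H(3-5) lift_on_sphere(2)[OF r(1) pp(1)] lift_on_sphere(2)[OF r'(1) pp(2)] r(2,3) r'(2,3)
    by (intro exI[of _ "proj (q, G) \<circ> H"]) simp
qed

definition end_class :: "(nat \<Rightarrow> real) \<Rightarrow> real mat \<Rightarrow> (real \<Rightarrow> (nat \<Rightarrow> real) set) set" where
  "end_class x A = {p \<in> loops X (proj (q, G) x). lift_end x p A}"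

lemma loop_class_eq_end_class:
  assumes x: "x \<in> S" and p: "p \<in> loops X (proj (q, G) x)" and A: "A \<in> G" "lift_end x p A"
  shows "loop_class X (proj (q, G) x) p = end_class x A"
  using lift_end_homotopic[OF x _ A] homotopic_of_lift_end[OF x p _ A]
  by (auto simp: loop_class_def end_class_def)

text \<open>\<open>p\<close> is prescribed on the unit interval only, because loops are total
  functions with arbitrary values elsewhere.\<close>

lemma proj_path_loop:
  assumes x: "x \<in> S" and r: "continuous_on {0..1} r" "r ` {0..1} \<subseteq> S" "r 0 = x" "r 1 = mat_act A x" and A: "A \<in> G"
    and p: "\<And>t. t \<in> {0..1} \<Longrightarrow> p t = proj (q, G) (r t)"
  shows "p \<in> end_class x A"
proof -
  have "continuous_map (top_of_set {0..1}) (nsphere q) r" using r by (simp add: continuous_map_nsphere_iff)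
  from continuous_map_compose[OF this] have "continuous_map (top_of_set {0..1}) X (proj (q, G) \<circ> r)"
    using continuous_map_proj[of "(q, G)"] by simp
  then have "pathin X p" unfolding pathin_def by (rule continuous_map_eq) (simp add: p)
  then have "p \<in> loops X (proj (q, G) x)"
    using p[of 0] p[of 1] r proj_act[OF A] by (simp add: loops_def)
  moreover have "lift_on {0..1} p r"
    using r p in_proj by (auto simp: lift_on_def)
  ultimately show ?thesis using r by (auto simp: end_class_def lift_end_def)
qed

lemma end_class_nonempty:
  assumes x: "x \<in> S" and A: "A \<in> G"
  obtains p where "p \<in> end_class x A"
proof -
  obtain r where r: "continuous_on {0..1} r" "r ` {0..1::real} \<subseteq> S" "r 0 = x" "r 1 = mat_act A x"
    using nsphere_path_exists[of q x "mat_act A x"] q_ge_2 x act_sphere[OF A x] by auto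
  have "(\<lambda>t. proj (q, G) (r t)) \<in> end_class x A" by (rule proj_path_loop[OF x r A refl])
  then show ?thesis by (rule that)
qed

text \<open>The second lift must start where the first one ends, so it is translated by
  \<open>A\<close> and ends at \<open>A\<close> applied to the image of \<open>x\<close> under
  \<open>B\<close>. This order yields a homomorphism, not an antihomomorphism.\<close>

lemma loop_concat_end_class:
  assumes x: "x \<in> S" and A: "A \<in> G" and B: "B \<in> G" and p: "p \<in> end_class x A" and p': "p' \<in> end_class x B"
  shows "loop_concat p p' \<in> end_class x (A * B)"
proof -
  let ?I = "{0..1::real}"
  obtain r r' where r: "lift_on ?I p r" "r 0 = x" "r 1 = mat_act A x"
    and r': "lift_on ?I p' r'" "r' 0 = x" "r' 1 = mat_act B x"
    using p p' by (auto simp: end_class_def lift_end_def)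
  have pp: "\<And>t. t \<in> ?I \<Longrightarrow> p t \<in> points (q, G)" "\<And>t. t \<in> ?I \<Longrightarrow> p' t \<in> points (q, G)"
    using p p' pathin_points by (auto simp: end_class_def loops_def)
  define R where "R t = (if t \<le> 1 / 2 then r (2 * t) else mat_act A (r' (2 * t - 1)))" for t :: real
  have "continuous_on ?I R"
    unfolding R_def
  proof (rule continuous_on_cases_le)
    show "continuous_on {t \<in> ?I. t \<le> 1 / 2} (\<lambda>t. r (2 * t))"
      by (rule continuous_on_compose2[of ?I r]) (use r(1) in \<open>auto simp: lift_on_def intro!: continuous_intros\<close>)
    show "continuous_on {t \<in> ?I. 1 / 2 \<le> t} (\<lambda>t. mat_act A (r' (2 * t - 1)))"
    proof (rule continuous_on_mat_act)
      show "continuous_on {t \<in> ?I. 1 / 2 \<le> t} (\<lambda>t. r' (2 * t - 1))"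
        by (rule continuous_on_compose2[of ?I r']) (use r'(1) in \<open>auto simp: lift_on_def intro!: continuous_intros\<close>)
    qed
    show "r (2 * t) = mat_act A (r' (2 * t - 1))" if "t \<in> ?I" "t = 1 / 2" for t
    proof -
      have "2 * t = 1" using that by simp
      then show ?thesis by (simp add: r(3) r'(2))
    qed
  qed (intro continuous_intros)
  moreover have "R t \<in> S \<and> loop_concat p p' t = proj (q, G) (R t)" if t: "t \<in> ?I" for t
  proof (cases "t \<le> 1 / 2")
    case True
    then show ?thesis
      using lift_on_sphere[OF r(1) pp(1), of "2 * t"] t by (simp add: R_def loop_concat_def)
  next
    case False
    then show ?thesis
      using lift_on_sphere[OF r'(1) pp(2), of "2 * t - 1"] t act_sphere[OF A] proj_act[OF A]
      by (simp add: R_def loop_concat_def)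
  qed
  moreover have "R 0 = x" "R 1 = mat_act (A * B) x"
    using r r' by (simp_all add: R_def act_mult A B)
  ultimately show ?thesis
    by (intro proj_path_loop[OF x, of R] mult_in_G A B) auto
qed

text \<open>Classes of loops correspond to the labels of their lifts: every label occurs since the
  sphere is path connected, and equal labels mean homotopic loops since it is simply
  connected.\<close>

theorem fundamental_group_iso:
  assumes P: "P \<in> points (q, G)"
  shows "(orthogonal_group (q + 1))\<lparr>carrier := G\<rparr> \<cong> fundamental_group X P"
proof -
  obtain x where x: "x \<in> S" "P = proj (q, G) x" using P by (auto simp: points_eq)
  have class_end: "loop_class X P p = end_class x A" if "A \<in> G" "p \<in> end_class x A" for p A
    using loop_class_eq_end_class[OF x(1), of p A] that by (simp add: end_class_def x(2))
  have carrier: "carrier (fundamental_group X P) = end_class x ` G"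
  proof (intro equalityI subsetI)
    fix c assume "c \<in> carrier (fundamental_group X P)"
    then obtain p where p: "p \<in> loops X P" "c = loop_class X P p" by (auto simp: fundamental_group_def)
    then obtain A where "A \<in> G" "lift_end x p A" using lift_end_exists[OF x(1)] x(2) by metis
    then show "c \<in> end_class x ` G"
      using loop_class_eq_end_class[OF x(1)] p x(2) by auto
  next
    fix c assume "c \<in> end_class x ` G"
    then obtain A where A: "A \<in> G" "c = end_class x A" by auto
    obtain p where p: "p \<in> end_class x A" using end_class_nonempty[OF x(1) A(1)] .
    then have "p \<in> loops X P" by (simp add: end_class_def x(2))
    then show "c \<in> carrier (fundamental_group X P)"
      using class_end[OF A(1) p] A(2) by (auto simp: fundamental_group_def)
  qed
  have inj: "inj_on (end_class x) G"
  proof (rule inj_onI)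
    fix A B assume A: "A \<in> G" and B: "B \<in> G" and eq: "end_class x A = end_class x B"
    obtain p where p: "p \<in> end_class x A" using end_class_nonempty[OF x(1) A] .
    then have "p \<in> end_class x B" using eq by simp
    with p show "A = B"
      using lift_end_unique[OF x(1) _ A B] by (auto simp: end_class_def loops_def)
  qed
  have mult: "end_class x (A * B) = end_class x A \<otimes>\<^bsub>fundamental_group X P\<^esub> end_class x B"
    if A: "A \<in> G" and B: "B \<in> G" for A B
  proof -
    \<comment> \<open>The product is a union over representatives; all its members are the same
      class, and it is nonempty because both factors are inhabited.\<close>
    have "loop_class X P (loop_concat p p') = end_class x (A * B)"
      if "p \<in> end_class x A" "p' \<in> end_class x B" for p p'
      using class_end[OF mult_in_G[OF A B] loop_concat_end_class[OF x(1) A B that]] .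
    moreover obtain p p' where "p \<in> end_class x A" "p' \<in> end_class x B"
      using end_class_nonempty[OF x(1)] A B by metis
    ultimately show ?thesis by (auto simp: fundamental_group_def)
  qed
  have "end_class x \<in> iso ((orthogonal_group (q + 1))\<lparr>carrier := G\<rparr>) (fundamental_group X P)"
    using carrier inj mult by (auto simp: iso_def hom_def bij_betw_def)
  then show ?thesis by (rule is_isoI)
qed

end

lemma isomorphic_fundamental_groupsD:
  assumes "spherical_space_form (q, G)" "spherical_space_form (q', H)"
    "isomorphic_fundamental_groups (q, G) (q', H)"
  shows "(orthogonal_group (q + 1))\<lparr>carrier := G\<rparr> \<cong> (orthogonal_group (q' + 1))\<lparr>carrier := H\<rparr>"
proof -
  interpret G: space_form_group q G by unfold_locales (rule assms)
  interpret H: space_form_group q' H by unfold_locales (rule assms)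
  obtain P Q where PQ: "P \<in> points (q, G)" "Q \<in> points (q', H)"
    "fundamental_group (quotient_top (q, G)) P \<cong> fundamental_group (quotient_top (q', H)) Q"
    using assms(3) unfolding isomorphic_fundamental_groups_def by blast
  have "group ((orthogonal_group (q' + 1))\<lparr>carrier := H\<rparr>)"
    by (rule subgroup.subgroup_is_group[OF H.subgroup_G group_orthogonal_group])
  then have "fundamental_group (quotient_top (q', H)) Q \<cong> (orthogonal_group (q' + 1))\<lparr>carrier := H\<rparr>"
    by (rule group.iso_sym[OF _ H.fundamental_group_iso[OF PQ(2)]])
  with iso_trans[OF G.fundamental_group_iso[OF PQ(1)] PQ(3)] show ?thesis
    by (rule iso_trans)
qed

section \<open>Monomial matrices\<close>

definition complex_coord :: "(nat \<Rightarrow> real) \<Rightarrow> nat \<Rightarrow> complex" where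
  "complex_coord x n = Complex (x (2 * n)) (x (2 * n + 1))"

text \<open>Since 819 = 9 * 91, multiples of 9 give the 91st roots of unity and multiples of 91 the
  9th roots.\<close>

definition root819 :: "nat \<Rightarrow> complex" where
  "root819 m = cis (2 * pi * real m / 819)"

lemma root819_add: "root819 (m + n) = root819 m * root819 n"
  by (simp add: root819_def cis_mult add_divide_distrib distrib_left)

lemma root819_eq_1_iff: "root819 m = 1 \<longleftrightarrow> 819 dvd m"
proof -
  have "root819 m = 1 \<longleftrightarrow> (\<exists>n::int. 2 * pi * real m / 819 = real_of_int (2 * n) * pi)"
    by (simp add: root819_def cis_conv_exp exp_eq_1)
  also have "\<dots> \<longleftrightarrow> (\<exists>n::int. real m = 819 * real_of_int n)"
    by (simp add: field_simps)
  also have "\<dots> \<longleftrightarrow> (\<exists>n::int. int m = 819 * n)"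
    by (metis (mono_tags) of_int_eq_iff of_int_mult of_int_numeral of_int_of_nat_eq)
  also have "\<dots> \<longleftrightarrow> int 819 dvd int m" by (auto simp: dvd_def)
  finally show ?thesis by (simp only: int_dvd_int_iff)
qed

lemma root819_dvd: "819 dvd m \<Longrightarrow> root819 m = 1"
  by (simp add: root819_eq_1_iff)

lemma root819_cong:
  assumes "[m = n] (mod 819)"
  shows "root819 m = root819 n"
proof -
  have "root819 m = root819 (m mod 819)" for m
    using root819_add[of "819 * (m div 819)" "m mod 819"] root819_dvd[of "819 * (m div 819)"] by simp
  then show ?thesis using assms unfolding cong_def by metis
qed

lemma root819_nonzero [simp]: "root819 m \<noteq> 0"
  by (simp add: root819_def)

text \<open>The real matrix of multiplication by \<open>z\<close>, with rows (Re z, - Im z) and (Im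
  z, Re z).\<close>

definition rotation_entry :: "complex \<Rightarrow> nat \<Rightarrow> nat \<Rightarrow> real" where
  "rotation_entry z i j = (if i = j then Re z else if i = 0 then - Im z else Im z)"

text \<open>The real matrix of the map sending the complex coordinate \<open>n\<close>, multiplied by
  \<open>root819 (\<theta> n)\<close>, to the complex coordinate \<open>\<pi> n\<close>.\<close>

definition monomial_mat :: "nat \<Rightarrow> (nat \<Rightarrow> nat) \<Rightarrow> (nat \<Rightarrow> nat) \<Rightarrow> real mat" where
  "monomial_mat N \<pi> \<theta> = Matrix.mat (2 * N) (2 * N) (\<lambda>(s, t).
     if s div 2 = \<pi> (t div 2) then rotation_entry (root819 (\<theta> (t div 2))) (s mod 2) (t mod 2) else 0)"

lemma monomial_mat_carrier [simp]: "monomial_mat N \<pi> \<theta> \<in> carrier_mat (2 * N) (2 * N)"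
  by (simp add: monomial_mat_def)

lemma sum_pairs: "(\<Sum>t<2 * N. f t) = (\<Sum>n<N. f (2 * n) + f (2 * n + 1))"
  for f :: "nat \<Rightarrow> 'a::comm_monoid_add"
  by (induction N) (auto simp: add_ac)

lemma complex_coord_monomial:
  assumes \<pi>: "bij_betw \<pi> {..<N} {..<N}" and n: "n < N"
  shows "complex_coord (mat_act (monomial_mat N \<pi> \<theta>) x) (\<pi> n) = root819 (\<theta> n) * complex_coord x n"
proof -
  have \<pi>n: "\<pi> n < N" using bij_betwE[OF \<pi>] n by auto
  have inj: "\<pi> n = \<pi> m \<longleftrightarrow> m = n" if "m < N" for m
    using \<pi> n that by (auto simp: bij_betw_def inj_on_def)
  have entry: "mat_act (monomial_mat N \<pi> \<theta>) x (2 * \<pi> n + e)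
      = rotation_entry (root819 (\<theta> n)) e 0 * x (2 * n) + rotation_entry (root819 (\<theta> n)) e 1 * x (2 * n + 1)"
    if e: "e < 2" for e
  proof -
    have "mat_act (monomial_mat N \<pi> \<theta>) x (2 * \<pi> n + e) = (\<Sum>t<2 * N. monomial_mat N \<pi> \<theta> $$ (2 * \<pi> n + e, t) * x t)"
      using e \<pi>n by (simp add: mat_act_apply[of _ "2 * N"])
    also have "\<dots> = (\<Sum>m<N. if m = n then rotation_entry (root819 (\<theta> n)) e 0 * x (2 * n) + rotation_entry (root819 (\<theta> n)) e 1 * x (2 * n + 1) else 0)"
      unfolding sum_pairs
    proof (rule sum.cong[OF refl])
      fix m assume "m \<in> {..<N}"
      moreover have "(2 * \<pi> n + e) div 2 = \<pi> n" "(2 * \<pi> n + e) mod 2 = e" "2 * \<pi> n + e < 2 * N"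
        using e \<pi>n by auto
      ultimately show "monomial_mat N \<pi> \<theta> $$ (2 * \<pi> n + e, 2 * m) * x (2 * m) + monomial_mat N \<pi> \<theta> $$ (2 * \<pi> n + e, 2 * m + 1) * x (2 * m + 1)
        = (if m = n then rotation_entry (root819 (\<theta> n)) e 0 * x (2 * n) + rotation_entry (root819 (\<theta> n)) e 1 * x (2 * n + 1) else 0)"
        using inj[of m] by (simp add: monomial_mat_def)
    qed
    also have "\<dots> = rotation_entry (root819 (\<theta> n)) e 0 * x (2 * n) + rotation_entry (root819 (\<theta> n)) e 1 * x (2 * n + 1)"
      using n by simp
    finally show ?thesis .
  qed
  show ?thesis
    using entry[of 0] entry[of 1] by (simp add: complex_coord_def complex_eq_iff rotation_entry_def)
qed

lemma complex_coord_eqI: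
  assumes "\<And>i. i \<ge> 2 * N \<Longrightarrow> x i = 0" "\<And>i. i \<ge> 2 * N \<Longrightarrow> y i = 0"
    and "\<And>n. n < N \<Longrightarrow> complex_coord x n = complex_coord y n"
  shows "x = y"
proof
  fix i
  show "x i = y i"
  proof (cases "i < 2 * N")
    case True
    then have "complex_coord x (i div 2) = complex_coord y (i div 2)" using assms(3) by simp
    then have "x (2 * (i div 2)) = y (2 * (i div 2))" "x (2 * (i div 2) + 1) = y (2 * (i div 2) + 1)"
      by (simp_all add: complex_coord_def)
    moreover have "i = 2 * (i div 2) \<or> i = 2 * (i div 2) + 1" by presburger
    ultimately show ?thesis by metis
  qed (use assms in simp)
qed

lemma mat_eq_of_mat_act:
  assumes A: "A \<in> carrier_mat n n" and B: "B \<in> carrier_mat n n" and eq: "\<And>x. mat_act A x = mat_act B x"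
  shows "A = B"
proof (rule eq_matI)
  have entry: "C $$ (i, j) = mat_act C (\<lambda>t. if t = j then 1 else 0) i"
    if "C \<in> carrier_mat n n" "i < n" "j < n" for C i j
    using that by (simp add: mat_act_apply[OF that(1)] if_distrib[of "\<lambda>c. _ * c"] cong: if_cong)
  show "A $$ (i, j) = B $$ (i, j)" if "i < dim_row B" "j < dim_col B" for i j
    using entry[OF A, of i j] entry[OF B, of i j] that B eq by simp
qed (use A B in auto)

text \<open>A matrix is recognised by its effect on complex coordinates, so products need no
  computation with real entries.\<close>

lemma monomial_mat_eqI:
  assumes \<pi>: "bij_betw \<pi> {..<N} {..<N}" and A: "A \<in> carrier_mat (2 * N) (2 * N)"
    and "\<And>x n. n < N \<Longrightarrow> complex_coord (mat_act A x) (\<pi> n) = root819 (\<theta> n) * complex_coord x n"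
  shows "A = monomial_mat N \<pi> \<theta>"
proof (rule mat_eq_of_mat_act[OF A monomial_mat_carrier])
  fix x
  show "mat_act A x = mat_act (monomial_mat N \<pi> \<theta>) x"
  proof (rule complex_coord_eqI[of N])
    fix m assume "m < N"
    then obtain n where n: "n < N" "m = \<pi> n" using \<pi> by (auto simp: bij_betw_def)
    show "complex_coord (mat_act A x) m = complex_coord (mat_act (monomial_mat N \<pi> \<theta>) x) m"
      unfolding n(2) using assms(3)[OF n(1)] complex_coord_monomial[OF \<pi> n(1)] by simp
  qed (use A in \<open>auto simp: mat_act_apply[OF A] mat_act_apply[OF monomial_mat_carrier]\<close>)
qed

lemma monomial_mat_mult:
  assumes \<pi>: "bij_betw \<pi> {..<N} {..<N}" and \<pi>': "bij_betw \<pi>' {..<N} {..<N}"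
  shows "monomial_mat N \<pi> \<theta> * monomial_mat N \<pi>' \<theta>' = monomial_mat N (\<pi> \<circ> \<pi>') (\<lambda>n. \<theta>' n + \<theta> (\<pi>' n))"
proof (rule monomial_mat_eqI)
  show "bij_betw (\<pi> \<circ> \<pi>') {..<N} {..<N}" using bij_betw_trans[OF \<pi>' \<pi>] .
  show "monomial_mat N \<pi> \<theta> * monomial_mat N \<pi>' \<theta>' \<in> carrier_mat (2 * N) (2 * N)"
    by (rule mult_carrier_mat[OF monomial_mat_carrier monomial_mat_carrier])
  fix x n assume n: "n < N"
  then have "\<pi>' n < N" using bij_betwE[OF \<pi>'] by auto
  then show "complex_coord (mat_act (monomial_mat N \<pi> \<theta> * monomial_mat N \<pi>' \<theta>') x) ((\<pi> \<circ> \<pi>') n)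
      = root819 (\<theta>' n + \<theta> (\<pi>' n)) * complex_coord x n"
    using n by (simp add: mat_act_mult[OF monomial_mat_carrier monomial_mat_carrier]
        complex_coord_monomial[OF \<pi>] complex_coord_monomial[OF \<pi>'] root819_add mult_ac)
qed

lemma monomial_mat_cong:
  assumes "bij_betw \<pi> {..<N} {..<N}" and "\<And>n. n < N \<Longrightarrow> \<pi> n = \<pi>' n" and "\<And>n. n < N \<Longrightarrow> [\<theta> n = \<theta>' n] (mod 819)"
  shows "monomial_mat N \<pi> \<theta> = monomial_mat N \<pi>' \<theta>'"
proof (rule eq_matI)
  fix i j assume "i < dim_row (monomial_mat N \<pi>' \<theta>')" "j < dim_col (monomial_mat N \<pi>' \<theta>')"
  then have ij: "i < 2 * N" "j < 2 * N" by (simp_all add: monomial_mat_def)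
  then have "j div 2 < N" by simp
  then show "monomial_mat N \<pi> \<theta> $$ (i, j) = monomial_mat N \<pi>' \<theta>' $$ (i, j)"
    using ij assms(2) root819_cong[OF assms(3)] by (simp add: monomial_mat_def)
qed (simp_all add: monomial_mat_def)

lemma monomial_mat_one: "monomial_mat N (\<lambda>n. n) (\<lambda>_. 0) = 1\<^sub>m (2 * N)"
proof (rule monomial_mat_eqI[symmetric])
  show "bij_betw (\<lambda>n. n) {..<N} {..<N}" using bij_betw_id by (simp add: id_def)
  fix x n assume n: "n < N"
  have "mat_act (1\<^sub>m (2 * N)) x i = x i" if "i < 2 * N" for i
    using that by (simp add: mat_act_apply[of _ "2 * N"] if_distrib[of "\<lambda>c. c * _"] cong: if_cong)
  then show "complex_coord (mat_act (1\<^sub>m (2 * N)) x) n = root819 0 * complex_coord x n"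
    using n by (simp add: complex_coord_def root819_def)
qed simp

text \<open>818 is -1 modulo 819; exponents are natural numbers, so inverse roots have to be written
  this way.\<close>

lemma root819_cnj: "root819 (818 * m) = cnj (root819 m)"
proof -
  have "root819 (818 * m) * root819 m = 1"
    using root819_dvd[of "819 * m"] by (simp flip: root819_add)
  moreover have "cnj (root819 m) * root819 m = 1"
    by (simp add: root819_def cis_cnj cis_mult)
  ultimately show ?thesis by (metis mult_right_cancel root819_nonzero)
qed

lemma monomial_mat_orthogonal:
  assumes \<pi>: "bij_betw \<pi> {..<N} {..<N}"
  shows "monomial_mat N \<pi> \<theta> \<in> carrier (orthogonal_group (2 * N))"
proof -
  define \<pi>' where "\<pi>' = inv_into {..<N} \<pi>"
  have \<pi>': "bij_betw \<pi>' {..<N} {..<N}" unfolding \<pi>'_def by (rule bij_betw_inv_into[OF \<pi>])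
  have inv1: "\<pi>' (\<pi> n) = n" if "n < N" for n
    using that bij_betw_inv_into_left[OF \<pi>] by (simp add: \<pi>'_def)
  have inv2: "\<pi> (\<pi>' n) = n" if "n < N" for n
    using that bij_betw_inv_into_right[OF \<pi>] by (simp add: \<pi>'_def)
  \<comment> \<open>The transpose is again monomial, with the inverse permutation and conjugate
    roots.\<close>
  have "transpose_mat (monomial_mat N \<pi> \<theta>) = monomial_mat N \<pi>' (\<lambda>m. 818 * \<theta> (\<pi>' m))"
  proof (rule eq_matI)
    fix s t assume "s < dim_row (monomial_mat N \<pi>' (\<lambda>m. 818 * \<theta> (\<pi>' m)))" "t < dim_col (monomial_mat N \<pi>' (\<lambda>m. 818 * \<theta> (\<pi>' m)))"
    then have st: "s < 2 * N" "t < 2 * N" by (simp_all add: monomial_mat_def)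
    then have "s div 2 < N" "t div 2 < N" by auto
    then have iff: "t div 2 = \<pi> (s div 2) \<longleftrightarrow> s div 2 = \<pi>' (t div 2)"
      using inv1[of "s div 2"] inv2[of "t div 2"] by auto
    have rot: "rotation_entry z (t mod 2) (s mod 2) = rotation_entry (cnj z) (s mod 2) (t mod 2)" for z
      by (auto simp: rotation_entry_def)
    show "transpose_mat (monomial_mat N \<pi> \<theta>) $$ (s, t) = monomial_mat N \<pi>' (\<lambda>m. 818 * \<theta> (\<pi>' m)) $$ (s, t)"
      using st by (auto simp: monomial_mat_def iff rot root819_cnj)
  qed (simp_all add: monomial_mat_def)
  then have "transpose_mat (monomial_mat N \<pi> \<theta>) * monomial_mat N \<pi> \<theta>
      = monomial_mat N (\<pi>' \<circ> \<pi>) (\<lambda>n. \<theta> n + 818 * \<theta> (\<pi>' (\<pi> n)))"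
    by (simp add: monomial_mat_mult[OF \<pi>' \<pi>])
  also have "\<dots> = monomial_mat N (\<lambda>n. n) (\<lambda>_. 0)"
    by (rule monomial_mat_cong[OF bij_betw_trans[OF \<pi> \<pi>']]) (auto simp: inv1 cong_0_iff)
  finally show ?thesis by (simp add: carrier_orthogonal_group monomial_mat_one)
qed

definition monomial_group :: "nat \<Rightarrow> real mat set" where
  "monomial_group N = {monomial_mat N \<pi> \<theta> |\<pi> \<theta>. bij_betw \<pi> {..<N} {..<N}}"

lemma monomial_group_subset: "monomial_group N \<subseteq> carrier (orthogonal_group (2 * N))"
  by (auto simp: monomial_group_def intro: monomial_mat_orthogonal)

lemma monomial_group_mult:
  assumes "A \<in> monomial_group N" "B \<in> monomial_group N"
  shows "A * B \<in> monomial_group N"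
proof -
  obtain \<pi> \<theta> where \<pi>: "bij_betw \<pi> {..<N} {..<N}" and A: "A = monomial_mat N \<pi> \<theta>"
    using assms(1) unfolding monomial_group_def by blast
  obtain \<pi>' \<theta>' where \<pi>': "bij_betw \<pi>' {..<N} {..<N}" and B: "B = monomial_mat N \<pi>' \<theta>'"
    using assms(2) unfolding monomial_group_def by blast
  have "A * B = monomial_mat N (\<pi> \<circ> \<pi>') (\<lambda>n. \<theta>' n + \<theta> (\<pi>' n))"
    unfolding A B by (rule monomial_mat_mult[OF \<pi> \<pi>'])
  then show ?thesis
    unfolding monomial_group_def using bij_betw_trans[OF \<pi>' \<pi>] by blast
qed

text \<open>Only exponents modulo 819 and values of both functions below \<open>N\<close>
  matter.\<close>

lemma finite_monomial_group: "finite (monomial_group N)"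
proof -
  let ?F = "PiE {..<N} (\<lambda>_. {..<N}) \<times> PiE {..<N} (\<lambda>_. {..<819::nat})"
  have "monomial_group N \<subseteq> (\<lambda>(\<pi>, \<theta>). monomial_mat N \<pi> \<theta>) ` ?F"
  proof
    fix A assume "A \<in> monomial_group N"
    then obtain \<pi> \<theta> where \<pi>: "bij_betw \<pi> {..<N} {..<N}" and A: "A = monomial_mat N \<pi> \<theta>"
      unfolding monomial_group_def by blast
    have "A = monomial_mat N (restrict \<pi> {..<N}) (restrict (\<lambda>n. \<theta> n mod 819) {..<N})"
      unfolding A by (rule monomial_mat_cong[OF \<pi>]) (auto simp: cong_def)
    moreover have "(restrict \<pi> {..<N}, restrict (\<lambda>n. \<theta> n mod 819) {..<N}) \<in> ?F"
      using bij_betwE[OF \<pi>] by auto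
    ultimately show "A \<in> (\<lambda>(\<pi>, \<theta>). monomial_mat N \<pi> \<theta>) ` ?F"
      by (intro image_eqI[of _ _ "(restrict \<pi> {..<N}, restrict (\<lambda>n. \<theta> n mod 819) {..<N})"]) simp_all
  qed
  moreover have "finite ?F" by (intro finite_cartesian_product finite_PiE) auto
  ultimately show ?thesis by (rule finite_surj[rotated])
qed

section \<open>The metacyclic groups\<close>

text \<open>As 16^3 and 9^3 are 1 modulo 91, the weight of \<open>9 * c + 3 * i + j\<close> is
  congruent to 16^i 9^j: one formula for all copies of the nine coordinates.\<close>

definition weight :: "nat \<Rightarrow> nat" where
  "weight n = 16 ^ (n div 3) * 9 ^ n"

lemma coprime_weight: "coprime (weight n) 91"
proof -
  have "coprime (16::nat) 91" "coprime (9::nat) 91" by (simp_all add: coprime_iff_gcd_eq_1 gcd_non_0_nat)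
  then show ?thesis by (simp add: weight_def)
qed

lemma cong_9_91:
  fixes x y :: nat
  assumes "[x = x'] (mod 91)" "[y = y'] (mod 9)"
  shows "[9 * x + 91 * y = 9 * x' + 91 * y'] (mod 819)"
proof (rule cong_add)
  have "9 * x mod (9 * 91) = 9 * x' mod (9 * 91)" "91 * y mod (91 * 9) = 91 * y' mod (91 * 9)"
    using assms unfolding cong_def by (metis mult_mod_right)+
  then show "[9 * x = 9 * x'] (mod 819)" "[91 * y = 91 * y'] (mod 819)" by (simp_all add: cong_def)
qed

text \<open>Reduction modulo 9 and modulo 91 isolates one summand each, whose coefficient is a unit
  for that modulus.\<close>

lemma dvd_9_91:
  fixes x y :: nat
  assumes "819 dvd 9 * x + 91 * y"
  shows "91 dvd x" "9 dvd y"
proof -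
  have "9 dvd 9 * x + 91 * y" "91 dvd 9 * x + 91 * y"
    using assms by (auto elim!: dvd_trans[rotated])
  then have "9 dvd 91 * y" "91 dvd 9 * x" by (auto simp: dvd_add_right_iff dvd_add_left_iff)
  moreover have "coprime (9::nat) 91" by (simp add: coprime_iff_gcd_eq_1 gcd_non_0_nat)
  ultimately show "91 dvd x" "9 dvd y" by (auto simp: coprime_dvd_mult_right_iff coprime_commute)
qed

text \<open>What both groups share. Modulo 91, \<open>1 + 90 * r\<close> is 1 - r and
  \<open>1 + 90 * r ^ 2\<close> is 1 - r^2; that these are units is used in
  \<open>elt_conjugate_power\<close>.\<close>

locale metacyclic =
  fixes k r :: nat and \<pi> :: "nat \<Rightarrow> nat"
  assumes k: "k \<ge> 1"
    and \<pi>_less: "\<And>n. n < 9 * k \<Longrightarrow> \<pi> n < 9 * k"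
    and \<pi>3: "\<And>n. \<pi> (\<pi> (\<pi> n)) = n"
    and weight_\<pi>: "\<And>n. [weight (\<pi> n) = r * weight n] (mod 91)"
    and r3: "[r ^ 3 = 1] (mod 91)"
    and r_unit: "coprime (1 + 90 * r) 91" "coprime (1 + 90 * r ^ 2) 91"
begin

abbreviation "N \<equiv> 9 * k"

lemma bij_\<pi>: "bij_betw \<pi> {..<N} {..<N}"
  by (rule bij_betw_byWitness[where f' = "\<pi> \<circ> \<pi>"]) (auto simp: \<pi>3 \<pi>_less)

lemma bij_\<pi>_pow: "bij_betw (\<pi> ^^ b) {..<N} {..<N}"
  by (rule bij_betw_funpow[OF bij_\<pi>])

lemma \<pi>_pow_dvd: "3 dvd b \<Longrightarrow> (\<pi> ^^ b) n = n"
proof -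
  have "\<pi> ^^ 3 = (\<lambda>n. n)" by (auto simp: \<pi>3 eval_nat_numeral fun_eq_iff)
  then have "(\<pi> ^^ (3 * c)) n = n" for c
    unfolding funpow_mult[symmetric] by (induction c) simp_all
  then show "3 dvd b \<Longrightarrow> (\<pi> ^^ b) n = n" by (auto elim!: dvdE)
qed

lemma \<pi>_pow_cong:
  assumes "[b = b'] (mod 9)"
  shows "(\<pi> ^^ b) n = (\<pi> ^^ b') n"
proof -
  have "(\<pi> ^^ b) n = (\<pi> ^^ (b mod 9)) n" for b
  proof -
    have "(\<pi> ^^ (b mod 9 + 9 * (b div 9))) n = (\<pi> ^^ (b mod 9)) n"
      unfolding funpow_add o_apply by (subst \<pi>_pow_dvd) auto
    then show ?thesis by simp
  qed
  then show ?thesis using assms unfolding cong_def by metis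
qed

lemma weight_pow: "[weight ((\<pi> ^^ b) n) = r ^ b * weight n] (mod 91)"
proof (induction b)
  case (Suc b)
  have "[weight (\<pi> ((\<pi> ^^ b) n)) = r * weight ((\<pi> ^^ b) n)] (mod 91)" by (rule weight_\<pi>)
  also have "[r * weight ((\<pi> ^^ b) n) = r * (r ^ b * weight n)] (mod 91)"
    by (rule cong_mult[OF cong_refl Suc])
  finally show ?case by (simp add: mult.assoc)
qed simp

lemma r_pow_dvd:
  assumes "3 dvd b"
  shows "[r ^ b = 1] (mod 91)"
proof -
  obtain c where "b = 3 * c" using assms by auto
  then show ?thesis using cong_pow[OF r3, of c] by (simp add: power_mult)
qed

lemma r_pow_cancel:
  assumes "3 dvd b"
  shows "[r ^ b * x = x] (mod 91)"
  using cong_mult[OF r_pow_dvd[OF assms] cong_refl[of x]] by simp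

text \<open>The matrix A^a B^b: B^b permutes by \<open>\<pi> ^^ b\<close> and contributes
  \<open>91 * b\<close>, then A^a acts on the target coordinate through its weight.\<close>

definition elt :: "nat \<Rightarrow> nat \<Rightarrow> real mat" where
  "elt a b = monomial_mat N (\<pi> ^^ b) (\<lambda>n. 9 * (a * weight ((\<pi> ^^ b) n)) + 91 * b)"

lemma elt_monomial_group: "elt a b \<in> monomial_group N"
  unfolding elt_def monomial_group_def using bij_\<pi>_pow by blast

lemma elt_cong:
  assumes "[a = a'] (mod 91)" "[b = b'] (mod 9)"
  shows "elt a b = elt a' b'"
  unfolding elt_def
proof (rule monomial_mat_cong[OF bij_\<pi>_pow])
  show eq: "(\<pi> ^^ b) n = (\<pi> ^^ b') n" for n by (rule \<pi>_pow_cong[OF assms(2)])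
  show "[9 * (a * weight ((\<pi> ^^ b) n)) + 91 * b = 9 * (a' * weight ((\<pi> ^^ b') n)) + 91 * b'] (mod 819)" for n
    unfolding eq by (intro cong_9_91 cong_mult assms cong_refl)
qed

text \<open>B^b A^a' B^-b is A to the power r^-b a', and r^-b is written \<open>r ^ (2 * b)\<close>
  because r^3 is 1 modulo 91.\<close>

lemma elt_mult: "elt a b * elt a' b' = elt (a + r ^ (2 * b) * a') (b + b')"
proof -
  have "elt a b * elt a' b' = monomial_mat N (\<pi> ^^ b \<circ> \<pi> ^^ b')
      (\<lambda>n. (9 * (a' * weight ((\<pi> ^^ b') n)) + 91 * b') + (9 * (a * weight ((\<pi> ^^ b) ((\<pi> ^^ b') n))) + 91 * b))"
    unfolding elt_def by (rule monomial_mat_mult[OF bij_\<pi>_pow bij_\<pi>_pow])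
  also have "\<dots> = elt (a + r ^ (2 * b) * a') (b + b')"
    unfolding elt_def
  proof (rule monomial_mat_cong)
    show "bij_betw (\<pi> ^^ b \<circ> \<pi> ^^ b') {..<N} {..<N}" by (rule bij_betw_trans[OF bij_\<pi>_pow bij_\<pi>_pow])
    show "(\<pi> ^^ b \<circ> \<pi> ^^ b') n = (\<pi> ^^ (b + b')) n" for n by (simp add: funpow_add)
    fix n
    define w' where "w' = weight ((\<pi> ^^ b') n)"
    define w where "w = weight ((\<pi> ^^ b) ((\<pi> ^^ b') n))"
    have "[r ^ (2 * b) * a' * w = r ^ (2 * b) * a' * (r ^ b * w')] (mod 91)"
      unfolding w_def w'_def by (intro cong_mult cong_refl weight_pow)
    also have "r ^ (2 * b) * a' * (r ^ b * w') = r ^ (3 * b) * (a' * w')"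
    proof -
      have "r ^ (3 * b) = r ^ (2 * b) * r ^ b" by (simp flip: power_add)
      then show ?thesis by (simp add: mult_ac)
    qed
    also have "[r ^ (3 * b) * (a' * w') = a' * w'] (mod 91)" by (rule r_pow_cancel) simp
    finally have "[a' * w' + a * w = r ^ (2 * b) * a' * w + a * w] (mod 91)"
      by (intro cong_add cong_refl) (rule cong_sym)
    then have "[9 * (a' * w' + a * w) + 91 * (b + b') = 9 * ((a + r ^ (2 * b) * a') * w) + 91 * (b + b')] (mod 819)"
      by (intro cong_9_91 cong_refl) (simp add: algebra_simps)
    then show "[(9 * (a' * weight ((\<pi> ^^ b') n)) + 91 * b') + (9 * (a * weight ((\<pi> ^^ b) ((\<pi> ^^ b') n))) + 91 * b)
       = 9 * ((a + r ^ (2 * b) * a') * weight ((\<pi> ^^ (b + b')) n)) + 91 * (b + b')] (mod 819)"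
      by (simp add: w_def w'_def funpow_add algebra_simps)
  qed
  finally show ?thesis .
qed

lemma elt_0_0: "elt 0 0 = 1\<^sub>m (2 * N)"
  unfolding monomial_mat_one[symmetric] elt_def by (rule monomial_mat_cong) (use bij_\<pi>_pow[of 0] in \<open>auto simp: id_def\<close>)

text \<open>The inverse of A^a B^b has exponents - r^b a and - b, where -1 is 90 modulo 91 and 8
  modulo 9.\<close>

lemma elt_inverse:
  "elt a b * elt (90 * (r ^ b * a)) (8 * b) = 1\<^sub>m (2 * N)"
  "elt (90 * (r ^ b * a)) (8 * b) * elt a b = 1\<^sub>m (2 * N)"
proof -
  have "r ^ (2 * b) * (90 * (r ^ b * a)) = 90 * (r ^ (3 * b) * a)"
  proof -
    have "r ^ (3 * b) = r ^ (2 * b) * r ^ b" by (simp flip: power_add)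
    then show ?thesis by (simp add: mult_ac)
  qed
  moreover have "[a + 90 * (r ^ (3 * b) * a) = a + 90 * a] (mod 91)"
    by (intro cong_add cong_mult cong_refl r_pow_cancel) simp
  moreover have "[a + 90 * a = 0] (mod 91)" by (simp add: cong_0_iff)
  ultimately have 1: "[a + r ^ (2 * b) * (90 * (r ^ b * a)) = 0] (mod 91)"
    using cong_trans by metis
  have b9: "[b + 8 * b = 0] (mod 9)" "[8 * b + b = 0] (mod 9)" by (simp_all add: cong_0_iff)
  show "elt a b * elt (90 * (r ^ b * a)) (8 * b) = 1\<^sub>m (2 * N)"
    unfolding elt_mult elt_0_0[symmetric] by (rule elt_cong[OF 1 b9(1)])
  have "r ^ (2 * (8 * b)) * a = r ^ (15 * b) * (r ^ b * a)"
  proof -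
    have "2 * (8 * b) = 15 * b + b" by simp
    then have "r ^ (2 * (8 * b)) = r ^ (15 * b) * r ^ b" by (simp only: power_add)
    then show ?thesis by (simp add: mult_ac)
  qed
  moreover have "[90 * (r ^ b * a) + r ^ (15 * b) * (r ^ b * a) = 90 * (r ^ b * a) + r ^ b * a] (mod 91)"
    by (intro cong_add cong_refl r_pow_cancel) (rule dvd_mult2, simp)
  moreover have "[90 * (r ^ b * a) + r ^ b * a = 0] (mod 91)" by (simp add: cong_0_iff)
  ultimately have 2: "[90 * (r ^ b * a) + r ^ (2 * (8 * b)) * a = 0] (mod 91)"
    using cong_trans by metis
  show "elt (90 * (r ^ b * a)) (8 * b) * elt a b = 1\<^sub>m (2 * N)"
    unfolding elt_mult elt_0_0[symmetric] by (rule elt_cong[OF 2 b9(2)])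
qed

lemma complex_coord_elt:
  assumes "n < N"
  shows "complex_coord (mat_act (elt a b) x) ((\<pi> ^^ b) n) = root819 (9 * (a * weight ((\<pi> ^^ b) n)) + 91 * b) * complex_coord x n"
  unfolding elt_def by (rule complex_coord_monomial[OF bij_\<pi>_pow assms])

text \<open>A nonzero coordinate is followed three times along \<open>\<pi> ^^ b\<close>, back to
  itself. The 9-part of the root collected is that of exponent 3 b, so 9 divides 3 b and hence 3
  divides b. The matrix is then diagonal, and a single entry equal to 1 forces both divisibilities,
  weights being units.\<close>

lemma elt_fixed_point:
  assumes x: "x \<in> topspace (nsphere (2 * N - 1))" and fixed: "mat_act (elt a b) x = x"
  shows "91 dvd a" "9 dvd b"
proof -
  have "\<exists>n<N. complex_coord x n \<noteq> 0"
  proof (rule ccontr)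
    assume "\<not> (\<exists>n<N. complex_coord x n \<noteq> 0)"
    then have "x = (\<lambda>_. 0)"
      using x k by (intro complex_coord_eqI[of N]) (auto simp: topspace_nsphere complex_coord_def complex_eq_iff)
    then show False using x by (simp add: topspace_nsphere)
  qed
  then obtain n where n: "n < N" "complex_coord x n \<noteq> 0" by blast
  define \<theta> where "\<theta> m = 9 * (a * weight ((\<pi> ^^ b) m)) + 91 * b" for m
  let ?\<sigma> = "\<pi> ^^ b"
  have step: "complex_coord x (?\<sigma> m) = root819 (\<theta> m) * complex_coord x m" if "m < N" for m
    using complex_coord_elt[OF that, of a b x] fixed by (simp add: \<theta>_def)
  have \<sigma>_less: "?\<sigma> m < N" if "m < N" for m
    using bij_betwE[OF bij_\<pi>_pow] that by auto
  have "?\<sigma> (?\<sigma> (?\<sigma> n)) = (\<pi> ^^ (b + (b + b))) n" by (simp add: funpow_add)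
  also have "\<dots> = n" by (rule \<pi>_pow_dvd) presburger
  finally have \<sigma>3: "?\<sigma> (?\<sigma> (?\<sigma> n)) = n" .
  have "complex_coord x n = root819 (\<theta> (?\<sigma> (?\<sigma> n)) + \<theta> (?\<sigma> n) + \<theta> n) * complex_coord x n"
    using step[OF \<sigma>_less[OF \<sigma>_less[OF n(1)]]] step[OF \<sigma>_less[OF n(1)]] step[OF n(1)]
    by (simp add: \<sigma>3 root819_add mult_ac)
  then have "819 dvd \<theta> (?\<sigma> (?\<sigma> n)) + \<theta> (?\<sigma> n) + \<theta> n"
    using n(2) by (simp add: root819_eq_1_iff[symmetric])
  also have "\<theta> (?\<sigma> (?\<sigma> n)) + \<theta> (?\<sigma> n) + \<theta> n
      = 9 * (a * weight (?\<sigma> (?\<sigma> (?\<sigma> n))) + a * weight (?\<sigma> (?\<sigma> n)) + a * weight (?\<sigma> n)) + 91 * (3 * b)"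
    by (simp add: \<theta>_def)
  finally have "9 dvd 3 * b" by (rule dvd_9_91(2))
  then have b3: "3 dvd b" by presburger
  have "complex_coord x n = root819 (\<theta> n) * complex_coord x n"
    using step[OF n(1)] \<pi>_pow_dvd[OF b3] by simp
  then have "819 dvd \<theta> n" using n(2) by (simp add: root819_eq_1_iff[symmetric])
  then have d: "91 dvd a * weight (?\<sigma> n)" "9 dvd b" unfolding \<theta>_def by (rule dvd_9_91)+
  then show "91 dvd a" "9 dvd b"
    using coprime_weight[of "?\<sigma> n"] by (auto simp: coprime_dvd_mult_left_iff coprime_commute)
qed

lemma elt_eq_one_iff: "elt a b = 1\<^sub>m (2 * N) \<longleftrightarrow> 91 dvd a \<and> 9 dvd b"
proof
  assume eq: "elt a b = 1\<^sub>m (2 * N)"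
  let ?x = "\<lambda>n. if n = 0 then 1 else (0::real)"
  have x: "?x \<in> topspace (nsphere (2 * N - 1))" by (rule in_topspace_nsphere)
  have "mat_act (elt a b) ?x = ?x"
    unfolding eq by (rule mat_act_one) (use k in \<open>auto simp: topspace_Euclidean_space\<close>)
  then show "91 dvd a \<and> 9 dvd b" using elt_fixed_point[OF x] by blast
next
  assume "91 dvd a \<and> 9 dvd b"
  then show "elt a b = 1\<^sub>m (2 * N)"
    unfolding elt_0_0[symmetric] by (intro elt_cong) (auto simp: cong_0_iff)
qed

lemma elt_eqD:
  assumes "elt a b = elt a' b'"
  shows "[a = a'] (mod 91)" "[b = b'] (mod 9)"
proof -
  have "elt a b * elt (90 * (r ^ b' * a')) (8 * b') = 1\<^sub>m (2 * N)"
    using elt_inverse(1)[of a' b'] assms by simp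
  then have 1: "91 dvd a + r ^ (2 * b) * (90 * (r ^ b' * a'))" "9 dvd b + 8 * b'"
    unfolding elt_mult elt_eq_one_iff by simp_all
  show bb: "[b = b'] (mod 9)"
  proof -
    have "[b + 8 * b' = b' + 8 * b'] (mod 9)" using 1(2) by (simp add: cong_def)
    then show ?thesis by (simp only: cong_add_rcancel_nat)
  qed
  \<comment> \<open>As b and b' agree modulo 9, this is 3 b modulo 3.\<close>
  have "3 dvd 2 * b + b'"
    using bb unfolding cong_def by presburger
  then have "[r ^ (2 * b + b') * (90 * a') = 90 * a'] (mod 91)" by (rule r_pow_cancel)
  then have "[a + r ^ (2 * b) * (90 * (r ^ b' * a')) = a + 90 * a'] (mod 91)"
    by (intro cong_add cong_refl) (simp add: power_add mult_ac)
  moreover have "[a + r ^ (2 * b) * (90 * (r ^ b' * a')) = a' + 90 * a'] (mod 91)"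
    using 1(1) by (simp add: cong_def)
  ultimately have "[a + 90 * a' = a' + 90 * a'] (mod 91)" using cong_sym cong_trans by blast
  then show "[a = a'] (mod 91)" by (simp only: cong_add_rcancel_nat)
qed

definition G :: "real mat set" where
  "G = {elt a b |a b. True}"

lemma elt_in_G [simp]: "elt a b \<in> G"
  by (auto simp: G_def)

lemma G_subset: "G \<subseteq> monomial_group N"
  by (auto simp: G_def elt_monomial_group)

text \<open>The normal form of the 819 elements, by which the two groups are matched one to
  one.\<close>

lemma bij_betw_elt: "bij_betw (\<lambda>(a, b). elt a b) ({..<91} \<times> {..<9}) G"
proof (rule bij_betw_imageI)
  show "inj_on (\<lambda>(a, b). elt a b) ({..<91} \<times> {..<9})"
  proof (rule inj_onI)
    fix p p' assume pp: "p \<in> {..<91} \<times> {..<9}" "p' \<in> {..<91} \<times> {..<9}"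
      and eq: "(case p of (a, b) \<Rightarrow> elt a b) = (case p' of (a, b) \<Rightarrow> elt a b)"
    obtain a b a' b' where p: "p = (a, b)" "p' = (a', b')" by (cases p, cases p') auto
    have "elt a b = elt a' b'" using eq p by simp
    from elt_eqD[OF this] show "p = p'" using pp p by (simp add: cong_def)
  qed
  show "(\<lambda>(a, b). elt a b) ` ({..<91} \<times> {..<9}) = G"
  proof (intro equalityI subsetI)
    fix A assume "A \<in> G"
    then obtain a b where "A = elt a b" by (auto simp: G_def)
    also have "\<dots> = elt (a mod 91) (b mod 9)" by (rule elt_cong) (simp_all add: cong_def)
    finally show "A \<in> (\<lambda>(a, b). elt a b) ` ({..<91} \<times> {..<9})"
      by (intro image_eqI[of _ _ "(a mod 91, b mod 9)"]) auto
  qed auto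
qed

lemma spherical_space_form_G: "spherical_space_form (2 * N - 1, G)"
proof -
  have N: "2 * N - 1 + 1 = 2 * N" using k by simp
  interpret O: group "orthogonal_group (2 * N)" by (rule group_orthogonal_group)
  have sub: "G \<subseteq> carrier (orthogonal_group (2 * N))"
    using G_subset monomial_group_subset by blast
  have "subgroup G (orthogonal_group (2 * N))"
  proof (rule O.subgroupI[OF sub])
    show "G \<noteq> {}" using elt_in_G by blast
    fix A assume "A \<in> G"
    then obtain a b where A: "A = elt a b" by (auto simp: G_def)
    have "inv\<^bsub>orthogonal_group (2 * N)\<^esub> A = elt (90 * (r ^ b * a)) (8 * b)"
      unfolding A by (rule O.inv_equality) (use elt_inverse(2) sub elt_in_G in auto)
    then show "inv\<^bsub>orthogonal_group (2 * N)\<^esub> A \<in> G" by simp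
  next
    fix A B assume "A \<in> G" "B \<in> G"
    then obtain a b a' b' where "A = elt a b" "B = elt a' b'" by (auto simp: G_def)
    then show "A \<otimes>\<^bsub>orthogonal_group (2 * N)\<^esub> B \<in> G" by (simp add: elt_mult)
  qed
  moreover have "finite G"
    using G_subset finite_monomial_group finite_subset by blast
  moreover have "A = 1\<^sub>m (2 * N)" if "A \<in> G" "x \<in> topspace (nsphere (2 * N - 1))" "mat_act A x = x" for A x
  proof -
    obtain a b where "A = elt a b" using \<open>A \<in> G\<close> by (auto simp: G_def)
    then show ?thesis using elt_fixed_point[OF that(2)] that(3) elt_eq_one_iff by blast
  qed
  ultimately show ?thesis
    unfolding spherical_space_form_def prod.case N using k by auto
qed

end

text \<open>Both products are required to be the identity so that \<open>S\<close> and
  \<open>T\<close> can exchange roles in the proof of symmetry.\<close>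

definition monomially_conjugate :: "nat \<Rightarrow> real mat \<Rightarrow> real mat \<Rightarrow> bool" where
  "monomially_conjugate N A B \<longleftrightarrow> (\<exists>S\<in>monomial_group N. \<exists>T\<in>monomial_group N.
     B = T * A * S \<and> S * T = 1\<^sub>m (2 * N) \<and> T * S = 1\<^sub>m (2 * N))"

lemma monomial_group_carrier: "A \<in> monomial_group N \<Longrightarrow> A \<in> carrier_mat (2 * N) (2 * N)"
  by (auto simp: monomial_group_def)

lemma monomial_group_assoc:
  assumes "A \<in> monomial_group N" "B \<in> monomial_group N" "C \<in> monomial_group N"
  shows "A * B * C = A * (B * C)"
  by (rule assoc_mult_mat[OF assms[THEN monomial_group_carrier]])

lemma monomial_group_one:
  assumes "A \<in> monomial_group N"
  shows "A * 1\<^sub>m (2 * N) = A" "1\<^sub>m (2 * N) * A = A"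
  using monomial_group_carrier[OF assms] by simp_all

lemma monomially_conjugate_sym:
  assumes A: "A \<in> monomial_group N" and "monomially_conjugate N A B"
  shows "monomially_conjugate N B A"
proof -
  obtain S T where ST: "S \<in> monomial_group N" "T \<in> monomial_group N" "B = T * A * S"
    "S * T = 1\<^sub>m (2 * N)" "T * S = 1\<^sub>m (2 * N)"
    using assms(2) by (auto simp: monomially_conjugate_def)
  note m = A ST(1,2) monomial_group_mult
  have "S * B * T = (S * T) * A * (S * T)"
    unfolding ST(3) by (simp only: monomial_group_assoc[where N = N] m)
  also have "\<dots> = A" by (simp only: ST(4) monomial_group_one A)
  finally show ?thesis
    unfolding monomially_conjugate_def using ST by metis
qed

lemma monomially_conjugate_trans:
  assumes A: "A \<in> monomial_group N" and "monomially_conjugate N A B" "monomially_conjugate N B C"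
  shows "monomially_conjugate N A C"
proof -
  obtain S T where ST: "S \<in> monomial_group N" "T \<in> monomial_group N" "B = T * A * S"
    "S * T = 1\<^sub>m (2 * N)" "T * S = 1\<^sub>m (2 * N)"
    using assms(2) by (auto simp: monomially_conjugate_def)
  obtain S' T' where ST': "S' \<in> monomial_group N" "T' \<in> monomial_group N" "C = T' * B * S'"
    "S' * T' = 1\<^sub>m (2 * N)" "T' * S' = 1\<^sub>m (2 * N)"
    using assms(3) by (auto simp: monomially_conjugate_def)
  note m = A ST(1,2) ST'(1,2) monomial_group_mult
  have "C = T' * T * A * (S * S')"
    unfolding ST'(3) ST(3) by (simp only: monomial_group_assoc[where N = N] m)
  moreover have "S * S' * (T' * T) = 1\<^sub>m (2 * N)"
  proof -
    have "S * S' * (T' * T) = S * (S' * T') * T" by (simp only: monomial_group_assoc[where N = N] m)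
    then show ?thesis by (simp only: ST'(4) monomial_group_one ST(1,4))
  qed
  moreover have "T' * T * (S * S') = 1\<^sub>m (2 * N)"
  proof -
    have "T' * T * (S * S') = T' * (T * S) * S'" by (simp only: monomial_group_assoc[where N = N] m)
    then show ?thesis by (simp only: ST(5) monomial_group_one ST'(2,5))
  qed
  ultimately show ?thesis
    unfolding monomially_conjugate_def using m by blast
qed

context metacyclic
begin

text \<open>Conjugation by A^y adds (1 - r^(2b)) y to the exponent of A. As 3 does not divide b,
  that factor is 1 - r or 1 - r^2 modulo 91, a unit, so the exponent can be brought to 0.\<close>

lemma elt_conjugate_power:
  assumes b: "\<not> 3 dvd b"
  shows "monomially_conjugate N (elt a b) (elt 0 b)"
proof -
  have cop: "coprime (1 + 90 * r ^ (2 * b)) 91"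
  proof -
    have r_mod: "[r ^ (2 * b) = r ^ (2 * b mod 3)] (mod 91)"
    proof -
      have "r ^ (2 * b) = r ^ (3 * (2 * b div 3)) * r ^ (2 * b mod 3)"
        by (simp flip: power_add)
      then show ?thesis using r_pow_cancel[of "3 * (2 * b div 3)"] by simp
    qed
    have "2 * b mod 3 = 1 \<or> 2 * b mod 3 = 2" using b by presburger
    then have "coprime (1 + 90 * r ^ (2 * b mod 3)) 91" using r_unit by auto
    moreover have "[1 + 90 * r ^ (2 * b) = 1 + 90 * r ^ (2 * b mod 3)] (mod 91)"
      by (intro cong_add cong_mult cong_refl r_mod)
    ultimately show ?thesis using cong_imp_coprime cong_sym by blast
  qed
  obtain z where z: "[(1 + 90 * r ^ (2 * b)) * z = Suc 0] (mod 91)"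
    using cong_solve_coprime_nat[OF cop] by blast
  \<comment> \<open>This is - a z, with z the inverse of 1 - r^(2b).\<close>
  define y where "y = 90 * a * z"
  have "elt y 0 * elt a b * elt (90 * y) 0 = elt (y + a + r ^ (2 * b) * (90 * y)) b"
    by (simp add: elt_mult)
  also have "\<dots> = elt 0 b"
  proof (rule elt_cong)
    have "y + a + r ^ (2 * b) * (90 * y) = 90 * a * ((1 + 90 * r ^ (2 * b)) * z) + a"
      by (simp add: y_def algebra_simps)
    also have "[90 * a * ((1 + 90 * r ^ (2 * b)) * z) + a = 90 * a * Suc 0 + a] (mod 91)"
      by (intro cong_add cong_mult cong_refl z)
    also have "[90 * a * Suc 0 + a = 0] (mod 91)" by (simp add: cong_0_iff)
    finally show "[y + a + r ^ (2 * b) * (90 * y) = 0] (mod 91)" .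
  qed simp
  finally have "elt 0 b = elt y 0 * elt a b * elt (90 * y) 0" by simp
  moreover have "elt (90 * y) 0 * elt y 0 = 1\<^sub>m (2 * N)" "elt y 0 * elt (90 * y) 0 = 1\<^sub>m (2 * N)"
    unfolding elt_mult elt_eq_one_iff by simp_all
  ultimately show ?thesis
    unfolding monomially_conjugate_def using elt_monomial_group by blast
qed

end

text \<open>The indices of the complex coordinates are \<open>9 * c + 3 * i + j\<close> with \<open>i, j < 3\<close>; the first
  two permutations shift \<open>i\<close> and \<open>j\<close> cyclically, and the third one exchanges them.\<close>

definition shift_block :: "nat \<Rightarrow> nat" where
  "shift_block n = (if n mod 9 < 6 then n + 3 else n - 6)"

definition shift_unit :: "nat \<Rightarrow> nat" where
  "shift_unit n = (if n mod 3 < 2 then n + 1 else n - 2)"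

definition exchange :: "nat \<Rightarrow> nat" where
  "exchange n = 9 * (n div 9) + 3 * (n mod 3) + (n mod 9) div 3"

lemma shift_block_eq: "s < 9 \<Longrightarrow> shift_block (9 * c + s) = (if s < 6 then 9 * c + s + 3 else 9 * c + s - 6)"
  by (simp add: shift_block_def)

lemma shift_unit_eq: "j < 3 \<Longrightarrow> shift_unit (3 * m + j) = (if j < 2 then 3 * m + j + 1 else 3 * m + j - 2)"
  by (simp add: shift_unit_def)

lemma exchange_eq:
  assumes "i < 3" "j < 3"
  shows "exchange (9 * c + (3 * i + j)) = 9 * c + (3 * j + i)"
proof -
  have "9 * c + (3 * i + j) = 3 * (3 * c + i) + j" by simp
  then have "(9 * c + (3 * i + j)) mod 3 = j" using assms by (simp only: mod_mult_self4 mod_less)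
  moreover have "3 * i + j < 9" "(3 * i + j) div 3 = i" using assms by auto
  ultimately show ?thesis by (simp add: exchange_def)
qed

lemma block_cases:
  fixes n :: nat
  obtains c i j where "n = 9 * c + (3 * i + j)" "i < 3" "j < 3"
proof -
  have "n = 9 * (n div 9) + (3 * (n mod 9 div 3) + n mod 9 mod 3)" by simp
  moreover have "n mod 9 div 3 < 3" by (simp add: less_mult_imp_div_less)
  moreover have "n mod 9 mod 3 < 3" by simp
  ultimately show ?thesis by (rule that)
qed

lemma less_3_cases: "(i::nat) < 3 \<Longrightarrow> i = 0 \<or> i = 1 \<or> i = 2"
  by auto

lemma exchange_exchange: "exchange (exchange n) = n"
  by (cases n rule: block_cases) (simp add: exchange_eq)

lemma exchange_less:
  assumes "n < 9 * k"
  shows "exchange n < 9 * k"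
proof -
  obtain c i j where n: "n = 9 * c + (3 * i + j)" "i < 3" "j < 3" by (rule block_cases)
  then have "c + 1 \<le> k" using assms by simp
  then show ?thesis using n by (simp add: exchange_eq)
qed

lemma exchange_shift: "exchange (shift_block (exchange n)) = shift_unit n"
proof -
  obtain c i j where n: "n = 9 * c + (3 * i + j)" "i < 3" "j < 3" by (rule block_cases)
  define j' where "j' = (if j < 2 then j + 1 else 0)"
  have j': "j' < 3" using n by (simp add: j'_def)
  have "shift_block (9 * c + (3 * j + i)) = 9 * c + (3 * j' + i)"
    using n less_3_cases[OF n(3)] shift_block_eq[of "3 * j + i" c] by (elim disjE) (simp_all add: j'_def)
  moreover have "shift_unit n = 9 * c + (3 * i + j')"
  proof -
    have n2: "n = 3 * (3 * c + i) + j" using n by simp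
    show ?thesis unfolding n2 shift_unit_eq[OF n(3)] using n(3) by (auto simp: j'_def)
  qed
  ultimately show ?thesis using n j' by (simp add: exchange_eq)
qed

text \<open>The unit conditions hold since 1 - 16 = -15 and 1 - 16^2 = -255 are prime to 91.\<close>

lemma metacyclic_shift_block:
  assumes "k \<ge> 1"
  shows "metacyclic k 16 shift_block"
proof
  fix n :: nat
  obtain c s where n: "n = 9 * c + s" "s < 9"
    by (metis add.commute mod_less_divisor mod_mult_div_eq zero_less_numeral)
  show "shift_block n < 9 * k" if "n < 9 * k"
  proof -
    have "c + 1 \<le> k" using n that by simp
    then show ?thesis using n by (auto simp: shift_block_eq)
  qed
  show "shift_block (shift_block (shift_block n)) = n"
  proof -
    consider "s < 3" | "3 \<le> s" "s < 6" | "6 \<le> s" by linarith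
    then show ?thesis
    proof cases
      case 1
      then show ?thesis
        using n shift_block_eq[of s c] shift_block_eq[of "s + 3" c] shift_block_eq[of "s + 6" c] by (simp add: add.assoc)
    next
      case 2
      then show ?thesis
        using n shift_block_eq[of s c] shift_block_eq[of "s + 3" c] shift_block_eq[of "s - 3" c] by (simp add: add.assoc)
    next
      case 3
      then obtain u where "s = u + 6" by (metis add.commute le_Suc_ex)
      then show ?thesis
        using n shift_block_eq[of s c] shift_block_eq[of u c] shift_block_eq[of "u + 3" c] by (simp add: add.assoc)
    qed
  qed
  show "[weight (shift_block n) = 16 * weight n] (mod 91)"
  proof (cases "s < 6")
    case True
    \<comment> \<open>Moving 3 places multiplies the weight by 16 * 9^3, and 729 = 9^3 is 1 modulo
      91.\<close>
    then have "weight (shift_block n) = 729 * (16 * weight n)"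
      using n by (simp add: shift_block_eq weight_def power_add)
    moreover have "[729 * (16 * weight n) = 1 * (16 * weight n)] (mod 91)"
      by (intro cong_mult cong_refl) (simp add: cong_def)
    ultimately show ?thesis by simp
  next
    case False
    then obtain t where t: "s = t + 6" by (metis add.commute le_Suc_ex not_less)
    have "(9 * c + (t + 6)) div 3 = (9 * c + t) div 3 + 2" by presburger
    \<comment> \<open>256 is 16^2 and 531441 is 9^6, the factors gained over two blocks; with the
      extra 16 they give 16^3 9^6, which is 1 modulo 91.\<close>
    then have "16 * weight n = 16 * (256 * 531441) * weight (9 * c + t)"
      by (simp add: n t weight_def power_add)
    moreover have "[16 * (256 * 531441) * weight (9 * c + t) = 1 * weight (9 * c + t)] (mod 91)"
      by (intro cong_mult cong_refl) (simp add: cong_def)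
    moreover have "shift_block n = 9 * c + t" using n t False by (simp add: shift_block_eq)
    ultimately show ?thesis by (simp add: cong_sym)
  qed
qed (use assms in \<open>simp_all add: cong_def coprime_iff_gcd_eq_1 gcd_non_0_nat\<close>)

text \<open>Here 1 - 9 = -8 and 1 - 9^2 = -80 are prime to 91. A cycle of three closes up because
  9^3 = 729 is 1 modulo 91.\<close>

lemma metacyclic_shift_unit:
  assumes "k \<ge> 1"
  shows "metacyclic k 9 shift_unit"
proof
  fix n :: nat
  obtain m j where n: "n = 3 * m + j" "j < 3"
    by (metis add.commute mod_less_divisor mod_mult_div_eq zero_less_numeral)
  have j: "j = 0 \<or> j = 1 \<or> j = 2" using n(2) by (rule less_3_cases)
  show "shift_unit n < 9 * k" if "n < 9 * k"
  proof -
    have "m + 1 \<le> 3 * k" using n that by simp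
    then show ?thesis using n shift_unit_eq[of j m] by auto
  qed
  show "shift_unit (shift_unit (shift_unit n)) = n"
    using j n shift_unit_eq[of 0 m] shift_unit_eq[of 1 m] shift_unit_eq[of 2 m] by auto
  show "[weight (shift_unit n) = 9 * weight n] (mod 91)"
  proof (cases "j < 2")
    case True
    then have "shift_unit n = n + 1" "(n + 1) div 3 = n div 3" using n shift_unit_eq[of j m] by auto
    then show ?thesis by (simp add: weight_def mult.left_commute)
  next
    case False
    then have "j = 2" using n by simp
    then have "9 * weight n = 729 * weight (3 * m)"
      by (simp add: n weight_def power_add)
    moreover have "[729 * weight (3 * m) = 1 * weight (3 * m)] (mod 91)"
      by (intro cong_mult cong_refl) (simp add: cong_def)
    moreover have "shift_unit n = 3 * m" using n \<open>j = 2\<close> shift_unit_eq[of 2 m] by simp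
    ultimately show ?thesis by (simp add: cong_sym)
  qed
qed (use assms in \<open>simp_all add: cong_def coprime_iff_gcd_eq_1 gcd_non_0_nat\<close>)

definition block_group :: "nat \<Rightarrow> real mat set" where
  "block_group k = metacyclic.G k shift_block"

definition unit_group :: "nat \<Rightarrow> real mat set" where
  "unit_group k = metacyclic.G k shift_unit"

text \<open>The exchange does not respect the weights. With first exponent 0 these drop out: what
  remains is a scalar times a permutation, and the permutations are conjugate.\<close>

lemma exchange_conjugate:
  assumes k: "k \<ge> 1"
  shows "monomially_conjugate (9 * k) (metacyclic.elt k shift_block 0 b) (metacyclic.elt k shift_unit 0 b)"
proof -
  interpret B: metacyclic k 16 shift_block by (rule metacyclic_shift_block[OF k])
  interpret U: metacyclic k 9 shift_unit by (rule metacyclic_shift_unit[OF k])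
  define Q where "Q = monomial_mat (9 * k) exchange (\<lambda>_. 0)"
  have bij: "bij_betw exchange {..<9 * k} {..<9 * k}"
    by (rule bij_betw_byWitness[where f' = exchange]) (auto simp: exchange_exchange exchange_less)
  have Q: "Q \<in> monomial_group (9 * k)" using bij by (auto simp: Q_def monomial_group_def)
  have "Q * Q = monomial_mat (9 * k) (exchange \<circ> exchange) (\<lambda>n. 0 + 0)"
    unfolding Q_def by (rule monomial_mat_mult[OF bij bij])
  also have "\<dots> = 1\<^sub>m (2 * (9 * k))"
    unfolding monomial_mat_one[symmetric]
    by (rule monomial_mat_cong[OF bij_betw_trans[OF bij bij]]) (auto simp: exchange_exchange)
  finally have QQ: "Q * Q = 1\<^sub>m (2 * (9 * k))" .
  have pow: "exchange ((shift_block ^^ b) (exchange n)) = (shift_unit ^^ b) n" for n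
  proof (induction b)
    case (Suc b)
    have "exchange ((shift_block ^^ Suc b) (exchange n))
        = exchange (shift_block (exchange (exchange ((shift_block ^^ b) (exchange n)))))"
      by (simp add: exchange_exchange)
    then show ?case by (simp add: exchange_shift Suc.IH)
  qed (simp add: exchange_exchange)
  have "B.elt 0 b * Q = monomial_mat (9 * k) (shift_block ^^ b \<circ> exchange) (\<lambda>n. 0 + (9 * (0 * weight ((shift_block ^^ b) (exchange n))) + 91 * b))"
    unfolding B.elt_def Q_def by (rule monomial_mat_mult[OF B.bij_\<pi>_pow bij])
  then have "Q * (B.elt 0 b * Q) = monomial_mat (9 * k) (exchange \<circ> (shift_block ^^ b \<circ> exchange))
      (\<lambda>n. 0 + (9 * (0 * weight ((shift_block ^^ b) (exchange n))) + 91 * b) + 0)"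
    unfolding Q_def by (simp only: monomial_mat_mult[OF bij bij_betw_trans[OF bij B.bij_\<pi>_pow]])
  also have "\<dots> = U.elt 0 b"
    unfolding U.elt_def
    by (rule monomial_mat_cong[OF bij_betw_trans[OF bij_betw_trans[OF bij B.bij_\<pi>_pow] bij]]) (auto simp: pow)
  finally have "U.elt 0 b = Q * B.elt 0 b * Q"
    by (simp only: monomial_group_assoc[OF Q B.elt_monomial_group Q])
  then show ?thesis
    unfolding monomially_conjugate_def using Q QQ by blast
qed

lemma
  assumes k: "k \<ge> 1"
  shows spherical_space_form_block: "spherical_space_form (18 * k - 1, block_group k)"
    and spherical_space_form_unit: "spherical_space_form (18 * k - 1, unit_group k)"
  using metacyclic.spherical_space_form_G[OF metacyclic_shift_block[OF k]]
    metacyclic.spherical_space_form_G[OF metacyclic_shift_unit[OF k]]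
  by (simp_all add: block_group_def unit_group_def)

lemma isospectral_block_unit:
  assumes k: "k \<ge> 1"
  shows "isospectral (18 * k - 1, block_group k) (18 * k - 1, unit_group k)"
proof -
  interpret B: metacyclic k 16 shift_block by (rule metacyclic_shift_block[OF k])
  interpret U: metacyclic k 9 shift_unit by (rule metacyclic_shift_unit[OF k])
  let ?R = "{..<91} \<times> {..<9::nat}"
  let ?b = "\<lambda>(a, b). B.elt a b" and ?u = "\<lambda>(a, b). U.elt a b"
  \<comment> \<open>Elements with the same pair of exponents in normal form are matched.\<close>
  define \<beta> where "\<beta> = ?u \<circ> inv_into ?R ?b"
  have dim: "18 * k - 1 + 1 = 2 * (9 * k)" using k by simp
  have \<beta>: "bij_betw \<beta> B.G U.G"
    unfolding \<beta>_def by (rule bij_betw_trans[OF bij_betw_inv_into[OF B.bij_betw_elt] U.bij_betw_elt])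
  have conj: "monomially_conjugate (9 * k) (B.elt a b) (U.elt a b)" for a b
  proof (cases "3 dvd b")
    case True
    have "B.elt a b = U.elt a b"
      unfolding B.elt_def U.elt_def
      by (rule monomial_mat_cong[OF B.bij_\<pi>_pow]) (simp_all add: B.\<pi>_pow_dvd[OF True] U.\<pi>_pow_dvd[OF True])
    moreover have one: "1\<^sub>m (2 * (9 * k)) \<in> monomial_group (9 * k)"
      using B.elt_monomial_group[of 0 0] by (simp only: B.elt_0_0)
    ultimately show ?thesis
      unfolding monomially_conjugate_def
      by (intro bexI[OF _ one]) (simp only: monomial_group_one[OF U.elt_monomial_group] monomial_group_one[OF one])
  next
    case False
    \<comment> \<open>The chain leads through the power of B in the first group and that in the
      second to \<open>U.elt a b\<close>.\<close>
    have "monomially_conjugate (9 * k) (B.elt a b) (U.elt 0 b)"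
      by (rule monomially_conjugate_trans[OF B.elt_monomial_group B.elt_conjugate_power[OF False] exchange_conjugate[OF k]])
    then show ?thesis
      by (rule monomially_conjugate_trans[OF B.elt_monomial_group])
        (rule monomially_conjugate_sym[OF U.elt_monomial_group U.elt_conjugate_power[OF False]])
  qed
  show ?thesis
    unfolding block_group_def unit_group_def
  proof (rule isospectral_of_almost_conjugate[where \<Gamma> = "monomial_group (9 * k)", OF _ _ _ finite_monomial_group
        monomial_group_mult B.G_subset U.G_subset \<beta>])
    show "spherical_space_form (18 * k - 1, B.G)" "spherical_space_form (18 * k - 1, U.G)"
      using spherical_space_form_block[OF k] spherical_space_form_unit[OF k] by (simp_all add: block_group_def unit_group_def)
    show "monomial_group (9 * k) \<subseteq> carrier (orthogonal_group (18 * k - 1 + 1))"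
      unfolding dim by (rule monomial_group_subset)
    fix A assume A: "A \<in> B.G"
    obtain a b where ab: "inv_into ?R ?b A = (a, b)" by (cases "inv_into ?R ?b A")
    have "?b (inv_into ?R ?b A) = A"
      using bij_betw_inv_into_right[OF B.bij_betw_elt A] .
    then have "A = B.elt a b" "\<beta> A = U.elt a b" by (simp_all add: \<beta>_def ab)
    then obtain S T where "S \<in> monomial_group (9 * k)" "T \<in> monomial_group (9 * k)"
      "\<beta> A = T * A * S" "S * T = 1\<^sub>m (2 * (9 * k))"
      using conj[of a b] by (auto simp: monomially_conjugate_def)
    then show "\<exists>S\<in>monomial_group (9 * k). \<exists>T\<in>monomial_group (9 * k). \<beta> A = T * A * S \<and> S * T = 1\<^sub>m (18 * k - 1 + 1)"
      unfolding dim by blast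
  qed
qed

text \<open>Comparing the actions on the cyclic subgroups of order 91, an isomorphism would give
  \<open>16\<^sup>2 * u = 9 ^ (2 * d) * u\<close> modulo 91 for some \<open>u\<close> prime to 91, but \<open>16\<^sup>2\<close> is not a power
  of 9 modulo 91.\<close>

lemma not_isomorphic_block_unit:
  assumes k: "k \<ge> 1"
  shows "\<not> (orthogonal_group (18 * k))\<lparr>carrier := block_group k\<rparr> \<cong> (orthogonal_group (18 * k))\<lparr>carrier := unit_group k\<rparr>"
proof
  interpret B: metacyclic k 16 shift_block by (rule metacyclic_shift_block[OF k])
  interpret U: metacyclic k 9 shift_unit by (rule metacyclic_shift_unit[OF k])
  assume "(orthogonal_group (18 * k))\<lparr>carrier := block_group k\<rparr> \<cong> (orthogonal_group (18 * k))\<lparr>carrier := unit_group k\<rparr>"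
  then obtain h where h: "bij_betw h B.G U.G" and hom: "\<And>A C. A \<in> B.G \<Longrightarrow> C \<in> B.G \<Longrightarrow> h (A * C) = h A * h C"
    by (auto simp: is_iso_def iso_def hom_def block_group_def unit_group_def)
  have hG: "\<exists>u v. h A = U.elt u v" if "A \<in> B.G" for A
    using bij_betwE[OF h] that by (auto simp: U.G_def)
  have hom_elt: "h (B.elt a b * B.elt a' b') = h (B.elt a b) * h (B.elt a' b')" for a b a' b'
    by (rule hom) simp_all
  \<comment> \<open>The image of the identity is idempotent; comparing exponents shows that it is
    the identity.\<close>
  have h1: "h (B.elt 0 0) = U.elt 0 0"
  proof -
    obtain x y where xy: "h (B.elt 0 0) = U.elt x y" using hG[of "B.elt 0 0"] by auto
    have "U.elt x y * U.elt x y = U.elt x y"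
      using hom_elt[of 0 0 0 0] by (simp add: B.elt_mult xy)
    then have eq: "U.elt (x + 9 ^ (2 * y) * x) (y + y) = U.elt x y" by (simp only: U.elt_mult)
    have "[y + y = 0 + y] (mod 9)" using U.elt_eqD(2)[OF eq] by simp
    then have y: "[y = 0] (mod 9)" by (simp only: cong_add_rcancel_nat)
    then have "3 dvd 2 * y" unfolding cong_def by presburger
    then have c: "[9 ^ (2 * y) * x = x] (mod 91)" by (rule U.r_pow_cancel)
    have "[x + x = x + 9 ^ (2 * y) * x] (mod 91)" by (rule cong_add[OF cong_refl cong_sym[OF c]])
    from cong_trans[OF this U.elt_eqD(1)[OF eq]] have "[x + x = 0 + x] (mod 91)" by simp
    then have "[x = 0] (mod 91)" by (simp only: cong_add_rcancel_nat)
    then show ?thesis unfolding xy by (rule U.elt_cong) (rule y)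
  qed
  obtain u v where uv: "h (B.elt 1 0) = U.elt u v" using hG[of "B.elt 1 0"] by auto
  \<comment> \<open>Second exponents add, so the 91st power of A gives 91 v = 0 modulo 9; as 91 is 1
    modulo 9, v = 0 follows.\<close>
  have "\<exists>s. h (B.elt m 0) = U.elt s (m * v)" for m
  proof (induction m)
    case 0
    show ?case using h1 by auto
  next
    case (Suc m)
    then obtain s where s: "h (B.elt m 0) = U.elt s (m * v)" by blast
    have "B.elt (Suc m) 0 = B.elt m 0 * B.elt 1 0" by (simp add: B.elt_mult)
    then have "h (B.elt (Suc m) 0) = U.elt s (m * v) * U.elt u v" by (simp only: hom_elt s uv)
    also have "\<dots> = U.elt (s + 9 ^ (2 * (m * v)) * u) (Suc m * v)" by (simp add: U.elt_mult add.commute)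
    finally show ?case by blast
  qed
  then obtain s where "h (B.elt 91 0) = U.elt s (91 * v)" by blast
  moreover have "B.elt 91 0 = B.elt 0 0" by (rule B.elt_cong) (simp_all add: cong_def)
  ultimately have "U.elt s (91 * v) = U.elt 0 0" using h1 by simp
  then have "[91 * v = 0] (mod 9)" by (rule U.elt_eqD(2))
  then have v: "[v = 0] (mod 9)" unfolding cong_def by presburger
  have hA: "h (B.elt m 0) = U.elt (m * u) 0" for m
  proof (induction m)
    case 0
    show ?case using h1 by simp
  next
    case (Suc m)
    have "B.elt (Suc m) 0 = B.elt m 0 * B.elt 1 0" by (simp add: B.elt_mult)
    then have "h (B.elt (Suc m) 0) = U.elt (m * u) 0 * U.elt u v" by (simp only: hom_elt Suc.IH uv)
    also have "U.elt u v = U.elt u 0" by (rule U.elt_cong[OF cong_refl v])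
    finally show ?case by (simp add: U.elt_mult add.commute)
  qed
  \<comment> \<open>Injectivity of \<open>h\<close> says that \<open>u\<close> is prime to 91; below
    this is used for the multipliers 1, 7 and 13.\<close>
  have no_kill: "\<not> 91 dvd m * u" if "\<not> 91 dvd m" for m
  proof
    assume "91 dvd m * u"
    then have "U.elt (m * u) 0 = U.elt 0 0" by (intro U.elt_cong) (simp_all add: cong_0_iff)
    then have "h (B.elt m 0) = h (B.elt 0 0)" using hA[of m] h1 by simp
    then have "B.elt m 0 = B.elt 0 0"
      using h by (auto simp: bij_betw_def inj_on_def)
    from B.elt_eqD(1)[OF this] show False using that by (simp add: cong_0_iff)
  qed
  obtain c d where cd: "h (B.elt 0 1) = U.elt c d" using hG[of "B.elt 0 1"] by auto
  \<comment> \<open>The defining relation B A = A^(16^2) B, whose image under \<open>h\<close>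
    compares 16^2 with a power of 9 as multipliers of \<open>u\<close>.\<close>
  have "B.elt 0 1 * B.elt 1 0 = B.elt (16\<^sup>2) 0 * B.elt 0 1"
    by (simp add: B.elt_mult)
  then have "h (B.elt 0 1) * h (B.elt 1 0) = h (B.elt (16\<^sup>2) 0) * h (B.elt 0 1)"
    using hom_elt by metis
  then have "U.elt c d * U.elt (1 * u) 0 = U.elt (16\<^sup>2 * u) 0 * U.elt c d"
    by (simp only: hA cd)
  then have "U.elt (c + 9 ^ (2 * d) * u) d = U.elt (c + 256 * u) d"
    by (simp add: U.elt_mult add.commute)
  from U.elt_eqD(1)[OF this] have key: "[9 ^ (2 * d) * u = 256 * u] (mod 91)"
    by (simp only: cong_add_lcancel_nat)
  have "[9 ^ (2 * d) * u = 9 ^ (2 * d mod 3) * u] (mod 91)"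
  proof -
    have "(9::nat) ^ (2 * d) * u = 9 ^ (3 * (2 * d div 3)) * (9 ^ (2 * d mod 3) * u)"
      unfolding mult.assoc[symmetric] power_add[symmetric] mult_div_mod_eq ..
    then show ?thesis
      using U.r_pow_cancel[OF dvd_triv_left, of "2 * d div 3" "9 ^ (2 * d mod 3) * u"] by (simp only:)
  qed
  from cong_trans[OF cong_sym[OF this] key]
  have key': "[9 ^ (2 * d mod 3) * u = 256 * u] (mod 91)" .
  have "2 * d mod 3 = 0 \<or> 2 * d mod 3 = 1 \<or> 2 * d mod 3 = 2" by (intro less_3_cases) simp
  then have "9 ^ (2 * d mod 3) \<in> {1, 9, 81::nat}" by (elim disjE) simp_all
  moreover have "\<not> 91 dvd u" "\<not> 91 dvd 7 * u" "\<not> 91 dvd 13 * u" using no_kill[of 1] no_kill[of 7] no_kill[of 13] by simp_all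
  \<comment> \<open>Modulo 7 and 13, 256 is (4, 9), whereas 1, 9 and 81 are (1, 1), (2, 9) and (4,
    3). So 256 - c is a unit, divisible by 13 only, or divisible by 7 only.\<close>
  moreover have "91 dvd u \<or> 91 dvd 7 * u \<or> 91 dvd 13 * u"
    if cc: "c \<in> {1, 9, 81}" "[c * u = 256 * u] (mod 91)" for c :: nat
  proof -
    have d: "91 dvd (256 - c) * u"
    proof -
      have "c * u \<le> 256 * u" using cc(1) by auto
      then have "91 dvd 256 * u - c * u"
        using cong_sym[OF cc(2)] by (simp add: cong_altdef_nat)
      then show ?thesis by (simp only: diff_mult_distrib)
    qed
    consider "c = 1" | "c = 9" | "c = 81" using cc(1) by blast
    then show ?thesis
    proof cases
      case 1
      \<comment> \<open>The multipliers 5, 3 and 12 in the three cases reduce 255, 247 and 175 to 1,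
        13 and 7 modulo 91.\<close>
      have "5 * ((256 - c) * u) = u + 91 * (14 * u)" by (simp add: 1)
      then have "91 dvd u + 91 * (14 * u)" using dvd_mult[OF d, of 5] by metis
      then have "91 dvd u" by (simp only: dvd_add_left_iff dvd_triv_left)
      then show ?thesis by blast
    next
      case 2
      have "3 * ((256 - c) * u) = 13 * u + 91 * (8 * u)" by (simp add: 2)
      then have "91 dvd 13 * u + 91 * (8 * u)" using dvd_mult[OF d, of 3] by metis
      then have "91 dvd 13 * u" by (simp only: dvd_add_left_iff dvd_triv_left)
      then show ?thesis by blast
    next
      case 3
      have "12 * ((256 - c) * u) = 7 * u + 91 * (23 * u)" by (simp add: 3)
      then have "91 dvd 7 * u + 91 * (23 * u)" using dvd_mult[OF d, of 12] by metis
      then have "91 dvd 7 * u" by (simp only: dvd_add_left_iff dvd_triv_left)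
      then show ?thesis by blast
    qed
  qed
  ultimately show False using key' by blast
qed

text \<open>The charts on both sides have the same nonempty domain. Were it open in two different
  dimensions, a point could be moved along a coordinate that must vanish in the smaller one.\<close>

lemma isometric_imp_dim_eq:
  assumes "isometric M N" "points M \<noteq> {}"
  shows "fst M = fst N"
proof -
  obtain P where P: "P \<in> points M" using assms(2) by blast
  obtain \<Phi> where "\<forall>P\<in>points M. \<exists>U \<sigma> \<tau>. parametrization M U \<sigma> \<and> parametrization N U \<tau> \<and>
      P \<in> (proj M \<circ> \<sigma>) ` U \<and>
      (\<forall>u\<in>U. \<Phi> (proj M (\<sigma> u)) = proj N (\<tau> u) \<and> metric_mat (fst M) \<sigma> u = metric_mat (fst N) \<tau> u)"
    using assms(1) unfolding isometric_def by blast
  from bspec[OF this P] obtain U \<sigma> \<tau> where "parametrization M U \<sigma>" "parametrization N U \<tau>"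
    "P \<in> (proj M \<circ> \<sigma>) ` U" by blast
  then obtain u where U: "parametrization M U \<sigma>" "parametrization N U \<tau>" "u \<in> U" by blast
  have le: "a \<le> b" if "openin (Euclidean_space a) U" "openin (Euclidean_space b) U" for a b
  proof (rule ccontr)
    assume "\<not> a \<le> b"
    then have ev: "\<forall>\<^sub>F t in nhds (u b). u(b := t) \<in> U"
      using openin_Euclidean_fun_upd[OF that(1) U(3)] by simp
    have zero: "x b = 0" if "x \<in> U" for x
      using openin_subset[OF \<open>openin (Euclidean_space b) U\<close>] that by (auto simp: topspace_Euclidean_space)
    obtain e where e: "e > 0" "\<And>t. dist t (u b) < e \<Longrightarrow> u(b := t) \<in> U"
      using ev unfolding eventually_nhds_metric by blast
    have "u(b := e / 2) \<in> U" using e(1) zero[OF U(3)] by (intro e(2)) (simp add: dist_real_def)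
    from zero[OF this] show False using e(1) by simp
  qed
  show ?thesis
    using le[of "fst M" "fst N"] le[of "fst N" "fst M"] U(1,2) by (simp add: parametrization_def)
qed

section \<open>The pairs of space forms\<close>

theorem theorem1p5:
  shows "\<exists>\<P> :: (space_form \<times> space_form) set.
    infinite \<P> \<and>
    (\<forall>(M\<^sub>1, M\<^sub>2) \<in> \<P>.
       spherical_space_form M\<^sub>1 \<and> spherical_space_form M\<^sub>2 \<and>
       isospectral M\<^sub>1 M\<^sub>2 \<and>
       \<not> isomorphic_fundamental_groups M\<^sub>1 M\<^sub>2) \<and>
    (\<forall>p\<in>\<P>. \<forall>p'\<in>\<P>. p \<noteq> p' \<longrightarrow> \<not> isometric_pairs p p')"
proof -
  define pair where "pair k = ((18 * k - 1, block_group k), (18 * k - 1, unit_group k))" for k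
  have dim_inj: "k = l" if "k \<in> {1..}" "l \<in> {1..}" "18 * k - 1 = 18 * l - 1" for k l :: nat
    using that by auto
  have "inj_on pair {1..}"
  proof (rule inj_onI)
    fix k l :: nat assume kl: "k \<in> {1..}" "l \<in> {1..}" and "pair k = pair l"
    then have "18 * k - 1 = 18 * l - 1" by (simp add: pair_def)
    then show "k = l" by (rule dim_inj[OF kl])
  qed
  then have inf: "infinite (pair ` {1..})"
    by (simp add: finite_image_iff infinite_Ici)
  have pairs: "case p of (M\<^sub>1, M\<^sub>2) \<Rightarrow> spherical_space_form M\<^sub>1 \<and> spherical_space_form M\<^sub>2 \<and>
      isospectral M\<^sub>1 M\<^sub>2 \<and> \<not> isomorphic_fundamental_groups M\<^sub>1 M\<^sub>2" if p: "p \<in> pair ` {1..}" for p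
  proof -
    obtain k where k: "k \<ge> 1" and pk: "p = pair k" using p by auto
    note sf = spherical_space_form_block[OF k] spherical_space_form_unit[OF k]
    have "\<not> isomorphic_fundamental_groups (18 * k - 1, block_group k) (18 * k - 1, unit_group k)"
      using isomorphic_fundamental_groupsD[OF sf] not_isomorphic_block_unit[OF k] k by auto
    then show ?thesis
      unfolding pk pair_def prod.case using sf isospectral_block_unit[OF k] by blast
  qed
  have not_isometric: "\<not> isometric_pairs p p'"
    if pp: "p \<in> pair ` {1..}" "p' \<in> pair ` {1..}" "p \<noteq> p'" for p p'
  proof
    assume iso: "isometric_pairs p p'"
    obtain k l where kl: "k \<in> {1..}" "l \<in> {1..}" and p: "p = pair k" "p' = pair l" using pp by auto
    have "points (18 * k - 1, block_group k) \<noteq> {}"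
      using in_topspace_nsphere by (auto simp: points_def)
    \<comment> \<open>Both members of a pair have the same dimension, so either matching allowed by
      \<open>isometric_pairs\<close> gives this equation.\<close>
    then have "18 * k - 1 = 18 * l - 1"
      using iso isometric_imp_dim_eq[of "fst p"] by (auto simp: isometric_pairs_def p pair_def)
    then have "k = l" by (rule dim_inj[OF kl])
    then show False using pp(3) p by simp
  qed
  show ?thesis
  proof (rule exI[of _ "pair ` {1..}"], intro conjI)
    show "infinite (pair ` {1..})" by (rule inf)
  qed (use pairs not_isometric in blast)+
qed

end
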